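(* Let $L>0$, $\varkappa>0$ and $\theta=\min\{\varkappa/2,1\}$, and let $I_{\rm rod}$ and $I_{\rm rod}^{h,\varepsilon}$ be the continuous and discretized bending-torsion functionals defined in the context, extended by $+\infty$ outside the admissible sets $\mathcal{A}$ and $\mathcal{A}_h$, respectively. Then, as $\varepsilon,h\searrow 0$ (with no restriction on the ratio of $\varepsilon$ and $h$), the functional $I_{\rm rod}^{h,\varepsilon}$ Gamma-converges to $I_{\rm rod}$ with respect to the weak topology of $H^2((0,L);\mathbb{R}^3)\times H^1((0,L);\mathbb{R}^3)$. That is, for all sequences $h\searrow0$, $\varepsilon\searrow0$: (i) whenever $(y_h,b_h)\in H^2\times H^1$ satisfy $y_h\rightharpoonup y$ in $H^2$ and $b_h\rightharpoonup b$ in $H^1$, then $I_{\rm rod}[y,b]\le\liminf I_{\rm rod}^{h,\varepsilon}[y_h,b_h]$; (ii) for every $(y,b)\in H^2\times H^1$ there are $(y_h,b_h)\in H^2\times H^1$ with $y_h\rightharpoonup y$ in $H^2$, $b_h\rightharpoonup b$ in $H^1$ and $\limsup I_{\rm rod}^{h,\varepsilon}[y_h,b_h]\le I_{\rm rod}[y,b]$.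
   Context: All functions are $\mathbb{R}^3$-valued on $[0,L]$; $H^2\times H^1$ means $H^2((0,L);\mathbb{R}^3)\times H^1((0,L);\mathbb{R}^3)$. Boundary conditions. $L_{\rm bc}^{\rm rod}:H^2\times H^1\to Y$ is a linear map into a finite-dimensional linear space $Y$ that only involves linear combinations of the boundary values $y(0),y(L),y'(0),y'(L),b(0),b(L)$ (so periodicity may be encoded), and $\ell_{\rm bc}^{\rm rod}\in Y$ is given. Continuous problem. $$\mathcal{A}=\{(y,b)\in H^2\times H^1:\ L_{\rm bc}^{\rm rod}[y,b]=\ell_{\rm bc}^{\rm rod},\ |y'|=|b|=1,\ y'\cdot b=0 \text{ on }[0,L]\}.$$ It is assumed that the boundary data are such that $\mathcal{A}\neq\emptyset$ and the distance between the endpoints $y(0),y(L)$ is strictly less than $L$. For $(y,b)\in\mathcal{A}$, $$I_{\rm rod}[y,b]=\frac{\varkappa}{2}\int_0^L|y''|^2\,dx+\frac12\int_0^L\big(b'\cdot(y'\times b)\big)^2\,dx,$$ and $I_{\rm rod}[y,b]=+\infty$ for $(y,b)\in (H^2\times H^1)\setminus\mathcal{A}$. Discretization. For each $h$, $\mathcal{N}_h$ is a finite set of nodes in $[0,L]$ containing $0$ and $L$, defining a partition of $[0,L]$ into elements (intervals between neighboring nodes) with maximal element length $h$. $V_{\rm rod}^h\subset H^2\times H^1$ is the set of pairs $(y_h,b_h)$ where $y_h\in C^1([0,L];\mathbb{R}^3)$ is a cubic polynomial on each element and $b_h\in C^0([0,L];\mathbb{R}^3)$ is affine on each element. $\mathcal{I}_h^{1,0}v$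 denotes the continuous, piecewise affine nodal interpolant of $v\in C^0([0,L])$. $Q_h$ is the elementwise averaging operator: $Q_hv(x)=\frac{1}{z'-z}\int_z^{z'}v(\xi)\,d\xi$ for $x\in(z,z')$, where $z<z'$ are neighboring nodes. Set $$\mathcal{A}_h=\{(y_h,b_h)\in V_{\rm rod}^h:\ L_{\rm bc}^{\rm rod}[y_h,b_h]=\ell_{\rm bc}^{\rm rod},\ |y_h'(z)|=|b_h(z)|=1\text{ for all }z\in\mathcal{N}_h\},$$ and for $(y_h,b_h)\in\mathcal{A}_h$ and $\varepsilon>0$ $$I_{\rm rod}^{h,\varepsilon}[y_h,b_h]=\frac{\varkappa}{2}\int_0^L|y_h''|^2dx+\frac{\theta}{2}\int_0^L|b_h'|^2dx-\frac{\theta}{2}\int_0^L(Q_hb_h\cdot y_h'')^2dx+\frac{1}{2\varepsilon}\int_0^L\mathcal{I}_h^{1,0}\big[(y_h'\cdot b_h)^2\big]dx+\frac{1-\theta}{2}\int_0^L\big(b_h'\cdot(y_h'\times Q_hb_h)\big)^2dx,$$ and $I_{\rm rod}^{h,\varepsilon}=+\infty$ on $(H^2\times H^1)\setminus\mathcal{A}_h$. *)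

theory Defs
  imports "HOL-Analysis.Analysis"
begin

text \<open>
  Throughout, a function on \<open>[0,L]\<close> is a function on \<open>real\<close> whose values outside \<open>{0..L}\<close> are
  irrelevant. Elements of \<open>H\<^sup>1\<close> and \<open>H\<^sup>2\<close> are identified with their representatives in
  \<open>C\<^sup>0([0,L])\<close> and \<open>C\<^sup>1([0,L])\<close>, so that pointwise and boundary values are meaningful.
\<close>

type_synonym curve = "real \<Rightarrow> real^3"


subsection \<open>Sobolev spaces on an interval and weak convergence\<close>

definition L2_fun :: "real \<Rightarrow> curve \<Rightarrow> bool" where
  "L2_fun L g \<longleftrightarrow> g \<in> borel_measurable (lebesgue_on {0..L}) \<and>
     integrable (lebesgue_on {0..L}) (\<lambda>x. (norm (g x))\<^sup>2)"

definition test_functions :: "real \<Rightarrow> (real \<Rightarrow> real) set" where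
  "test_functions L = {\<phi>. \<phi> C1_differentiable_on UNIV \<and> closure {x. \<phi> x \<noteq> 0} \<subseteq> {0<..<L}}"

definition is_weak_deriv :: "real \<Rightarrow> curve \<Rightarrow> curve \<Rightarrow> bool" where
  "is_weak_deriv L f g \<longleftrightarrow> (\<forall>\<phi>\<in>test_functions L.
     (LINT x|lebesgue_on {0..L}. deriv \<phi> x *\<^sub>R f x) =
     - (LINT x|lebesgue_on {0..L}. \<phi> x *\<^sub>R g x))"

definition H1 :: "real \<Rightarrow> curve set" where
  "H1 L = {f. continuous_on {0..L} f \<and> (\<exists>g. L2_fun L g \<and> is_weak_deriv L f g)}"

definition H2 :: "real \<Rightarrow> curve set" where
  "H2 L = {y \<in> H1 L. \<exists>p\<in>H1 L. is_weak_deriv L y p}"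

text \<open>The weak derivative of an \<open>H\<^sup>1\<close> function is unique only almost everywhere; some version is
  chosen. It is only ever used under an integral.\<close>

definition wderiv :: "real \<Rightarrow> curve \<Rightarrow> curve" where
  "wderiv L f = (SOME g. L2_fun L g \<and> is_weak_deriv L f g)"

text \<open>The classical derivative, one-sided at the endpoints. For an \<open>H\<^sup>2\<close> function it is the
  continuous version of the weak derivative, and so has values at every point of \<open>[0,L]\<close>.\<close>

definition cderiv :: "real \<Rightarrow> curve \<Rightarrow> curve" where
  "cderiv L y x = vector_derivative y (at x within {0..L})"

abbreviation wderiv2 :: "real \<Rightarrow> curve \<Rightarrow> curve" where
  "wderiv2 L y \<equiv> wderiv L (cderiv L y)"

definition H1_norm :: "real \<Rightarrow> curve \<Rightarrow> real" where
  "H1_norm L f = sqrt ((LINT x|lebesgue_on {0..L}. (norm (f x))\<^sup>2)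
                     + (LINT x|lebesgue_on {0..L}. (norm (wderiv L f x))\<^sup>2))"

definition H2_norm :: "real \<Rightarrow> curve \<Rightarrow> real" where
  "H2_norm L y = sqrt ((LINT x|lebesgue_on {0..L}. (norm (y x))\<^sup>2)
                     + (LINT x|lebesgue_on {0..L}. (norm (cderiv L y x))\<^sup>2)
                     + (LINT x|lebesgue_on {0..L}. (norm (wderiv2 L y x))\<^sup>2))"

definition dual_functional :: "curve set \<Rightarrow> (curve \<Rightarrow> real) \<Rightarrow> (curve \<Rightarrow> real) \<Rightarrow> bool" where
  "dual_functional X nrm F \<longleftrightarrow>
     (\<forall>u\<in>X. \<forall>v\<in>X. F (\<lambda>x. u x + v x) = F u + F v) \<and>
     (\<forall>c. \<forall>u\<in>X. F (\<lambda>x. c *\<^sub>R u x) = c * F u) \<and>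
     (\<exists>C. \<forall>u\<in>X. \<bar>F u\<bar> \<le> C * nrm u)"

definition weakly_converges ::
  "curve set \<Rightarrow> (curve \<Rightarrow> real) \<Rightarrow> (nat \<Rightarrow> curve) \<Rightarrow> curve \<Rightarrow> bool" where
  "weakly_converges X nrm u v \<longleftrightarrow> (\<forall>n. u n \<in> X) \<and> v \<in> X \<and>
     (\<forall>F. dual_functional X nrm F \<longrightarrow> (\<lambda>n. F (u n)) \<longlonglongrightarrow> F v)"

abbreviation weakly_H1 :: "real \<Rightarrow> (nat \<Rightarrow> curve) \<Rightarrow> curve \<Rightarrow> bool" where
  "weakly_H1 L \<equiv> weakly_converges (H1 L) (H1_norm L)"

abbreviation weakly_H2 :: "real \<Rightarrow> (nat \<Rightarrow> curve) \<Rightarrow> curve \<Rightarrow> bool" where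
  "weakly_H2 L \<equiv> weakly_converges (H2 L) (H2_norm L)"


subsection \<open>The continuous problem\<close>

definition boundary_operator :: "real \<Rightarrow> (curve \<Rightarrow> curve \<Rightarrow> 'y::real_vector) \<Rightarrow> bool" where
  "boundary_operator L Lbc \<longleftrightarrow>
     (\<exists>\<Lambda> :: (real^3) \<times> (real^3) \<times> (real^3) \<times> (real^3) \<times> (real^3) \<times> (real^3) \<Rightarrow> 'y. linear \<Lambda> \<and>
       (\<forall>y\<in>H2 L. \<forall>b\<in>H1 L. Lbc y b = \<Lambda> (y 0, y L, cderiv L y 0, cderiv L y L, b 0, b L)))"

definition admissible ::
  "real \<Rightarrow> (curve \<Rightarrow> curve \<Rightarrow> 'y) \<Rightarrow> 'y \<Rightarrow> (curve \<times> curve) set" where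
  "admissible L Lbc lbc = {(y, b). y \<in> H2 L \<and> b \<in> H1 L \<and> Lbc y b = lbc \<and>
     (\<forall>x\<in>{0..L}. norm (cderiv L y x) = 1 \<and> norm (b x) = 1 \<and> cderiv L y x \<bullet> b x = 0)}"

definition I_rod ::
  "real \<Rightarrow> real \<Rightarrow> (curve \<Rightarrow> curve \<Rightarrow> 'y) \<Rightarrow> 'y \<Rightarrow> curve \<Rightarrow> curve \<Rightarrow> ereal" where
  "I_rod L \<kappa> Lbc lbc y b =
     (if (y, b) \<in> admissible L Lbc lbc then ereal (
          \<kappa> / 2 * (LINT x|lebesgue_on {0..L}. (norm (wderiv2 L y x))\<^sup>2)
        + 1 / 2 * (LINT x|lebesgue_on {0..L}. (wderiv L b x \<bullet> cross3 (cderiv L y x) (b x))\<^sup>2))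
      else \<infinity>)"


subsection \<open>Discretization\<close>

definition node_set :: "real \<Rightarrow> real set \<Rightarrow> bool" where
  "node_set L N \<longleftrightarrow> finite N \<and> N \<subseteq> {0..L} \<and> 0 \<in> N \<and> L \<in> N"

definition neighbours :: "real set \<Rightarrow> real \<Rightarrow> real \<Rightarrow> bool" where
  "neighbours N z z' \<longleftrightarrow> z \<in> N \<and> z' \<in> N \<and> z < z' \<and> N \<inter> {z<..<z'} = {}"

definition mesh_size :: "real set \<Rightarrow> real" where
  "mesh_size N = Max {z' - z | z z'. neighbours N z z'}"

definition polynomial_on :: "nat \<Rightarrow> real set \<Rightarrow> curve \<Rightarrow> bool" where
  "polynomial_on k S f \<longleftrightarrow> (\<exists>c. \<forall>x\<in>S. f x = (\<Sum>i\<le>k. x ^ i *\<^sub>R c i))"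

text \<open>The pairs in this space automatically belong to \<open>H\<^sup>2 \<times> H\<^sup>1\<close>.\<close>

definition V_rod :: "real \<Rightarrow> real set \<Rightarrow> (curve \<times> curve) set" where
  "V_rod L N = {(y, b).
     (\<forall>x\<in>{0..L}. y differentiable at x within {0..L}) \<and> continuous_on {0..L} (cderiv L y) \<and>
     (\<forall>z z'. neighbours N z z' \<longrightarrow> polynomial_on 3 {z..z'} y) \<and>
     continuous_on {0..L} b \<and>
     (\<forall>z z'. neighbours N z z' \<longrightarrow> polynomial_on 1 {z..z'} b)}"

text \<open>The nodes enclosing a point of \<open>[0,L]\<close>; both coincide with the point if it is a node.\<close>

definition left_node :: "real set \<Rightarrow> real \<Rightarrow> real" where
  "left_node N x = Max {z \<in> N. z \<le> x}"

definition right_node :: "real set \<Rightarrow> real \<Rightarrow> real" where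
  "right_node N x = Min {z \<in> N. x \<le> z}"

definition nodal_interp :: "real set \<Rightarrow> (real \<Rightarrow> real) \<Rightarrow> real \<Rightarrow> real" where
  "nodal_interp N v x = (let z = left_node N x; z' = right_node N x in
     if z = z' then v z else ((z' - x) * v z + (x - z) * v z') / (z' - z))"

text \<open>The averages are only meaningful off the null set of nodes, where the value here is \<open>0\<close>.\<close>

definition Q_avg :: "real set \<Rightarrow> curve \<Rightarrow> curve" where
  "Q_avg N v x = (let z = left_node N x; z' = right_node N x in
     (1 / (z' - z)) *\<^sub>R (LINT \<xi>|lebesgue_on {z..z'}. v \<xi>))"

definition admissible_h ::
  "real \<Rightarrow> real set \<Rightarrow> (curve \<Rightarrow> curve \<Rightarrow> 'y) \<Rightarrow> 'y \<Rightarrow> (curve \<times> curve) set" where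
  "admissible_h L N Lbc lbc = {(y, b). (y, b) \<in> V_rod L N \<and> Lbc y b = lbc \<and>
     (\<forall>z\<in>N. norm (cderiv L y z) = 1 \<and> norm (b z) = 1)}"

definition I_rod_h ::
  "real \<Rightarrow> real \<Rightarrow> real \<Rightarrow> (curve \<Rightarrow> curve \<Rightarrow> 'y) \<Rightarrow> 'y \<Rightarrow> real set \<Rightarrow> real \<Rightarrow> curve \<Rightarrow> curve \<Rightarrow> ereal"
  where
  "I_rod_h L \<kappa> \<theta> Lbc lbc N \<epsilon> y b =
     (if (y, b) \<in> admissible_h L N Lbc lbc then ereal (
          \<kappa> / 2 * (LINT x|lebesgue_on {0..L}. (norm (wderiv2 L y x))\<^sup>2)
        + \<theta> / 2 * (LINT x|lebesgue_on {0..L}. (norm (wderiv L b x))\<^sup>2)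
        - \<theta> / 2 * (LINT x|lebesgue_on {0..L}. (Q_avg N b x \<bullet> wderiv2 L y x)\<^sup>2)
        + 1 / (2 * \<epsilon>) *
            (LINT x|lebesgue_on {0..L}. nodal_interp N (\<lambda>t. (cderiv L y t \<bullet> b t)\<^sup>2) x)
        + (1 - \<theta>) / 2 *
            (LINT x|lebesgue_on {0..L}. (wderiv L b x \<bullet> cross3 (cderiv L y x) (Q_avg N b x))\<^sup>2))
      else \<infinity>)"

end

theory Submission
  imports Defs
begin

text \<open>
  For the lower bound, compactness turns bounded discrete energy into \<open>y'\<^sub>h \<rightarrow> y'\<close> and
  \<open>Q\<^sub>h b\<^sub>h \<rightarrow> b\<close> pointwise and boundedly, so the discrete energy is a quadratic form in
  \<open>(y''\<^sub>h, b'\<^sub>h)\<close> with strongly converging coefficients. It is convex because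
  \<open>\<theta> \<le> \<kappa> / 2\<close> and \<open>\<bar>Q\<^sub>h b\<^sub>h\<bar> \<le> 1\<close>, so it can be linearised at the weak limit. Its limit is the
  bending-torsion energy, since \<open>b' \<bullet> b = 0\<close> and \<open>b' \<bullet> y' = - b \<bullet> y''\<close> almost everywhere.

  For the upper bound no density argument is needed: the cubic Hermite interpolant of \<open>y\<close> and the
  affine interpolant of \<open>b\<close> satisfy the nodal constraints and the boundary conditions exactly and
  have penalty zero. Their highest derivatives are elementwise \<open>L\<^sup>2\<close> projections of \<open>y''\<close> and
  \<open>b'\<close>, hence converge strongly.
\<close>

section \<open>Square-integrable functions\<close>

text \<open>The obstacle is the subtracted term
  \<open>(Q_avg N b x \<bullet> wderiv2 L y x)\<^sup>2\<close>: taken alone it has the wrong sign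
  for weak lower semicontinuity, so it must stay coupled to the bending term. It is present because
  a share \<theta> of the torsion is written as \<open>|b'|^2 - (b . y'')^2\<close>, which is what
  controls the full derivative of the director. For convexity \<theta> \<le> \<kappa> already
  suffices; the stricter \<theta> \<le> \<kappa> / 2 leaves a quarter of \<kappa> in front of
  \<open>|y''|^2\<close> and so bounds the curve, and \<theta> \<le> 1 keeps the remaining torsion
  coefficient nonnegative. The constraints hold at nodes only. A piecewise affine director with unit
  nodal values stays in the unit ball, but the tangent is piecewise quadratic and may leave it; its
  bound comes from Hoelder continuity. No coupling of \<epsilon> and h arises: the penalty integral
  is at most \<open>2 * \<epsilon> * c\<close> under an energy bound c, and it is zero along the
  recovery sequence. Boundary conditions may involve \<open>y L\<close>, so the interpolant must
  reach this value exactly, which is the purpose of the first moments in the projection.\<close>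

definition sq_integrable :: "'a measure \<Rightarrow> ('a \<Rightarrow> 'b::euclidean_space) \<Rightarrow> bool" where
  "sq_integrable M f \<longleftrightarrow> f \<in> borel_measurable M \<and> integrable M (\<lambda>x. (norm (f x))\<^sup>2)"

lemma L2_fun_iff: "L2_fun L g \<longleftrightarrow> sq_integrable (lebesgue_on {0..L}) g"
  by (simp add: L2_fun_def sq_integrable_def)

lemma sq_integrable_measurable[measurable_dest]:
  "sq_integrable M f \<Longrightarrow> f \<in> borel_measurable M"
  by (simp add: sq_integrable_def)

lemma sq_integrable_norm_sq: "sq_integrable M f \<Longrightarrow> integrable M (\<lambda>x. (norm (f x))\<^sup>2)"
  by (simp add: sq_integrable_def)

lemma abs_inner_le_sum_sq: "\<bar>f \<bullet> g\<bar> \<le> (norm f)\<^sup>2 + (norm g)\<^sup>2"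
proof -
  have "\<bar>f \<bullet> g\<bar> \<le> norm f * norm g" by (rule Cauchy_Schwarz_ineq2)
  also have "\<dots> \<le> (norm f)\<^sup>2 + (norm g)\<^sup>2"
    using sum_squares_bound[of "norm f" "norm g"] mult_nonneg_nonneg[OF norm_ge_zero[of f] norm_ge_zero[of g]]
    by linarith
  finally show ?thesis .
qed

lemma sq_integrable_inner:
  assumes "sq_integrable M f" "sq_integrable M g"
  shows "integrable M (\<lambda>x. f x \<bullet> g x)"
proof (rule Bochner_Integration.integrable_bound)
  show "integrable M (\<lambda>x. (norm (f x))\<^sup>2 + (norm (g x))\<^sup>2)"
    using assms by (auto simp: sq_integrable_def)
  show "(\<lambda>x. f x \<bullet> g x) \<in> borel_measurable M"
    using assms by (auto simp: sq_integrable_def)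
  show "AE x in M. norm (f x \<bullet> g x) \<le> norm ((norm (f x))\<^sup>2 + (norm (g x))\<^sup>2)"
    using abs_inner_le_sum_sq by (intro AE_I2) fastforce
qed

lemma sq_integrable_scaleR:
  assumes "sq_integrable M f" shows "sq_integrable M (\<lambda>x. c *\<^sub>R f x)"
  using assms by (auto simp: sq_integrable_def power_mult_distrib)

lemma sq_integrable_add:
  assumes "sq_integrable M f" "sq_integrable M g"
  shows "sq_integrable M (\<lambda>x. f x + g x)"
proof -
  have "integrable M (\<lambda>x. (norm (f x))\<^sup>2 + (norm (g x))\<^sup>2 + 2 * (f x \<bullet> g x))"
    using assms sq_integrable_inner[OF assms] by (auto simp: sq_integrable_def)
  moreover have "(norm (f x + g x))\<^sup>2 = (norm (f x))\<^sup>2 + (norm (g x))\<^sup>2 + 2 * (f x \<bullet> g x)" for x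
    by (simp add: power2_norm_eq_inner inner_add inner_commute)
  ultimately show ?thesis
    using assms by (auto simp: sq_integrable_def)
qed

lemma sq_integrable_diff:
  assumes "sq_integrable M f" "sq_integrable M g"
  shows "sq_integrable M (\<lambda>x. f x - g x)"
  using sq_integrable_add[OF assms(1) sq_integrable_scaleR[OF assms(2), of "-1"]] by simp

lemma sq_integrable_bound:
  assumes "sq_integrable M f" "g \<in> borel_measurable M" "AE x in M. norm (g x) \<le> B * norm (f x)"
  shows "sq_integrable M g"
  unfolding sq_integrable_def
proof
  show "integrable M (\<lambda>x. (norm (g x))\<^sup>2)"
  proof (rule Bochner_Integration.integrable_bound)
    show "integrable M (\<lambda>x. B\<^sup>2 * (norm (f x))\<^sup>2)"
      using assms(1) by (auto simp: sq_integrable_def)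
    show "AE x in M. norm ((norm (g x))\<^sup>2) \<le> norm (B\<^sup>2 * (norm (f x))\<^sup>2)"
      using assms(3)
    proof eventually_elim
      case (elim x)
      then show ?case using power_mono[OF elim norm_ge_zero, of 2]
        by (simp add: power_mult_distrib)
    qed
  qed (use assms in auto)
qed fact

lemma sq_integrable_bounded:
  assumes "finite_measure M" "g \<in> borel_measurable M" "\<And>x. x \<in> space M \<Longrightarrow> norm (g x) \<le> B"
  shows "sq_integrable M g"
  unfolding sq_integrable_def
proof
  interpret finite_measure M by fact
  show "integrable M (\<lambda>x. (norm (g x))\<^sup>2)"
  proof (rule integrable_const_bound[where B="B\<^sup>2"])
    show "AE x in M. norm ((norm (g x))\<^sup>2) \<le> B\<^sup>2"
      using assms(3) by (intro AE_I2) (simp add: power_mono)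
  qed (use assms in auto)
qed fact

lemma sq_integrable_imp_integrable:
  assumes "finite_measure M" "sq_integrable M f"
  shows "integrable M f"
proof (rule Bochner_Integration.integrable_bound)
  interpret finite_measure M by fact
  show "integrable M (\<lambda>x. (norm (f x))\<^sup>2 + 1)"
    using assms by (auto simp: sq_integrable_def)
  have "norm (f x) \<le> (norm (f x))\<^sup>2 + 1" for x
    using sum_squares_bound[of "norm (f x)" 1] norm_ge_zero[of "f x"] by (simp del: norm_ge_zero)
  then show "AE x in M. norm (f x) \<le> norm ((norm (f x))\<^sup>2 + 1)"
    by (intro AE_I2) fastforce
qed (use assms in \<open>auto simp: sq_integrable_def\<close>)

lemma integral_norm_sq_add:
  assumes "sq_integrable M f" "sq_integrable M g"
  shows "(LINT x|M. (norm (f x + g x))\<^sup>2) =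
    (LINT x|M. (norm (f x))\<^sup>2) + 2 * (LINT x|M. f x \<bullet> g x) + (LINT x|M. (norm (g x))\<^sup>2)"
proof -
  have "(norm (f x + g x))\<^sup>2 = (norm (f x))\<^sup>2 + 2 * (f x \<bullet> g x) + (norm (g x))\<^sup>2" for x
    by (simp add: power2_norm_eq_inner inner_add inner_commute)
  then show ?thesis
    using assms sq_integrable_inner[OF assms] by (simp add: sq_integrable_def)
qed

lemma integral_norm_sq_add_le:
  assumes "sq_integrable M f" "sq_integrable M g"
  shows "(LINT x|M. (norm (f x + g x))\<^sup>2) \<le> 2 * (LINT x|M. (norm (f x))\<^sup>2) + 2 * (LINT x|M. (norm (g x))\<^sup>2)"
proof -
  have "(LINT x|M. (norm (f x - g x))\<^sup>2) \<ge> 0" by simp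
  then show ?thesis
    using integral_norm_sq_add[OF assms] integral_norm_sq_add[OF assms(1) sq_integrable_scaleR[OF assms(2), of "-1"]]
    unfolding scaleR_minus1_left add_uminus_conv_diff inner_minus_right norm_minus_cancel integral_minus
    by linarith
qed

lemma Cauchy_Schwarz_integral:
  assumes "sq_integrable M f" "sq_integrable M g"
  shows "(LINT x|M. f x \<bullet> g x)\<^sup>2 \<le> (LINT x|M. (norm (f x))\<^sup>2) * (LINT x|M. (norm (g x))\<^sup>2)"
proof -
  define A B C where "A = (LINT x|M. (norm (f x))\<^sup>2)" and "B = (LINT x|M. f x \<bullet> g x)"
    and "C = (LINT x|M. (norm (g x))\<^sup>2)"
  have q: "0 \<le> A + 2 * t * B + t\<^sup>2 * C" for t
  proof -
    have "0 \<le> (LINT x|M. (norm (f x + t *\<^sub>R g x))\<^sup>2)" by simp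
    then show ?thesis
      using integral_norm_sq_add[OF assms(1) sq_integrable_scaleR[OF assms(2), of t]]
      by (simp add: A_def B_def C_def power_mult_distrib algebra_simps)
  qed
  have C: "C \<ge> 0" by (simp add: C_def)
  have "B\<^sup>2 \<le> A * C"
  proof (cases "C = 0")
    case True
    have "B = 0"
    proof (rule ccontr)
      assume "B \<noteq> 0"
      \<comment> \<open>For \<open>C = 0\<close> the quadratic is affine in t, and this t gives it
        the value -1.\<close>
      with q[of "- (A + 1) / (2 * B)"] True show False by (simp add: field_simps)
    qed
    then show ?thesis using True by simp
  next
    case False
    with q[of "- B / C"] C show ?thesis
      by (simp add: field_simps power2_eq_square)
  qed
  then show ?thesis by (simp add: A_def B_def C_def)
qed

lemma Cauchy_Schwarz_integral_sqrt:
  assumes "sq_integrable M f" "sq_integrable M g"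
  shows "\<bar>LINT x|M. f x \<bullet> g x\<bar> \<le> sqrt (LINT x|M. (norm (f x))\<^sup>2) * sqrt (LINT x|M. (norm (g x))\<^sup>2)"
  using real_sqrt_le_mono[OF Cauchy_Schwarz_integral[OF assms]] by (simp add: real_sqrt_mult)

section \<open>Weak-strong pairings and quadratic terms with converging directions\<close>

lemma tendsto_integral_inner:
  fixes v :: "nat \<Rightarrow> 'a \<Rightarrow> 'b::euclidean_space"
  assumes v: "\<And>n. sq_integrable M (v n)" "\<And>n. (LINT x|M. (norm (v n x))\<^sup>2) \<le> K"
    and weak: "\<And>w. sq_integrable M w \<Longrightarrow> (\<lambda>n. LINT x|M. v n x \<bullet> w x) \<longlonglongrightarrow> (LINT x|M. v0 x \<bullet> w x)"
    and w: "\<And>n. sq_integrable M (w n)" "sq_integrable M w0"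
    and strong: "(\<lambda>n. LINT x|M. (norm (w n x - w0 x))\<^sup>2) \<longlonglongrightarrow> 0"
  shows "(\<lambda>n. LINT x|M. v n x \<bullet> w n x) \<longlonglongrightarrow> (LINT x|M. v0 x \<bullet> w0 x)"
proof -
  have split: "(LINT x|M. v n x \<bullet> w n x) = (LINT x|M. v n x \<bullet> w0 x) + (LINT x|M. v n x \<bullet> (w n x - w0 x))" for n
    using sq_integrable_inner[OF v(1)[of n] w(2)] sq_integrable_inner[OF v(1)[of n] sq_integrable_diff[OF w(1)[of n] w(2)]]
    by (subst Bochner_Integration.integral_add[symmetric]) (auto simp: inner_diff_right)
  have "(\<lambda>n. LINT x|M. v n x \<bullet> (w n x - w0 x)) \<longlonglongrightarrow> 0"
  proof (rule Lim_null_comparison[OF always_eventually[OF allI]])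
    fix n
    have "\<bar>LINT x|M. v n x \<bullet> (w n x - w0 x)\<bar>
      \<le> sqrt (LINT x|M. (norm (v n x))\<^sup>2) * sqrt (LINT x|M. (norm (w n x - w0 x))\<^sup>2)"
      by (rule Cauchy_Schwarz_integral_sqrt[OF v(1) sq_integrable_diff[OF w(1) w(2)]])
    also have "\<dots> \<le> sqrt K * sqrt (LINT x|M. (norm (w n x - w0 x))\<^sup>2)"
      by (intro mult_right_mono real_sqrt_le_mono v) simp
    finally show "norm (LINT x|M. v n x \<bullet> (w n x - w0 x)) \<le> sqrt K * sqrt (LINT x|M. (norm (w n x - w0 x))\<^sup>2)"
      by simp
  next
    show "(\<lambda>n. sqrt K * sqrt (LINT x|M. (norm (w n x - w0 x))\<^sup>2)) \<longlonglongrightarrow> 0"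
      using tendsto_mult[OF tendsto_const[of "sqrt K"] tendsto_real_sqrt[OF strong]] by simp
  qed
  then show ?thesis
    unfolding split using tendsto_add[OF weak[OF w(2)]] by fastforce
qed

text \<open>The directions \<omega> will be the averaged director and its cross product with the
  tangent: uniformly bounded and converging almost everywhere. Everything reduces to the rank-one
  map sending v to \<open>(v \<bullet> \<omega>) *\<^sub>R \<omega>\<close>, because
  \<open>(v \<bullet> \<omega>) * (u \<bullet> \<omega>)\<close> is the inner product of u with that
  vector.\<close>

context
  fixes M :: "'a measure" and \<omega> :: "nat \<Rightarrow> 'a \<Rightarrow> 'b::euclidean_space" and \<omega>0 :: "'a \<Rightarrow> 'b" and B :: real
  assumes \<omega>_meas: "\<And>n. \<omega> n \<in> borel_measurable M" "\<omega>0 \<in> borel_measurable M"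
    and \<omega>_bound: "\<And>n. AE x in M. norm (\<omega> n x) \<le> B"
    and \<omega>_lim: "AE x in M. (\<lambda>n. \<omega> n x) \<longlonglongrightarrow> \<omega>0 x"
begin

lemma limit_bound: "AE x in M. norm (\<omega>0 x) \<le> B"
proof -
  have "AE x in M. \<forall>n. norm (\<omega> n x) \<le> B"
    using \<omega>_bound by (simp add: AE_all_countable)
  then show ?thesis using \<omega>_lim
  proof eventually_elim
    case (elim x)
    then show ?case
      by (intro Lim_bounded[OF tendsto_norm[OF elim(2)], of 0]) auto
  qed
qed

lemma norm_proj_le: "norm (w :: 'b) \<le> B \<Longrightarrow> norm ((v \<bullet> w) *\<^sub>R w) \<le> B\<^sup>2 * norm v"
proof -
  assume w: "norm w \<le> B"
  have "norm ((v \<bullet> w) *\<^sub>R w) \<le> norm v * norm w * norm w"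
    by (simp add: Cauchy_Schwarz_ineq2 mult_right_mono)
  also have "\<dots> \<le> norm v * B * B"
    using w order_trans[OF norm_ge_zero w] by (intro mult_mono) auto
  finally show ?thesis by (simp add: power2_eq_square mult_ac)
qed

lemma sq_integrable_proj:
  assumes "sq_integrable M v"
  shows "sq_integrable M (\<lambda>x. (v x \<bullet> \<omega> n x) *\<^sub>R \<omega> n x)" "sq_integrable M (\<lambda>x. (v x \<bullet> \<omega>0 x) *\<^sub>R \<omega>0 x)"
proof -
  note [measurable] = \<omega>_meas sq_integrable_measurable[OF assms]
  have "AE x in M. norm ((v x \<bullet> \<omega> n x) *\<^sub>R \<omega> n x) \<le> B\<^sup>2 * norm (v x)"
    using \<omega>_bound[of n] by eventually_elim (rule norm_proj_le)
  then show "sq_integrable M (\<lambda>x. (v x \<bullet> \<omega> n x) *\<^sub>R \<omega> n x)"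
    by (intro sq_integrable_bound[OF assms]) auto
  have "AE x in M. norm ((v x \<bullet> \<omega>0 x) *\<^sub>R \<omega>0 x) \<le> B\<^sup>2 * norm (v x)"
    using limit_bound by eventually_elim (rule norm_proj_le)
  then show "sq_integrable M (\<lambda>x. (v x \<bullet> \<omega>0 x) *\<^sub>R \<omega>0 x)"
    by (intro sq_integrable_bound[OF assms]) auto
qed

text \<open>On a fixed v the rank-one maps converge strongly: pointwise convergence of the
  directions is enough, since the differences are dominated by
  \<open>2 * B\<^sup>2 * norm (v x)\<close>.\<close>

lemma proj_strong_convergence:
  assumes v: "sq_integrable M v"
  shows "(\<lambda>n. LINT x|M. (norm ((v x \<bullet> \<omega> n x) *\<^sub>R \<omega> n x - (v x \<bullet> \<omega>0 x) *\<^sub>R \<omega>0 x))\<^sup>2) \<longlonglongrightarrow> 0"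
proof -
  note [measurable] = \<omega>_meas sq_integrable_measurable[OF v]
  have "(\<lambda>n. LINT x|M. (norm ((v x \<bullet> \<omega> n x) *\<^sub>R \<omega> n x - (v x \<bullet> \<omega>0 x) *\<^sub>R \<omega>0 x))\<^sup>2) \<longlonglongrightarrow> (LINT x|M. 0)"
  proof (rule integral_dominated_convergence[where w="\<lambda>x. (2 * B\<^sup>2)\<^sup>2 * (norm (v x))\<^sup>2"])
    show "integrable M (\<lambda>x. (2 * B\<^sup>2)\<^sup>2 * (norm (v x))\<^sup>2)"
      using v by (auto simp: sq_integrable_def)
    show "AE x in M. (\<lambda>n. (norm ((v x \<bullet> \<omega> n x) *\<^sub>R \<omega> n x - (v x \<bullet> \<omega>0 x) *\<^sub>R \<omega>0 x))\<^sup>2) \<longlonglongrightarrow> 0"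
      using \<omega>_lim
    proof eventually_elim
      case (elim x)
      have "(\<lambda>n. (norm ((v x \<bullet> \<omega> n x) *\<^sub>R \<omega> n x - (v x \<bullet> \<omega>0 x) *\<^sub>R \<omega>0 x))\<^sup>2)
        \<longlonglongrightarrow> (norm ((v x \<bullet> \<omega>0 x) *\<^sub>R \<omega>0 x - (v x \<bullet> \<omega>0 x) *\<^sub>R \<omega>0 x))\<^sup>2"
        by (intro tendsto_intros elim)
      then show ?case by simp
    qed
    show "AE x in M. norm ((norm ((v x \<bullet> \<omega> n x) *\<^sub>R \<omega> n x - (v x \<bullet> \<omega>0 x) *\<^sub>R \<omega>0 x))\<^sup>2)
        \<le> (2 * B\<^sup>2)\<^sup>2 * (norm (v x))\<^sup>2" for n
      using \<omega>_bound[of n] limit_bound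
    proof eventually_elim
      case (elim x)
      have "norm ((v x \<bullet> \<omega> n x) *\<^sub>R \<omega> n x - (v x \<bullet> \<omega>0 x) *\<^sub>R \<omega>0 x) \<le> B\<^sup>2 * norm (v x) + B\<^sup>2 * norm (v x)"
        by (rule norm_triangle_le_diff[OF add_mono[OF norm_proj_le[OF elim(1)] norm_proj_le[OF elim(2)]]])
      from power_mono[OF this norm_ge_zero, of 2] show ?case
        by (simp add: power_mult_distrib algebra_simps)
    qed
  qed auto
  then show ?thesis by simp
qed

lemma sq_integrable_inner_bounded:
  assumes "sq_integrable M v" "sq_integrable M u"
  shows "integrable M (\<lambda>x. (v x \<bullet> \<omega> n x) * (u x \<bullet> \<omega> n x))" "integrable M (\<lambda>x. (v x \<bullet> \<omega> n x)\<^sup>2)"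
    "integrable M (\<lambda>x. (v x \<bullet> \<omega>0 x)\<^sup>2)"
  using sq_integrable_inner[OF assms(2) sq_integrable_proj(1)[OF assms(1)], of n]
    sq_integrable_inner[OF assms(1) sq_integrable_proj(1)[OF assms(1)], of n]
    sq_integrable_inner[OF assms(1) sq_integrable_proj(2)[OF assms(1)]]
  by (simp_all add: power2_eq_square)

text \<open>Weak convergence of \<open>v n\<close> meets strong convergence of the rank-one image of
  the fixed \<open>v0\<close>.\<close>

lemma proj_cross_convergence:
  assumes v: "\<And>n. sq_integrable M (v n)" "\<And>n. (LINT x|M. (norm (v n x))\<^sup>2) \<le> K" "sq_integrable M v0"
    and weak: "\<And>w. sq_integrable M w \<Longrightarrow> (\<lambda>n. LINT x|M. v n x \<bullet> w x) \<longlonglongrightarrow> (LINT x|M. v0 x \<bullet> w x)"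
  shows "(\<lambda>n. LINT x|M. (v0 x \<bullet> \<omega> n x) * (v n x \<bullet> \<omega> n x)) \<longlonglongrightarrow> (LINT x|M. (v0 x \<bullet> \<omega>0 x)\<^sup>2)"
  using tendsto_integral_inner[OF v(1,2) weak sq_integrable_proj[OF v(3)] proj_strong_convergence[OF v(3)]]
  by (simp add: power2_eq_square)

lemma proj_square_convergence:
  assumes v0: "sq_integrable M v0"
  shows "(\<lambda>n. LINT x|M. (v0 x \<bullet> \<omega> n x)\<^sup>2) \<longlonglongrightarrow> (LINT x|M. (v0 x \<bullet> \<omega>0 x)\<^sup>2)"
  using proj_cross_convergence[where v="\<lambda>_. v0" and K="LINT x|M. (norm (v0 x))\<^sup>2" and ?v0.0=v0] v0
  by (simp add: power2_eq_square)

text \<open>Completing the square: linearising at \<open>v0\<close> loses exactly the square of the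
  difference. That loss may be discarded where the quadratic term is added, but has to be kept where
  it is subtracted.\<close>

lemma proj_lower_bound:
  assumes v: "sq_integrable M v" "sq_integrable M v0"
  shows "2 * (LINT x|M. (v0 x \<bullet> \<omega> n x) * (v x \<bullet> \<omega> n x)) - (LINT x|M. (v0 x \<bullet> \<omega> n x)\<^sup>2)
    = (LINT x|M. (v x \<bullet> \<omega> n x)\<^sup>2) - (LINT x|M. ((v x - v0 x) \<bullet> \<omega> n x)\<^sup>2)"
proof -
  have "(LINT x|M. ((v x - v0 x) \<bullet> \<omega> n x)\<^sup>2)
     = (LINT x|M. (v x \<bullet> \<omega> n x)\<^sup>2 - 2 * ((v0 x \<bullet> \<omega> n x) * (v x \<bullet> \<omega> n x)) + (v0 x \<bullet> \<omega> n x)\<^sup>2)"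
    by (rule Bochner_Integration.integral_cong) (simp_all add: inner_diff_left power2_diff)
  also have "\<dots> = (LINT x|M. (v x \<bullet> \<omega> n x)\<^sup>2) - 2 * (LINT x|M. (v0 x \<bullet> \<omega> n x) * (v x \<bullet> \<omega> n x))
      + (LINT x|M. (v0 x \<bullet> \<omega> n x)\<^sup>2)"
    using sq_integrable_inner_bounded(1,2)[OF v(1) v(2), of n] sq_integrable_inner_bounded(1,2)[OF v(2) v(1), of n]
    by simp
  finally show ?thesis by simp
qed

lemma proj_integral_le:
  assumes v: "sq_integrable M v"
  shows "(LINT x|M. (v x \<bullet> \<omega> n x)\<^sup>2) \<le> B\<^sup>2 * (LINT x|M. (norm (v x))\<^sup>2)"
proof -
  have "(LINT x|M. (v x \<bullet> \<omega> n x)\<^sup>2) \<le> (LINT x|M. B\<^sup>2 * (norm (v x))\<^sup>2)"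
  proof (rule integral_mono_AE)
    show "AE x in M. (v x \<bullet> \<omega> n x)\<^sup>2 \<le> B\<^sup>2 * (norm (v x))\<^sup>2"
      using \<omega>_bound[of n]
    proof eventually_elim
      case (elim x)
      have "(v x \<bullet> \<omega> n x)\<^sup>2 \<le> (norm (v x) * norm (\<omega> n x))\<^sup>2"
        using power_mono[OF Cauchy_Schwarz_ineq2[of "v x" "\<omega> n x"] abs_ge_zero, of 2] by simp
      also have "\<dots> \<le> (norm (v x) * B)\<^sup>2"
        using elim by (intro power_mono mult_left_mono) auto
      finally show ?case by (simp add: power_mult_distrib mult_ac)
    qed
  qed (use v sq_integrable_inner_bounded[OF v v] in \<open>auto simp: sq_integrable_def\<close>)
  then show ?thesis by simp
qed

text \<open>Under strong convergence the loss in the linearisation identity also tends to zero, so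
  the squares themselves converge.\<close>

lemma proj_strong_square_convergence:
  assumes v: "\<And>n. sq_integrable M (v n)" "sq_integrable M v0"
    and strong: "(\<lambda>n. LINT x|M. (norm (v n x - v0 x))\<^sup>2) \<longlonglongrightarrow> 0"
    and weak: "\<And>w. sq_integrable M w \<Longrightarrow> (\<lambda>n. LINT x|M. v n x \<bullet> w x) \<longlonglongrightarrow> (LINT x|M. v0 x \<bullet> w x)"
    and bd: "\<And>n. (LINT x|M. (norm (v n x))\<^sup>2) \<le> K"
  shows "(\<lambda>n. LINT x|M. (v n x \<bullet> \<omega> n x)\<^sup>2) \<longlonglongrightarrow> (LINT x|M. (v0 x \<bullet> \<omega>0 x)\<^sup>2)"
proof -
  have d: "(\<lambda>n. LINT x|M. ((v n x - v0 x) \<bullet> \<omega> n x)\<^sup>2) \<longlonglongrightarrow> 0"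
  proof (rule Lim_null_comparison[OF always_eventually[OF allI]])
    show "norm (LINT x|M. ((v n x - v0 x) \<bullet> \<omega> n x)\<^sup>2) \<le> B\<^sup>2 * (LINT x|M. (norm (v n x - v0 x))\<^sup>2)" for n
      using proj_integral_le[OF sq_integrable_diff[OF v(1)[of n] v(2)]] by simp
    show "(\<lambda>n. B\<^sup>2 * (LINT x|M. (norm (v n x - v0 x))\<^sup>2)) \<longlonglongrightarrow> 0"
      using tendsto_mult[OF tendsto_const[of "B\<^sup>2"] strong] by simp
  qed
  have eq: "(LINT x|M. (v n x \<bullet> \<omega> n x)\<^sup>2) = 2 * (LINT x|M. (v0 x \<bullet> \<omega> n x) * (v n x \<bullet> \<omega> n x))
    - (LINT x|M. (v0 x \<bullet> \<omega> n x)\<^sup>2) + (LINT x|M. ((v n x - v0 x) \<bullet> \<omega> n x)\<^sup>2)" for n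
    using proj_lower_bound[OF v(1)[of n] v(2), of n] by simp
  have "(\<lambda>n. LINT x|M. (v n x \<bullet> \<omega> n x)\<^sup>2) \<longlonglongrightarrow> 2 * (LINT x|M. (v0 x \<bullet> \<omega>0 x)\<^sup>2)
    - (LINT x|M. (v0 x \<bullet> \<omega>0 x)\<^sup>2) + 0"
    unfolding eq by (intro tendsto_intros proj_cross_convergence[OF v(1) bd v(2) weak]
        proj_square_convergence[OF v(2)] d)
  then show ?thesis by simp
qed

end

lemma tendsto_inner_of_strong:
  assumes v: "\<And>n. sq_integrable M (v n)" "sq_integrable M v0" "sq_integrable M w"
    and strong: "(\<lambda>n. LINT x|M. (norm (v n x - v0 x))\<^sup>2) \<longlonglongrightarrow> 0"
  shows "(\<lambda>n. LINT x|M. v n x \<bullet> w x) \<longlonglongrightarrow> (LINT x|M. v0 x \<bullet> w x)"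
  using tendsto_integral_inner[of M "\<lambda>_. w" "LINT x|M. (norm (w x))\<^sup>2" w v v0] v strong
  by (simp add: inner_commute)

lemma tendsto_norm_sq_of_strong:
  assumes v: "\<And>n. sq_integrable M (v n)" "sq_integrable M v0"
    and strong: "(\<lambda>n. LINT x|M. (norm (v n x - v0 x))\<^sup>2) \<longlonglongrightarrow> 0"
  shows "(\<lambda>n. LINT x|M. (norm (v n x))\<^sup>2) \<longlonglongrightarrow> (LINT x|M. (norm (v0 x))\<^sup>2)"
proof -
  have eq: "(LINT x|M. (norm (v n x))\<^sup>2) = (LINT x|M. (norm (v n x - v0 x))\<^sup>2) +
      2 * (LINT x|M. v n x \<bullet> v0 x) - (LINT x|M. (norm (v0 x))\<^sup>2)" for n
  proof -
    have "(LINT x|M. (norm (v n x - v0 x))\<^sup>2) = (LINT x|M. (norm (v n x))\<^sup>2) - 2 * (LINT x|M. v n x \<bullet> v0 x)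
        + (LINT x|M. (norm (v0 x))\<^sup>2)"
      using integral_norm_sq_add[OF v(1)[of n] sq_integrable_scaleR[OF v(2), of "-1"]] by simp
    then show ?thesis by simp
  qed
  have "(\<lambda>n. LINT x|M. (norm (v n x))\<^sup>2) \<longlonglongrightarrow> 0 + 2 * (LINT x|M. v0 x \<bullet> v0 x) - (LINT x|M. (norm (v0 x))\<^sup>2)"
    unfolding eq by (intro tendsto_intros strong tendsto_inner_of_strong[OF v v(2)])
  then show ?thesis by (simp add: power2_norm_eq_inner)
qed

section \<open>Density of continuous functions in the square-integrable ones\<close>

definition clamp_norm :: "real \<Rightarrow> 'b::euclidean_space \<Rightarrow> 'b" where
  "clamp_norm m v = (m / max m (norm v)) *\<^sub>R v"

lemma clamp_norm:
  fixes v :: "'b::euclidean_space"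
  assumes "m > 0"
  shows "norm (clamp_norm m v) \<le> m" "norm (clamp_norm m v) \<le> norm v"
    "norm v \<le> m \<Longrightarrow> clamp_norm m v = v" "continuous_on UNIV (clamp_norm m :: 'b \<Rightarrow> 'b)"
proof -
  have pos: "max m (norm v) > 0" for v :: 'b using assms by simp
  show "norm (clamp_norm m v) \<le> m"
    using assms pos[of v] by (auto simp: clamp_norm_def field_simps max_def)
  show "norm (clamp_norm m v) \<le> norm v"
    using assms pos[of v] by (auto simp: clamp_norm_def field_simps max_def mult_right_mono)
  show "clamp_norm m v = v" if "norm v \<le> m"
    using assms that by (simp add: clamp_norm_def)
  show "continuous_on UNIV (clamp_norm m :: 'b \<Rightarrow> 'b)"
    unfolding clamp_norm_def using pos less_imp_neq[OF pos] by (intro continuous_intros) (metis less_irrefl)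
qed

lemma AE_lebesgue_on_notin:
  assumes "N \<in> null_sets lebesgue" "S \<in> sets lebesgue"
  shows "AE x in lebesgue_on S. x \<notin> N"
proof -
  have "AE x in lebesgue. x \<in> S \<longrightarrow> x \<notin> N"
    using AE_not_in[OF assms(1)] by eventually_elim simp
  then show ?thesis using assms(2) by (simp add: AE_restrict_space_iff)
qed

lemma finite_measure_Icc: "finite_measure (lebesgue_on {a..b::real})"
  by (intro finite_measure_lebesgue_on) simp

lemma continuous_on_imp_measurable_Icc:
  "continuous_on {a..b::real} f \<Longrightarrow> f \<in> borel_measurable (lebesgue_on {a..b})"
  by (simp add: continuous_imp_measurable_on_sets_lebesgue)

lemma continuous_on_imp_sq_integrable:
  fixes f :: "real \<Rightarrow> 'b::euclidean_space"
  assumes "continuous_on {a..b} f"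
  shows "sq_integrable (lebesgue_on {a..b}) f"
proof -
  have "bounded (f ` {a..b})"
    using compact_continuous_image[OF assms compact_Icc] compact_imp_bounded by blast
  then obtain B where "\<And>x. x \<in> {a..b} \<Longrightarrow> norm (f x) \<le> B"
    unfolding bounded_iff by blast
  then show ?thesis
    by (intro sq_integrable_bounded[OF finite_measure_Icc continuous_on_imp_measurable_Icc[OF assms]]) auto
qed

text \<open>\<open>clamp_norm m\<close> is the radial retraction onto the ball of radius m. Clamping
  f first produces a bounded function; measurability then yields continuous functions converging to
  it off a negligible set, and clamping those at the same radius supplies a constant dominant
  without moving the limit. Two errors below \<open>e / 4\<close>, each doubled when squares are
  added, make up e.\<close>

lemma sq_integrable_approx_continuous:
  fixes f :: "real \<Rightarrow> 'b::euclidean_space"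
  assumes f: "sq_integrable (lebesgue_on {a..b}) f" and e: "e > 0"
  obtains k where "continuous_on UNIV k" "(LINT x|lebesgue_on {a..b}. (norm (f x - k x))\<^sup>2) < e"
proof -
  let ?M = "lebesgue_on {a..b}"
  note [measurable] = sq_integrable_measurable[OF f]
  define F where "F n x = clamp_norm (real (Suc n)) (f x)" for n x
  have F_meas[measurable]: "F n \<in> borel_measurable ?M" for n
    unfolding F_def by (rule borel_measurable_continuous_on[OF clamp_norm(4)]) simp_all
  have "(\<lambda>n. LINT x|?M. (norm (f x - F n x))\<^sup>2) \<longlonglongrightarrow> (LINT x|?M. 0)"
  proof (rule integral_dominated_convergence[where w="\<lambda>x. 4 * (norm (f x))\<^sup>2"])
    show "integrable ?M (\<lambda>x. 4 * (norm (f x))\<^sup>2)"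
      using f by (auto simp: sq_integrable_def)
    have "(\<lambda>n. (norm (f x - F n x))\<^sup>2) \<longlonglongrightarrow> 0" for x
    proof (rule tendsto_eventually)
      obtain n0 where n0: "norm (f x) \<le> real n0" using real_arch_simple by blast
      show "\<forall>\<^sub>F n in sequentially. (norm (f x - F n x))\<^sup>2 = 0"
        using eventually_ge_at_top[of n0]
      proof eventually_elim
        case (elim n)
        then have "clamp_norm (real (Suc n)) (f x) = f x" using n0 by (intro clamp_norm(3)) auto
        then show ?case by (simp add: F_def)
      qed
    qed
    then show "AE x in ?M. (\<lambda>n. (norm (f x - F n x))\<^sup>2) \<longlonglongrightarrow> 0" by simp
    have "(norm (f x - F n x))\<^sup>2 \<le> 4 * (norm (f x))\<^sup>2" for n x
    proof -
      have "norm (f x - F n x) \<le> norm (f x) + norm (f x)"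
        unfolding F_def by (rule norm_triangle_le_diff[OF add_left_mono[OF clamp_norm(2)]]) simp
      from power_mono[OF this norm_ge_zero, of 2] show ?thesis by (simp add: power2_eq_square algebra_simps)
    qed
    then show "AE x in ?M. norm ((norm (f x - F n x))\<^sup>2) \<le> 4 * (norm (f x))\<^sup>2" for n by simp
  qed auto
  then have "\<forall>\<^sub>F n in sequentially. (LINT x|?M. (norm (f x - F n x))\<^sup>2) < e / 4"
    using e by (intro order_tendstoD(2)) auto
  then obtain m where m: "(LINT x|?M. (norm (f x - F m x))\<^sup>2) < e / 4"
    using eventually_happens'[OF sequentially_bot] by blast
  define R where "R = real (Suc m)"
  have R: "R > 0" by (simp add: R_def)
  have FR: "norm (F m x) \<le> R" for x unfolding F_def R_def by (rule clamp_norm) simp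
  have "F m measurable_on {a..b}"
    by (simp add: measurable_on_iff_borel_measurable)
  then obtain N g where N: "negligible N" and g: "\<And>n. continuous_on UNIV (g n)"
    and lim: "\<And>x. x \<notin> N \<Longrightarrow> (\<lambda>n. g n x) \<longlonglongrightarrow> (if x \<in> {a..b} then F m x else 0)"
    unfolding measurable_on_def by metis
  define k where "k n x = clamp_norm R (g n x)" for n x
  have k: "continuous_on UNIV (k n)" for n
    unfolding k_def using continuous_on_compose2[OF clamp_norm(4)[OF R] g] by auto
  have k_meas[measurable]: "k n \<in> borel_measurable ?M" for n
    by (rule continuous_on_imp_measurable_Icc[OF continuous_on_subset[OF k]]) simp
  have "(\<lambda>n. LINT x|?M. (norm (F m x - k n x))\<^sup>2) \<longlonglongrightarrow> (LINT x|?M. 0)"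
  proof (rule integral_dominated_convergence[where w="\<lambda>x. 4 * R\<^sup>2"])
    have "AE x in ?M. x \<notin> N"
      using N by (intro AE_lebesgue_on_notin) (auto simp: negligible_iff_null_sets)
    then show "AE x in ?M. (\<lambda>n. (norm (F m x - k n x))\<^sup>2) \<longlonglongrightarrow> 0"
      using AE_space
    proof eventually_elim
      case (elim x)
      have "(\<lambda>n. clamp_norm R (g n x)) \<longlonglongrightarrow> clamp_norm R (F m x)"
        using lim[OF elim(1)] elim(2) clamp_norm(4)[OF R]
        by (intro continuous_on_tendsto_compose[OF clamp_norm(4)[OF R]]) auto
      then have "(\<lambda>n. k n x) \<longlonglongrightarrow> F m x"
        using clamp_norm(3)[OF R FR] by (simp add: k_def)
      then have "(\<lambda>n. (norm (F m x - k n x))\<^sup>2) \<longlonglongrightarrow> (norm (F m x - F m x))\<^sup>2"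
        by (intro tendsto_intros)
      then show ?case by simp
    qed
    have "(norm (F m x - k n x))\<^sup>2 \<le> 4 * R\<^sup>2" for n x
    proof -
      have "norm (F m x - k n x) \<le> R + R"
        unfolding k_def by (rule norm_triangle_le_diff[OF add_mono[OF FR clamp_norm(1)[OF R]]])
      from power_mono[OF this norm_ge_zero, of 2] show ?thesis by (simp add: power2_eq_square algebra_simps)
    qed
    then show "AE x in ?M. norm ((norm (F m x - k n x))\<^sup>2) \<le> 4 * R\<^sup>2" for n by simp
  qed auto
  then have "\<forall>\<^sub>F n in sequentially. (LINT x|?M. (norm (F m x - k n x))\<^sup>2) < e / 4"
    using e by (intro order_tendstoD(2)) auto
  then obtain n where n: "(LINT x|?M. (norm (F m x - k n x))\<^sup>2) < e / 4"
    using eventually_happens'[OF sequentially_bot] by blast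
  have Fs: "sq_integrable ?M (F m)"
    by (rule sq_integrable_bounded[OF finite_measure_Icc]) (use FR in auto)
  have ks: "sq_integrable ?M (k n)"
    by (rule continuous_on_imp_sq_integrable[OF continuous_on_subset[OF k]]) simp
  have "(LINT x|?M. (norm (f x - k n x))\<^sup>2) < e"
    using integral_norm_sq_add_le[OF sq_integrable_diff[OF f Fs] sq_integrable_diff[OF Fs ks]] m n by simp
  with k show thesis by (rule that)
qed

section \<open>Weak derivatives on an interval\<close>

text \<open>A \<open>C\<^sup>1\<close> step: differences of its rescaled translates are test functions that tend to
  indicator functions of intervals.\<close>

definition spline_step :: "real \<Rightarrow> real" where
  "spline_step t = 2 * (max 0 t)\<^sup>2 - 4 * (max 0 (t - 1/2))\<^sup>2 + 2 * (max 0 (t - 1))\<^sup>2"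

text \<open>The hat on [0, 1] with peak 2 at 1/2: the derivative of \<open>spline_step\<close>, of
  integral one.\<close>

definition spline_hat :: "real \<Rightarrow> real" where
  "spline_hat t = 4 * max 0 t - 8 * max 0 (t - 1/2) + 4 * max 0 (t - 1)"

lemma has_real_derivative_max_sq:
  "((\<lambda>t::real. (max 0 (t - c))\<^sup>2) has_real_derivative 2 * max 0 (t - c)) (at t)"
proof -
  consider "t < c" | "t > c" | "t = c" by linarith
  then show ?thesis
  proof cases
    case 1
    have "((\<lambda>t. 0) has_real_derivative 2 * max 0 (t - c)) (at t)"
      using 1 by simp
    then show ?thesis
      by (rule has_field_derivative_transform_within[where d="c - t"]) (use 1 in \<open>auto simp: dist_real_def abs_if split: if_splits\<close>)
  next
    case 2
    have "((\<lambda>t. (t - c)\<^sup>2) has_real_derivative 2 * max 0 (t - c)) (at t)"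
      using 2 by (auto intro!: derivative_eq_intros)
    then show ?thesis
      by (rule has_field_derivative_transform_within[where d="t - c"]) (use 2 in \<open>auto simp: dist_real_def abs_if split: if_splits\<close>)
  next
    case 3
    have "(\<lambda>h. ((max 0 (c + h - c))\<^sup>2 - (max 0 (c - c))\<^sup>2) / h) = (\<lambda>h::real. max 0 h)"
      by (auto simp: max_def power2_eq_square)
    moreover have "(\<lambda>h::real. max 0 h) \<midarrow>0\<rightarrow> max 0 0"
      by (intro tendsto_intros)
    ultimately have "((\<lambda>t::real. (max 0 (t - c))\<^sup>2) has_real_derivative 0) (at c)"
      by (simp add: DERIV_def)
    then show ?thesis using 3 by simp
  qed
qed

lemma spline_step_deriv: "(spline_step has_real_derivative spline_hat t) (at t)"
proof -
  have "(spline_step has_real_derivative 2 * (2 * max 0 (t - 0)) - 4 * (2 * max 0 (t - 1/2)) + 2 * (2 * max 0 (t - 1))) (at t)"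
    unfolding spline_step_def[abs_def]
    using has_real_derivative_max_sq[of 0 t]
    by (intro DERIV_add DERIV_diff DERIV_cmult has_real_derivative_max_sq) simp
  then show ?thesis by (simp add: spline_hat_def)
qed

lemma spline_step_scaled_deriv:
  "((\<lambda>x. spline_step (c * (x - a))) has_real_derivative c * spline_hat (c * (x - a))) (at x within S)"
proof -
  have "((\<lambda>x. c * (x - a)) has_real_derivative c) (at x within S)"
    by (auto intro!: derivative_eq_intros)
  from DERIV_chain2[OF spline_step_deriv this] show ?thesis by (simp add: mult.commute)
qed

lemma continuous_on_spline_hat: "continuous_on S (\<lambda>x. spline_hat (f x))" if "continuous_on S f"
  unfolding spline_hat_def by (intro continuous_intros that)

lemma continuous_on_spline_step: "continuous_on S (\<lambda>x. spline_step (f x))" if "continuous_on S f"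
  unfolding spline_step_def by (intro continuous_intros that)

lemma spline_step_values:
  "t \<le> 0 \<Longrightarrow> spline_step t = 0" "t \<ge> 1 \<Longrightarrow> spline_step t = 1"
  "\<bar>spline_step t\<bar> \<le> 1"
proof -
  show 0: "t \<le> 0 \<Longrightarrow> spline_step t = 0" by (simp add: spline_step_def)
  show 1: "t \<ge> 1 \<Longrightarrow> spline_step t = 1"
    by (simp add: spline_step_def max_def power2_eq_square algebra_simps)
  consider "t \<le> 0" | "t \<ge> 1" | "0 \<le> t" "t \<le> 1/2" | "1/2 \<le> t" "t \<le> 1" by linarith
  then show "\<bar>spline_step t\<bar> \<le> 1"
  proof cases
    case 3
    then have "spline_step t = 2 * t\<^sup>2" by (simp add: spline_step_def max_def)
    moreover have "t\<^sup>2 \<le> (1/2)\<^sup>2" using 3 by (intro power_mono) auto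
    ultimately show ?thesis by (simp add: power2_eq_square)
  next
    case 4
    then have "spline_step t = 1 - 2 * (1 - t)\<^sup>2"
      by (simp add: spline_step_def max_def power2_eq_square algebra_simps)
    moreover have "(1 - t)\<^sup>2 \<le> (1/2)\<^sup>2" using 4 by (intro power_mono) auto
    ultimately show ?thesis by (simp add: power2_eq_square)
  qed (auto simp: 0 1)
qed

lemma spline_hat_values: "t \<le> 0 \<Longrightarrow> spline_hat t = 0" "t \<ge> 1 \<Longrightarrow> spline_hat t = 0" "spline_hat t \<ge> 0"
  by (auto simp: spline_hat_def max_def)

text \<open>The rescaled hat has unit mass on [c, c + 1/n]. It is an approximate identity from the
  right, so c = 0 is allowed while c = L is not.\<close>

lemma spline_hat_mollifies:
  fixes f :: "real \<Rightarrow> 'b::euclidean_space"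
  assumes f: "continuous_on {0..L} f" and c: "0 \<le> c" "c < L"
  shows "(\<lambda>n. LINT x|lebesgue_on {0..L}. (real n * spline_hat (real n * (x - c))) *\<^sub>R f x) \<longlonglongrightarrow> f c"
proof (rule LIMSEQ_I)
  fix e :: real assume "e > 0"
  let ?M = "lebesgue_on {0..L}"
  let ?k = "\<lambda>n x. real n * spline_hat (real n * (x - c))"
  obtain d where d: "d > 0" "\<And>x. x \<in> {0..L} \<Longrightarrow> dist x c < d \<Longrightarrow> dist (f x) (f c) < e / 2"
    using f c \<open>e > 0\<close> unfolding continuous_on_iff
    by (metis atLeastAtMost_iff half_gt_zero less_eq_real_def)
  \<comment> \<open>One bound makes the support shorter than d, the other keeps it inside [0, L] so
    that no mass is lost.\<close>
  define n0 where "n0 = nat \<lceil>max (1 / d) (1 / (L - c))\<rceil> + 1"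
  have "norm ((LINT x|?M. ?k n x *\<^sub>R f x) - f c) < e" if "n \<ge> n0" for n
  proof -
    have n: "real n > 1 / d" "real n > 1 / (L - c)" "real n > 0"
      using that unfolding n0_def by linarith+
    have kc: "continuous_on {0..L} (?k n)" by (intro continuous_intros continuous_on_spline_hat)
    have ki: "integrable ?M (?k n)"
      by (intro continuous_imp_integrable_real kc)
    have "((?k n) has_integral (spline_step (real n * (L - c)) - spline_step (real n * (0 - c)))) {0..L}"
    proof (rule fundamental_theorem_of_calculus)
      show "((\<lambda>x. spline_step (real n * (x - c))) has_vector_derivative ?k n x) (at x within {0..L})" for x
        unfolding has_real_derivative_iff_has_vector_derivative[symmetric]
        by (rule spline_step_scaled_deriv)
    qed (use c in simp)
    moreover have "real n * (L - c) \<ge> 1" using n c by (simp add: field_simps)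
    ultimately have "(?k n has_integral 1) {0..L}"
      using c n by (simp add: spline_step_values)
    then have "integral {0..L} (?k n) = 1" by (rule integral_unique)
    moreover have "(LINT x|?M. ?k n x) = integral {0..L} (?k n)"
      by (rule lebesgue_integral_eq_integral[OF ki]) simp
    ultimately have k1: "(LINT x|?M. ?k n x) = 1" by metis
    have kf: "integrable ?M (\<lambda>x. ?k n x *\<^sub>R (f x - f c))" "integrable ?M (\<lambda>x. ?k n x *\<^sub>R f x)"
      using kc f by (auto intro!: continuous_imp_integrable_real continuous_on_scaleR continuous_on_diff)
    have kfc: "integrable ?M (\<lambda>x. ?k n x *\<^sub>R f c)"
      by (rule integrable_scaleR_left) (rule ki)
    have "(LINT x|?M. ?k n x *\<^sub>R f c) = f c"
      using integral_scaleR_left[of "f c" ?M "?k n"] ki unfolding k1 by simp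
    then have "(LINT x|?M. ?k n x *\<^sub>R f x) - f c = (LINT x|?M. ?k n x *\<^sub>R f x) - (LINT x|?M. ?k n x *\<^sub>R f c)"
      by (simp only:)
    also have "\<dots> = (LINT x|?M. ?k n x *\<^sub>R (f x - f c))"
      unfolding scaleR_diff_right by (rule Bochner_Integration.integral_diff[symmetric]) (rule kf kfc)+
    finally have "norm ((LINT x|?M. ?k n x *\<^sub>R f x) - f c) \<le> (LINT x|?M. norm (?k n x *\<^sub>R (f x - f c)))"
      by (simp only: integral_norm_bound)
    also have "\<dots> \<le> (LINT x|?M. ?k n x * (e / 2))"
    proof (rule integral_mono)
      fix x assume x: "x \<in> space ?M"
      show "norm (?k n x *\<^sub>R (f x - f c)) \<le> ?k n x * (e / 2)"
      proof (cases "c < x \<and> real n * (x - c) < 1")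
        case True
        have "x - c < 1 / real n" using True n by (simp add: field_simps)
        also have "\<dots> < d" using n d by (simp add: field_simps)
        finally have "norm (f x - f c) \<le> e / 2"
          using d(2)[of x] x True by (auto simp: dist_norm)
        moreover have k0: "?k n x \<ge> 0" by (intro mult_nonneg_nonneg spline_hat_values(3)) simp
        ultimately show ?thesis
          unfolding norm_scaleR real_norm_def abs_of_nonneg[OF k0] by (intro mult_left_mono)
      next
        case False
        then have "spline_hat (real n * (x - c)) = 0"
        proof (cases "x \<le> c")
          case True
          then show ?thesis by (intro spline_hat_values(1) mult_nonneg_nonpos) auto
        next
          case False
          with \<open>\<not> (c < x \<and> real n * (x - c) < 1)\<close> show ?thesis by (intro spline_hat_values(2)) linarith
        qed
        then show ?thesis by simp
      qed
    qed (intro integrable_norm kf integrable_mult_left ki)+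
    also have "\<dots> = (LINT x|?M. ?k n x) * (e / 2)" by (rule integral_mult_left_zero)
    also have "\<dots> = e / 2" unfolding k1 by simp
    finally show ?thesis using \<open>e > 0\<close> by simp
  qed
  then show "\<exists>no. \<forall>n\<ge>no. norm ((LINT x|?M. ?k n x *\<^sub>R f x) - f c) < e" by blast
qed

lemma test_function_props:
  assumes "\<phi> \<in> test_functions L"
  shows "(\<phi> has_real_derivative deriv \<phi> x) (at x)" "continuous_on S \<phi>" "continuous_on S (deriv \<phi>)"
    "\<phi> 0 = 0" "\<phi> L = 0"
proof -
  obtain D where D: "\<And>x. (\<phi> has_vector_derivative D x) (at x)" "continuous_on UNIV D"
    using assms unfolding test_functions_def C1_differentiable_on_def by auto
  have D': "(\<phi> has_real_derivative D x) (at x)" for x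
    using D(1) by (simp add: has_real_derivative_iff_has_vector_derivative)
  then have eq: "deriv \<phi> = D" by (auto intro: DERIV_imp_deriv)
  show "(\<phi> has_real_derivative deriv \<phi> x) (at x)" using D' eq by simp
  show "continuous_on S \<phi>"
    by (intro DERIV_continuous_on) (use D' has_field_derivative_at_within in blast)
  show "continuous_on S (deriv \<phi>)" using D(2) eq continuous_on_subset by blast
  show "\<phi> 0 = 0" "\<phi> L = 0"
    using assms closure_subset[of "{x. \<phi> x \<noteq> 0}"] unfolding test_functions_def by fastforce+
qed

text \<open>Test with the difference of a step at a and a step at b. Its derivative is a pair of
  mollifiers that pick out \<open>f a - f b\<close>, while the test function itself tends to the
  indicator of (a, b].\<close>

lemma weak_deriv_FTC_interior:
  assumes f: "continuous_on {0..L} f" and g: "L2_fun L g" and fg: "is_weak_deriv L f g"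
    and ab: "0 < a" "a < b" "b < L"
  shows "f b - f a = integral {a..b} g"
proof -
  let ?M = "lebesgue_on {0..L}"
  have gi: "integrable ?M g"
    using g sq_integrable_imp_integrable[OF finite_measure_Icc] by (simp add: L2_fun_iff)
  have gm: "g \<in> borel_measurable ?M" using gi by (rule borel_measurable_integrable)
  define \<phi> where "\<phi> n x = spline_step (real n * (x - a)) - spline_step (real n * (x - b))" for n x
  have d\<phi>: "(\<phi> n has_real_derivative real n * spline_hat (real n * (x - a)) - real n * spline_hat (real n * (x - b))) (at x)" for n x
    unfolding \<phi>_def[abs_def] by (intro DERIV_diff spline_step_scaled_deriv)
  have \<phi>c: "continuous_on S (\<phi> n)" for n S
    unfolding \<phi>_def by (intro continuous_intros continuous_on_spline_step)
  have ind: "indicat_real S \<in> borel_measurable ?M" if "S \<in> sets borel" for S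
    using that by (intro measurable_restrict_space1 measurable_completion borel_measurable_indicator) simp
  \<comment> \<open>The second step is complete at b + 1/n; from this index on, that point lies
    before L and the support is inside the open interval.\<close>
  obtain n0 where n0: "1 / (L - b) < real n0" using reals_Archimedean2 by blast
  have "(LINT x|?M. (real n * spline_hat (real n * (x - a)) - real n * spline_hat (real n * (x - b))) *\<^sub>R f x)
      = - (LINT x|?M. \<phi> n x *\<^sub>R g x)" if n: "n \<ge> n0" for n
  proof -
    have 1: "1 / (L - b) < real n" using n n0 by simp
    have "1 / (L - b) > 0" using ab by simp
    with 1 have pos: "real n > 0" by linarith
    then have n': "1 / real n < L - b" "real n > 0" using 1 ab by (simp_all add: field_simps)
    have "\<phi> n \<in> test_functions L"
      unfolding test_functions_def C1_differentiable_on_def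
    proof (intro CollectI conjI exI ballI)
      show "(\<phi> n has_vector_derivative real n * spline_hat (real n * (x - a)) - real n * spline_hat (real n * (x - b))) (at x)" for x
        using d\<phi> by (simp add: has_real_derivative_iff_has_vector_derivative)
      show "continuous_on UNIV (\<lambda>x. real n * spline_hat (real n * (x - a)) - real n * spline_hat (real n * (x - b)))"
        by (intro continuous_intros continuous_on_spline_hat)
      have "\<phi> n x = 0" if "x \<notin> {a..b + 1 / real n}" for x
      proof (cases "x < a")
        case True
        then show ?thesis using n' ab unfolding \<phi>_def
          by (simp add: spline_step_values mult_nonneg_nonpos)
      next
        case False
        then have x: "x > b + 1 / real n" using that by auto
        then have "real n * (x - b) \<ge> 1" using n' by (simp add: field_simps)
        moreover have "real n * (x - a) \<ge> real n * (x - b)" using n' ab by simp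
        ultimately show ?thesis unfolding \<phi>_def
          by (simp add: spline_step_values)
      qed
      then have "{x. \<phi> n x \<noteq> 0} \<subseteq> {a..b + 1 / real n}" by blast
      then have "closure {x. \<phi> n x \<noteq> 0} \<subseteq> {a..b + 1 / real n}"
        by (rule closure_minimal) simp
      also have "\<dots> \<subseteq> {0<..<L}" using ab n' by auto
      finally show "closure {x. \<phi> n x \<noteq> 0} \<subseteq> {0<..<L}" .
    qed
    moreover have "deriv (\<phi> n) x = real n * spline_hat (real n * (x - a)) - real n * spline_hat (real n * (x - b))" for x
      by (rule DERIV_imp_deriv[OF d\<phi>])
    ultimately show ?thesis using fg unfolding is_weak_deriv_def by fastforce
  qed
  then have ev: "\<forall>\<^sub>F n in sequentially.
      (LINT x|?M. (real n * spline_hat (real n * (x - a)) - real n * spline_hat (real n * (x - b))) *\<^sub>R f x)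
      = - (LINT x|?M. \<phi> n x *\<^sub>R g x)"
    by (auto simp: eventually_sequentially)
  have ki: "integrable ?M (\<lambda>x. (real n * spline_hat (real n * (x - c))) *\<^sub>R f x)" for n c
    by (intro continuous_imp_integrable_real continuous_intros continuous_on_spline_hat f)
  have lhs: "(\<lambda>n. LINT x|?M. (real n * spline_hat (real n * (x - a)) - real n * spline_hat (real n * (x - b))) *\<^sub>R f x)
      \<longlonglongrightarrow> f a - f b"
    using tendsto_diff[OF spline_hat_mollifies[OF f, of a] spline_hat_mollifies[OF f, of b]] ab ki
    by (simp add: scaleR_diff_left)
  have rhs: "(\<lambda>n. LINT x|?M. \<phi> n x *\<^sub>R g x) \<longlonglongrightarrow> (LINT x|?M. indicator {a<..b} x *\<^sub>R g x)"
  proof (rule integral_dominated_convergence[where w="\<lambda>x. 2 * norm (g x)"])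
    show "integrable ?M (\<lambda>x. 2 * norm (g x))" using gi by simp
    have step: "(\<lambda>n. spline_step (real n * (x - c))) \<longlonglongrightarrow> (if x > c then 1 else 0)" for x c
    proof (cases "x > c")
      case True
      obtain m where "1 / (x - c) < real m" using reals_Archimedean2 by blast
      then have m: "1 < real m * (x - c)" using True by (simp add: divide_less_eq)
      have "\<forall>\<^sub>F n in sequentially. spline_step (real n * (x - c)) = (if x > c then 1 else 0)"
        using eventually_ge_at_top[of m]
      proof eventually_elim
        case (elim n)
        have "real m * (x - c) \<le> real n * (x - c)" using elim True by (intro mult_right_mono) auto
        then have "1 \<le> real n * (x - c)" using m by linarith
        then show ?case using True by (simp only: spline_step_values(2) if_True)
      qed
      then show ?thesis by (rule tendsto_eventually)
    next
      case False
      then have "spline_step (real n * (x - c)) = 0" for n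
        by (intro spline_step_values(1) mult_nonneg_nonpos) auto
      then show ?thesis using False by simp
    qed
    have "(\<lambda>n. \<phi> n x *\<^sub>R g x) \<longlonglongrightarrow> indicator {a<..b} x *\<^sub>R g x" for x
    proof -
      have "(\<lambda>n. \<phi> n x) \<longlonglongrightarrow> (if x > a then 1 else 0) - (if x > b then 1 else 0)"
        unfolding \<phi>_def by (intro tendsto_diff step)
      also have "(if x > a then 1 else 0) - (if x > b then 1 else 0) = indicat_real {a<..b} x"
        using ab by (auto simp: indicator_def)
      finally show ?thesis by (intro tendsto_intros)
    qed
    then show "AE x in ?M. (\<lambda>n. \<phi> n x *\<^sub>R g x) \<longlonglongrightarrow> indicator {a<..b} x *\<^sub>R g x" by simp
    have "\<bar>\<phi> n x\<bar> \<le> 2" for n x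
      unfolding \<phi>_def using spline_step_values(3)[of "real n * (x - a)"] spline_step_values(3)[of "real n * (x - b)"]
      by linarith
    then show "AE x in ?M. norm (\<phi> n x *\<^sub>R g x) \<le> 2 * norm (g x)" for n
      by (simp add: mult_right_mono)
    show "(\<lambda>x. indicat_real {a<..b} x *\<^sub>R g x) \<in> borel_measurable ?M"
      by (intro borel_measurable_scaleR ind gm) simp
    show "(\<lambda>x. \<phi> n x *\<^sub>R g x) \<in> borel_measurable ?M" for n
      by (intro borel_measurable_scaleR continuous_on_imp_measurable_Icc \<phi>c gm)
  qed
  have "f a - f b = - (LINT x|?M. indicator {a<..b} x *\<^sub>R g x)"
    by (rule LIMSEQ_unique[OF lhs]) (rule Lim_transform_eventually[OF tendsto_minus[OF rhs]],
        use ev in eventually_elim, simp)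
  also have "(LINT x|?M. indicator {a<..b} x *\<^sub>R g x) = (LINT x|?M. indicator {a..b} x *\<^sub>R g x)"
  proof (rule integral_cong_AE)
    have "AE x in ?M. x \<notin> {a}"
      by (rule AE_lebesgue_on_notin) auto
    then show "AE x in ?M. indicat_real {a<..b} x *\<^sub>R g x = indicator {a..b} x *\<^sub>R g x"
      by eventually_elim (auto simp: indicator_def)
  qed (intro borel_measurable_scaleR ind gm; simp)+
  also have "\<dots> = (LINT x|lebesgue_on {a..b}. g x)"
    unfolding indicator_scaleR_eq_if using ab by (intro integral_restrict) auto
  also have "\<dots> = integral {a..b} g"
    using ab by (intro lebesgue_integral_eq_integral integrable_subinterval[OF gi]) auto
  finally have "- (f a - f b) = integral {a..b} g" by simp
  then show ?thesis by simp
qed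

lemma L2_fun_integrable: "L2_fun L g \<Longrightarrow> integrable (lebesgue_on {0..L}) g"
  using sq_integrable_imp_integrable[OF finite_measure_Icc] by (simp add: L2_fun_iff)

lemma integrable_imp_integrable_on_Icc:
  fixes g :: "real \<Rightarrow> 'b::euclidean_space"
  assumes "integrable (lebesgue_on {0..L}) g" "0 \<le> a" "b \<le> L"
  shows "g integrable_on {a..b}" "(LINT x|lebesgue_on {a..b}. g x) = integral {a..b} g"
    "integrable (lebesgue_on {a..b}) g"
proof -
  show i: "integrable (lebesgue_on {a..b}) g"
    using assms by (intro integrable_subinterval[OF assms(1)]) auto
  show "g integrable_on {a..b}" by (rule integrable_on_lebesgue_on[OF i]) simp
  show "(LINT x|lebesgue_on {a..b}. g x) = integral {a..b} g"
    by (rule lebesgue_integral_eq_integral[OF i]) simp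
qed

lemma integral_Icc_combine:
  fixes g :: "real \<Rightarrow> 'b::euclidean_space"
  assumes "integrable (lebesgue_on {0..L}) g" "0 \<le> a" "a \<le> c" "c \<le> b" "b \<le> L"
  shows "integral {a..b} g = integral {a..c} g + integral {c..b} g"
  using Henstock_Kurzweil_Integration.integral_combine[OF assms(3,4) integrable_imp_integrable_on_Icc(1)[OF assms(1,2,5)]] by simp

text \<open>By the interior case, f minus the primitive of g is constant on the open interval; both
  functions are continuous, so the constant persists at the endpoints.\<close>

lemma weak_deriv_FTC:
  assumes f: "continuous_on {0..L} f" and g: "L2_fun L g" and fg: "is_weak_deriv L f g"
    and ab: "0 \<le> a" "a \<le> b" "b \<le> L"
  shows "f b - f a = integral {a..b} g"
proof (cases "0 < L")
  case False
  then have "a = b" using ab by simp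
  then show ?thesis by simp
next
  case True
  note gi = L2_fun_integrable[OF g]
  define G where "G x = integral {0..x} g" for x
  have Gc: "continuous_on {0..L} G"
    unfolding G_def using integrable_imp_integrable_on_Icc(1)[OF gi] by (intro indefinite_integral_continuous_1) auto
  have G: "G y - G x = integral {x..y} g" if "0 \<le> x" "x \<le> y" "y \<le> L" for x y
    using integral_Icc_combine[OF gi, of 0 x y] that by (simp add: G_def)
  define c where "c = f (L / 2) - G (L / 2)"
  have "f x - G x = c" if "x \<in> {0<..<L}" for x
  proof -
    have "f y - G y = f x - G x" if "0 < x" "x < y" "y < L" for x y
    proof -
      have "f y - f x = G y - G x"
        using weak_deriv_FTC_interior[OF f g fg that] G[of x y] that by simp
      then show ?thesis by (simp add: algebra_simps)
    qed
    from this[of x "L / 2"] this[of "L / 2" x] show ?thesis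
      using that True unfolding c_def by (cases x "L / 2" rule: linorder_cases) auto
  qed
  then have "f x - G x = c" if "x \<in> {0..L}" for x
    using continuous_constant_on_closure[of "{0<..<L}" "\<lambda>x. f x - G x" c x] True that
      continuous_on_diff[OF f Gc] by simp
  from this[of a] this[of b] ab have "f b - G b = f a - G a" by simp
  then have "f b - f a = G b - G a" by (simp add: algebra_simps)
  then show ?thesis using G[OF ab] by simp
qed

text \<open>Lebesgue differentiation over intervals [x, x + h] controls right difference quotients
  only. This is enough here, because a derivative within the nondegenerate interval [x, L] is still
  unique.\<close>

lemma right_derivative_AE:
  fixes g :: "real \<Rightarrow> 'b::euclidean_space"
  assumes gi: "integrable (lebesgue_on {0..L}) g"
    and f: "\<And>a b. 0 \<le> a \<Longrightarrow> a \<le> b \<Longrightarrow> b \<le> L \<Longrightarrow> f b - f a = integral {a..b} g"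
  shows "AE x in lebesgue_on {0..L}. x < L \<and> (f has_vector_derivative g x) (at x within {x..L})"
proof -
  \<comment> \<open>Extension by zero makes the function integrable on every box, as the
    differentiation theorem asks.\<close>
  define g' where "g' x = (if x \<in> {0..L} then g x else 0)" for x
  have "g integrable_on {0..L}" by (rule integrable_on_lebesgue_on[OF gi]) simp
  then have "g' integrable_on UNIV"
    unfolding g'_def by (simp only: integrable_restrict_UNIV)
  then have "g' integrable_on cbox a b" for a b
    using integrable_on_subcbox by blast
  then obtain N where N: "negligible N" and lim: "\<And>x e. \<lbrakk>x \<notin> N; 0 < e\<rbrakk> \<Longrightarrow>
      \<exists>d>0. \<forall>h. 0 < h \<and> h < d \<longrightarrow> norm (integral (cbox x (x + h *\<^sub>R One)) g' /\<^sub>R h ^ DIM(real) - g' x) < e"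
    using integrable_ccontinuous_explicit[of g'] by metis
  have "AE x in lebesgue_on {0..L}. x \<notin> N"
    using N by (intro AE_lebesgue_on_notin) (auto simp: negligible_iff_null_sets)
  moreover have "AE x in lebesgue_on {0..L}. x \<notin> {L}"
    by (rule AE_lebesgue_on_notin) auto
  ultimately show ?thesis using AE_space
  proof eventually_elim
    case (elim x)
    then have x: "0 \<le> x" "x < L" "x \<notin> N" by auto
    have "(f has_derivative (\<lambda>h. h *\<^sub>R g x)) (at x within {x..L})"
      unfolding has_derivative_within_alt
    proof (intro conjI allI impI)
      show "bounded_linear (\<lambda>h. h *\<^sub>R g x)" by (rule bounded_linear_scaleR_left)
      fix e :: real assume e: "e > 0"
      obtain d where d: "d > 0" and lim_d: "\<And>h. 0 < h \<Longrightarrow> h < d \<Longrightarrow>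
          norm (integral (cbox x (x + h *\<^sub>R One)) g' /\<^sub>R h ^ DIM(real) - g' x) < e"
        using lim[OF x(3) e] by blast
      have lim_d: "norm (integral {x..x + h} g' /\<^sub>R h - g' x) < e" if "0 < h" "h < d" for h
        using lim_d[OF that] by simp
      show "\<exists>d>0. \<forall>y\<in>{x..L}. norm (y - x) < d \<longrightarrow> norm (f y - f x - (y - x) *\<^sub>R g x) \<le> e * norm (y - x)"
      proof (intro exI[of _ d] conjI ballI impI d)
        fix y assume y: "y \<in> {x..L}" "norm (y - x) < d"
        show "norm (f y - f x - (y - x) *\<^sub>R g x) \<le> e * norm (y - x)"
        proof (cases "y = x")
          case False
          define h where "h = y - x"
          have h: "0 < h" "h < d" "y = x + h" using y False by (auto simp: h_def)
          have "integral {x..x + h} g' = integral {x..y} g"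
            unfolding h(3)[symmetric] using x y by (intro integral_cong) (auto simp: g'_def)
          also have "\<dots> = f y - f x" by (rule f[symmetric]) (use x y in auto)
          finally have I: "integral {x..x + h} g' = f y - f x" .
          have "norm (f y - f x - h *\<^sub>R g x) = h * norm ((f y - f x) /\<^sub>R h - g x)"
          proof -
            have "f y - f x - h *\<^sub>R g x = h *\<^sub>R ((f y - f x) /\<^sub>R h - g x)"
              using h(1) by (simp add: scaleR_diff_right)
            then show ?thesis using h(1) by (simp only: norm_scaleR real_norm_def abs_of_pos)
          qed
          also have "\<dots> \<le> h * e"
          proof (rule mult_left_mono)
            show "norm ((f y - f x) /\<^sub>R h - g x) \<le> e"
              using lim_d[OF h(1,2)] x unfolding I by (simp add: g'_def)
          qed (use h(1) in simp)
          finally show ?thesis using h(1) by (simp add: h_def mult.commute)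
        qed simp
      qed
    qed
    then show ?case using x by (simp add: has_vector_derivative_def)
  qed
qed

text \<open>The zero function is a primitive of g, so almost everywhere g is its right
  derivative.\<close>

lemma zero_integrals_imp_AE_zero:
  fixes g :: "real \<Rightarrow> 'b::euclidean_space"
  assumes "integrable (lebesgue_on {0..L}) g"
    and "\<And>a b. 0 \<le> a \<Longrightarrow> a \<le> b \<Longrightarrow> b \<le> L \<Longrightarrow> integral {a..b} g = 0"
  shows "AE x in lebesgue_on {0..L}. g x = 0"
proof -
  have "AE x in lebesgue_on {0..L}. x < L \<and> ((\<lambda>_. 0) has_vector_derivative g x) (at x within {x..L})"
    using assms by (intro right_derivative_AE) auto
  then show ?thesis
  proof eventually_elim
    case (elim x)
    then show ?case
      using vector_derivative_unique_within_closed_interval[of x L x "\<lambda>_. 0" "g x" 0]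
      by (auto simp: has_vector_derivative_const)
  qed
qed

text \<open>Product rule almost everywhere: off a null set both primitives have right derivatives,
  and the right derivative of their inner product is that of a constant. It is applied to
  \<open>b \<bullet> b = 1\<close> and to the orthogonality of tangent and director.\<close>

lemma inner_const_imp_AE:
  fixes f k g j :: "real \<Rightarrow> 'b::euclidean_space"
  assumes gi: "integrable (lebesgue_on {0..L}) g" "integrable (lebesgue_on {0..L}) j"
    and f: "\<And>a b. 0 \<le> a \<Longrightarrow> a \<le> b \<Longrightarrow> b \<le> L \<Longrightarrow> f b - f a = integral {a..b} g"
    and k: "\<And>a b. 0 \<le> a \<Longrightarrow> a \<le> b \<Longrightarrow> b \<le> L \<Longrightarrow> k b - k a = integral {a..b} j"
    and c: "\<And>x. x \<in> {0..L} \<Longrightarrow> f x \<bullet> k x = c"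
  shows "AE x in lebesgue_on {0..L}. f x \<bullet> j x + g x \<bullet> k x = 0"
proof -
  have "AE x in lebesgue_on {0..L}. x < L \<and> (f has_vector_derivative g x) (at x within {x..L})"
    by (rule right_derivative_AE[OF gi(1)]) (rule f)
  moreover have "AE x in lebesgue_on {0..L}. x < L \<and> (k has_vector_derivative j x) (at x within {x..L})"
    by (rule right_derivative_AE[OF gi(2)]) (rule k)
  ultimately show ?thesis using AE_space
  proof eventually_elim
    case (elim x)
    have "((\<lambda>x. f x \<bullet> k x) has_vector_derivative (f x \<bullet> j x + g x \<bullet> k x)) (at x within {x..L})"
      using elim by (intro bounded_bilinear.has_vector_derivative[OF bounded_bilinear_inner]) auto
    moreover have "((\<lambda>x. f x \<bullet> k x) has_vector_derivative 0) (at x within {x..L})"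
      by (rule has_vector_derivative_transform[OF _ _ has_vector_derivative_const[of c]]) (use elim c in auto)
    ultimately show ?case
      using elim vector_derivative_unique_within_closed_interval[of x L x] by auto
  qed
qed

subsection \<open>The spaces \<open>H\<^sup>1\<close> and \<open>H\<^sup>2\<close>\<close>

lemma wderiv:
  assumes "f \<in> H1 L"
  shows "L2_fun L (wderiv L f)" "is_weak_deriv L f (wderiv L f)" "sq_integrable (lebesgue_on {0..L}) (wderiv L f)"
proof -
  have "\<exists>g. L2_fun L g \<and> is_weak_deriv L f g" using assms by (auto simp: H1_def)
  then have "L2_fun L (wderiv L f) \<and> is_weak_deriv L f (wderiv L f)"
    unfolding wderiv_def by (rule someI_ex)
  then show "L2_fun L (wderiv L f)" "is_weak_deriv L f (wderiv L f)" "sq_integrable (lebesgue_on {0..L}) (wderiv L f)"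
    by (auto simp: L2_fun_iff)
qed

lemma H1_continuous: "f \<in> H1 L \<Longrightarrow> continuous_on {0..L} f"
  by (simp add: H1_def)

lemma H1_sq_integrable: "f \<in> H1 L \<Longrightarrow> sq_integrable (lebesgue_on {0..L}) f"
  by (rule continuous_on_imp_sq_integrable[OF H1_continuous])

lemma wderiv_integrable: "f \<in> H1 L \<Longrightarrow> integrable (lebesgue_on {0..L}) (wderiv L f)"
  by (rule L2_fun_integrable[OF wderiv(1)])

lemma H1_FTC:
  assumes "f \<in> H1 L" "0 \<le> a" "a \<le> b" "b \<le> L"
  shows "f b - f a = integral {a..b} (wderiv L f)"
  using weak_deriv_FTC[OF H1_continuous wderiv(1,2)] assms by blast

lemma H1_I: "continuous_on {0..L} f \<Longrightarrow> L2_fun L g \<Longrightarrow> is_weak_deriv L f g \<Longrightarrow> f \<in> H1 L"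
  by (auto simp: H1_def)

text \<open>\<open>wderiv\<close> is an arbitrary choice among versions. Any two versions have equal
  integrals over all subintervals by the fundamental theorem, so a computed candidate may replace it
  almost everywhere.\<close>

lemma wderiv_AE_eq:
  assumes "continuous_on {0..L} f" "L2_fun L g" "is_weak_deriv L f g"
  shows "AE x in lebesgue_on {0..L}. wderiv L f x = g x"
proof -
  note f = H1_I[OF assms]
  have "AE x in lebesgue_on {0..L}. wderiv L f x - g x = 0"
  proof (rule zero_integrals_imp_AE_zero)
    fix a b :: real assume ab: "0 \<le> a" "a \<le> b" "b \<le> L"
    show "integral {a..b} (\<lambda>x. wderiv L f x - g x) = 0"
      using H1_FTC[OF f ab] weak_deriv_FTC[OF assms ab]
        integrable_imp_integrable_on_Icc(1)[OF wderiv_integrable[OF f] ab(1,3)]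
        integrable_imp_integrable_on_Icc(1)[OF L2_fun_integrable[OF assms(2)] ab(1,3)]
      by (simp add: Henstock_Kurzweil_Integration.integral_diff)
  qed (use wderiv_integrable[OF f] L2_fun_integrable[OF assms(2)] in simp)
  then show ?thesis by eventually_elim simp
qed

lemma test_function_product_integrable:
  fixes g :: "real \<Rightarrow> 'b::euclidean_space"
  assumes "continuous_on {0..L} \<phi>" "integrable (lebesgue_on {0..L}) g"
  shows "integrable (lebesgue_on {0..L}) (\<lambda>x. \<phi> x *\<^sub>R g x)"
proof -
  have "bounded (\<phi> ` {0..L})"
    using compact_continuous_image[OF assms(1) compact_Icc] compact_imp_bounded by blast
  then obtain B where "\<forall>y\<in>\<phi> ` {0..L}. norm y \<le> B"
    unfolding bounded_iff by blast
  then have B: "\<And>x. x \<in> {0..L} \<Longrightarrow> \<bar>\<phi> x\<bar> \<le> B" by auto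
  show ?thesis
  proof (rule Bochner_Integration.integrable_bound)
    show "integrable (lebesgue_on {0..L}) (\<lambda>x. B * norm (g x))" using assms(2) by simp
    show "(\<lambda>x. \<phi> x *\<^sub>R g x) \<in> borel_measurable (lebesgue_on {0..L})"
      by (intro borel_measurable_scaleR continuous_on_imp_measurable_Icc assms borel_measurable_integrable)
    show "AE x in lebesgue_on {0..L}. norm (\<phi> x *\<^sub>R g x) \<le> norm (B * norm (g x))"
      using AE_space
    proof eventually_elim
      case (elim x)
      then have "\<bar>\<phi> x\<bar> \<le> B" using B by simp
      then show ?case by (simp add: abs_mult mult_right_mono)
    qed
  qed
qed

lemma is_weak_deriv_add:
  assumes "continuous_on {0..L} f" "continuous_on {0..L} k" "L2_fun L g" "L2_fun L j"
    "is_weak_deriv L f g" "is_weak_deriv L k j"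
  shows "is_weak_deriv L (\<lambda>x. f x + k x) (\<lambda>x. g x + j x)"
  unfolding is_weak_deriv_def
proof
  fix \<phi> assume \<phi>: "\<phi> \<in> test_functions L"
  note c = test_function_props[OF \<phi>]
  note i = test_function_product_integrable[OF c(2) L2_fun_integrable[OF assms(3)]]
    test_function_product_integrable[OF c(2) L2_fun_integrable[OF assms(4)]]
    continuous_imp_integrable_real[OF continuous_on_scaleR[OF c(3) assms(1)]]
    continuous_imp_integrable_real[OF continuous_on_scaleR[OF c(3) assms(2)]]
  show "(LINT x|lebesgue_on {0..L}. deriv \<phi> x *\<^sub>R (f x + k x)) = - (LINT x|lebesgue_on {0..L}. \<phi> x *\<^sub>R (g x + j x))"
    using i bspec[OF assms(5)[unfolded is_weak_deriv_def] \<phi>] bspec[OF assms(6)[unfolded is_weak_deriv_def] \<phi>]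
    by (simp add: scaleR_add_right)
qed

lemma is_weak_deriv_scaleR:
  assumes "is_weak_deriv L f g"
  shows "is_weak_deriv L (\<lambda>x. c *\<^sub>R f x) (\<lambda>x. c *\<^sub>R g x)"
  unfolding is_weak_deriv_def
proof
  fix \<phi> assume \<phi>: "\<phi> \<in> test_functions L"
  have "(LINT x|lebesgue_on {0..L}. deriv \<phi> x *\<^sub>R c *\<^sub>R f x) = c *\<^sub>R (LINT x|lebesgue_on {0..L}. deriv \<phi> x *\<^sub>R f x)"
    unfolding scaleR_left_commute[of _ c] by (rule integral_scaleR_right)
  also have "\<dots> = - (LINT x|lebesgue_on {0..L}. \<phi> x *\<^sub>R c *\<^sub>R g x)"
    unfolding scaleR_left_commute[of _ c] integral_scaleR_right
    using bspec[OF assms[unfolded is_weak_deriv_def] \<phi>] by simp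
  finally show "(LINT x|lebesgue_on {0..L}. deriv \<phi> x *\<^sub>R c *\<^sub>R f x) = - (LINT x|lebesgue_on {0..L}. \<phi> x *\<^sub>R c *\<^sub>R g x)" .
qed

lemma is_weak_deriv_cong:
  assumes "\<And>x. x \<in> {0..L} \<Longrightarrow> f x = f' x" "\<And>x. x \<in> {0..L} \<Longrightarrow> g x = g' x"
  shows "is_weak_deriv L f g \<longleftrightarrow> is_weak_deriv L f' g'"
proof -
  have "(LINT x|lebesgue_on {0..L}. deriv \<phi> x *\<^sub>R f x) = (LINT x|lebesgue_on {0..L}. deriv \<phi> x *\<^sub>R f' x)"
    "(LINT x|lebesgue_on {0..L}. \<phi> x *\<^sub>R g x) = (LINT x|lebesgue_on {0..L}. \<phi> x *\<^sub>R g' x)" for \<phi>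
    using assms by (auto intro!: Bochner_Integration.integral_cong)
  then show ?thesis unfolding is_weak_deriv_def by simp
qed

lemma H1_cong:
  assumes "\<And>x. x \<in> {0..L} \<Longrightarrow> f x = f' x"
  shows "f \<in> H1 L \<longleftrightarrow> f' \<in> H1 L"
  using is_weak_deriv_cong[OF assms refl] continuous_on_cong[OF refl assms, of "{0..L}"]
  unfolding H1_def by simp

lemma wderiv_cong:
  assumes "\<And>x. x \<in> {0..L} \<Longrightarrow> f x = f' x"
  shows "wderiv L f = wderiv L f'"
  unfolding wderiv_def using is_weak_deriv_cong[OF assms refl] by auto

lemma L2_fun_add: "L2_fun L f \<Longrightarrow> L2_fun L g \<Longrightarrow> L2_fun L (\<lambda>x. f x + g x)"
  by (simp add: L2_fun_iff sq_integrable_add)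

lemma L2_fun_scaleR: "L2_fun L f \<Longrightarrow> L2_fun L (\<lambda>x. c *\<^sub>R f x)"
  by (simp add: L2_fun_iff sq_integrable_scaleR)

lemma H1_add:
  assumes "f \<in> H1 L" "g \<in> H1 L"
  shows "(\<lambda>x. f x + g x) \<in> H1 L"
    "AE x in lebesgue_on {0..L}. wderiv L (\<lambda>x. f x + g x) x = wderiv L f x + wderiv L g x"
proof -
  have c: "continuous_on {0..L} (\<lambda>x. f x + g x)" by (intro continuous_intros H1_continuous assms)
  note a = c L2_fun_add[OF wderiv(1)[OF assms(1)] wderiv(1)[OF assms(2)]]
    is_weak_deriv_add[OF H1_continuous H1_continuous wderiv(1) wderiv(1) wderiv(2) wderiv(2), OF assms assms assms]
  show "(\<lambda>x. f x + g x) \<in> H1 L" by (rule H1_I[OF a])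
  show "AE x in lebesgue_on {0..L}. wderiv L (\<lambda>x. f x + g x) x = wderiv L f x + wderiv L g x"
    by (rule wderiv_AE_eq[OF a])
qed

lemma H1_scaleR:
  assumes "f \<in> H1 L"
  shows "(\<lambda>x. c *\<^sub>R f x) \<in> H1 L"
    "AE x in lebesgue_on {0..L}. wderiv L (\<lambda>x. c *\<^sub>R f x) x = c *\<^sub>R wderiv L f x"
proof -
  have c: "continuous_on {0..L} (\<lambda>x. c *\<^sub>R f x)" by (intro continuous_intros H1_continuous assms)
  note a = c L2_fun_scaleR[OF wderiv(1)[OF assms]] is_weak_deriv_scaleR[OF wderiv(2)[OF assms]]
  show "(\<lambda>x. c *\<^sub>R f x) \<in> H1 L" by (rule H1_I[OF a])
  show "AE x in lebesgue_on {0..L}. wderiv L (\<lambda>x. c *\<^sub>R f x) x = c *\<^sub>R wderiv L f x"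
    by (rule wderiv_AE_eq[OF a])
qed

lemma H1_diff:
  assumes "f \<in> H1 L" "g \<in> H1 L"
  shows "(\<lambda>x. f x - g x) \<in> H1 L"
    "AE x in lebesgue_on {0..L}. wderiv L (\<lambda>x. f x - g x) x = wderiv L f x - wderiv L g x"
proof -
  note h = H1_scaleR[OF assms(2), of "-1"]
  show "(\<lambda>x. f x - g x) \<in> H1 L" using H1_add(1)[OF assms(1) h(1)] by simp
  show "AE x in lebesgue_on {0..L}. wderiv L (\<lambda>x. f x - g x) x = wderiv L f x - wderiv L g x"
    using H1_add(2)[OF assms(1) h(1)] h(2) by eventually_elim simp
qed

text \<open>Integrate the derivative of \<phi> times f; \<phi> vanishes at both ends. The finite
  exceptional set is there for the nodes, where piecewise functions have kinks.\<close>

lemma is_weak_deriv_of_has_vector_derivative: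
  assumes "finite S" "0 \<le> L" and f: "continuous_on {0..L} f" and g: "integrable (lebesgue_on {0..L}) g"
    and d: "\<And>x. x \<in> {0<..<L} - S \<Longrightarrow> (f has_vector_derivative g x) (at x)"
  shows "is_weak_deriv L f g"
  unfolding is_weak_deriv_def
proof
  fix \<phi> assume \<phi>: "\<phi> \<in> test_functions L"
  note c = test_function_props[OF \<phi>]
  have i1: "integrable (lebesgue_on {0..L}) (\<lambda>x. deriv \<phi> x *\<^sub>R f x)"
    by (intro continuous_imp_integrable_real continuous_on_scaleR c f)
  have i2: "integrable (lebesgue_on {0..L}) (\<lambda>x. \<phi> x *\<^sub>R g x)"
    by (rule test_function_product_integrable[OF c(2) g])
  have "((\<lambda>x. \<phi> x *\<^sub>R g x + deriv \<phi> x *\<^sub>R f x) has_integral (\<phi> L *\<^sub>R f L - \<phi> 0 *\<^sub>R f 0)) {0..L}"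
  proof (rule fundamental_theorem_of_calculus_interior_strong[OF assms(1,2)])
    show "((\<lambda>x. \<phi> x *\<^sub>R f x) has_vector_derivative \<phi> x *\<^sub>R g x + deriv \<phi> x *\<^sub>R f x) (at x)"
      if "x \<in> {0<..<L} - S" for x
      using c(1) d[OF that] by (intro bounded_bilinear.has_vector_derivative[OF bounded_bilinear_scaleR])
        (simp_all add: has_real_derivative_iff_has_vector_derivative)
  qed (intro continuous_intros c f)
  then have "integral {0..L} (\<lambda>x. \<phi> x *\<^sub>R g x + deriv \<phi> x *\<^sub>R f x) = 0"
    using c by (simp add: integral_unique)
  moreover have "(LINT x|lebesgue_on {0..L}. \<phi> x *\<^sub>R g x + deriv \<phi> x *\<^sub>R f x)
      = integral {0..L} (\<lambda>x. \<phi> x *\<^sub>R g x + deriv \<phi> x *\<^sub>R f x)"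
    by (rule lebesgue_integral_eq_integral) (use i1 i2 in auto)
  ultimately show "(LINT x|lebesgue_on {0..L}. deriv \<phi> x *\<^sub>R f x) = - (LINT x|lebesgue_on {0..L}. \<phi> x *\<^sub>R g x)"
    using i1 i2 by (simp add: add_eq_0_iff)
qed

lemma cderiv_eqI:
  assumes "0 < L" "x \<in> {0..L}" "(y has_vector_derivative p) (at x within {0..L})"
  shows "cderiv L y x = p"
  unfolding cderiv_def using vector_derivative_within_cbox[of 0 L x y p] assms by simp

text \<open>y is the primitive of the continuous representative p of its weak derivative, hence
  classically differentiable up to the endpoints with \<open>cderiv L y = p\<close> on
  [0, L].\<close>

lemma H2_D:
  assumes L: "0 < L" and y: "y \<in> H2 L"
  shows "y \<in> H1 L" "cderiv L y \<in> H1 L"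
    "x \<in> {0..L} \<Longrightarrow> (y has_vector_derivative cderiv L y x) (at x within {0..L})"
    "is_weak_deriv L y (cderiv L y)"
proof -
  show y1: "y \<in> H1 L" using y by (simp add: H2_def)
  obtain p where p: "p \<in> H1 L" "is_weak_deriv L y p" using y by (auto simp: H2_def)
  have p2: "L2_fun L p" using H1_sq_integrable[OF p(1)] by (simp add: L2_fun_iff)
  have d: "(y has_vector_derivative p x) (at x within {0..L})" if x: "x \<in> {0..L}" for x
  proof (rule has_vector_derivative_transform[OF x])
    show "y x = y 0 + integral {0..x} p" if "x \<in> {0..L}" for x
      using weak_deriv_FTC[OF H1_continuous[OF y1] p2 p(2), of 0 x] that by (simp add: diff_eq_eq add.commute)
    show "((\<lambda>x. y 0 + integral {0..x} p) has_vector_derivative p x) (at x within {0..L})"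
      using integral_has_vector_derivative[OF H1_continuous[OF p(1)] x]
      by (auto intro!: derivative_eq_intros)
  qed
  then have c: "cderiv L y x = p x" if "x \<in> {0..L}" for x
    using cderiv_eqI[OF L that] that by blast
  show "cderiv L y \<in> H1 L" using H1_cong[of L "cderiv L y" p] c p by blast
  show "x \<in> {0..L} \<Longrightarrow> (y has_vector_derivative cderiv L y x) (at x within {0..L})"
    using d c by simp
  show "is_weak_deriv L y (cderiv L y)"
    using is_weak_deriv_cong[of L y y "cderiv L y" p] c p by blast
qed

lemma H2_I:
  assumes L: "0 < L" and p: "p \<in> H1 L"
    and d: "\<And>x. x \<in> {0..L} \<Longrightarrow> (y has_vector_derivative p x) (at x within {0..L})"
  shows "y \<in> H2 L" "x \<in> {0..L} \<Longrightarrow> cderiv L y x = p x" "wderiv2 L y = wderiv L p"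
proof -
  have c: "continuous_on {0..L} y" using d continuous_on_vector_derivative by blast
  have w: "is_weak_deriv L y p"
  proof (rule is_weak_deriv_of_has_vector_derivative[of "{}"])
    show "(y has_vector_derivative p x) (at x)" if "x \<in> {0<..<L} - {}" for x
      using d[of x] that at_within_Icc_at[of 0 x L] by auto
  qed (use L c sq_integrable_imp_integrable[OF finite_measure_Icc H1_sq_integrable[OF p]] in auto)
  then show "y \<in> H2 L"
    using c p H1_sq_integrable[OF p] unfolding H2_def H1_def by (auto simp: L2_fun_iff)
  show eq: "x \<in> {0..L} \<Longrightarrow> cderiv L y x = p x" for x using cderiv_eqI[OF L] d by blast
  show "wderiv2 L y = wderiv L p" by (rule wderiv_cong[OF eq])
qed

lemma H2_add:
  assumes L: "0 < L" and u: "u \<in> H2 L" and v: "v \<in> H2 L"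
  shows "(\<lambda>x. u x + v x) \<in> H2 L"
    "x \<in> {0..L} \<Longrightarrow> cderiv L (\<lambda>x. u x + v x) x = cderiv L u x + cderiv L v x"
    "AE x in lebesgue_on {0..L}. wderiv2 L (\<lambda>x. u x + v x) x = wderiv2 L u x + wderiv2 L v x"
proof -
  note h = H1_add[OF H2_D(2)[OF L u] H2_D(2)[OF L v]]
  have d: "((\<lambda>x. u x + v x) has_vector_derivative cderiv L u x + cderiv L v x) (at x within {0..L})"
    if "x \<in> {0..L}" for x
    by (intro derivative_intros H2_D(3)[OF L] u v that)
  note i = H2_I[OF L h(1) d]
  show "(\<lambda>x. u x + v x) \<in> H2 L" by (rule i(1))
  show "x \<in> {0..L} \<Longrightarrow> cderiv L (\<lambda>x. u x + v x) x = cderiv L u x + cderiv L v x" by (rule i(2))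
  show "AE x in lebesgue_on {0..L}. wderiv2 L (\<lambda>x. u x + v x) x = wderiv2 L u x + wderiv2 L v x"
    unfolding H2_I(3)[of L "\<lambda>x. cderiv L u x + cderiv L v x" "\<lambda>x. u x + v x", OF L h(1) d, simplified] by (rule h(2))
qed

lemma H2_scaleR:
  assumes L: "0 < L" and u: "u \<in> H2 L"
  shows "(\<lambda>x. c *\<^sub>R u x) \<in> H2 L"
    "x \<in> {0..L} \<Longrightarrow> cderiv L (\<lambda>x. c *\<^sub>R u x) x = c *\<^sub>R cderiv L u x"
    "AE x in lebesgue_on {0..L}. wderiv2 L (\<lambda>x. c *\<^sub>R u x) x = c *\<^sub>R wderiv2 L u x"
proof -
  note h = H1_scaleR[OF H2_D(2)[OF L u], of c]
  have d: "((\<lambda>x. c *\<^sub>R u x) has_vector_derivative c *\<^sub>R cderiv L u x) (at x within {0..L})"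
    if "x \<in> {0..L}" for x
    using bounded_linear.has_vector_derivative[OF bounded_linear_scaleR_right H2_D(3)[OF L u that]] .
  note i = H2_I[OF L h(1) d]
  show "(\<lambda>x. c *\<^sub>R u x) \<in> H2 L" by (rule i(1))
  show "x \<in> {0..L} \<Longrightarrow> cderiv L (\<lambda>x. c *\<^sub>R u x) x = c *\<^sub>R cderiv L u x" by (rule i(2))
  show "AE x in lebesgue_on {0..L}. wderiv2 L (\<lambda>x. c *\<^sub>R u x) x = c *\<^sub>R wderiv2 L u x"
    unfolding H2_I(3)[of L "\<lambda>x. c *\<^sub>R cderiv L u x" "\<lambda>x. c *\<^sub>R u x", OF L h(1) d, simplified] by (rule h(2))
qed

section \<open>Hoelder, Poincare and Sobolev estimates\<close>

lemma integral_norm_sq_cong_AE: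
  assumes [measurable]: "f \<in> borel_measurable M" "g \<in> borel_measurable M" and "AE x in M. f x = g x"
  shows "(LINT x|M. (norm (f x))\<^sup>2) = (LINT x|M. (norm (g x))\<^sup>2)"
proof (rule integral_cong_AE)
  show "AE x in M. (norm (f x))\<^sup>2 = (norm (g x))\<^sup>2"
    using assms(3) by eventually_elim simp
qed measurable

lemma lebesgue_integral_subinterval_le:
  fixes h :: "real \<Rightarrow> real"
  assumes "integrable (lebesgue_on {0..L}) h" "0 \<le> a" "b \<le> L" "\<And>x. h x \<ge> 0"
  shows "(LINT x|lebesgue_on {a..b}. h x) \<le> (LINT x|lebesgue_on {0..L}. h x)"
proof -
  note i = integrable_imp_integrable_on_Icc[OF assms(1)]
  have "integral {a..b} h \<le> integral {0..L} h"
    using assms by (intro integral_subset_le i(1)) auto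
  then show ?thesis using i(2)[OF assms(2,3)] i(2)[of 0 L] by simp
qed

lemma norm_integral_sq_le:
  fixes g :: "real \<Rightarrow> 'b::euclidean_space"
  assumes g: "sq_integrable (lebesgue_on {0..L}) g" and ab: "0 \<le> a" "a \<le> b" "b \<le> L"
  shows "(norm (integral {a..b} g))\<^sup>2 \<le> (b - a) * (LINT x|lebesgue_on {0..L}. (norm (g x))\<^sup>2)"
proof -
  let ?M = "lebesgue_on {a..b}"
  define I where "I = integral {a..b} g"
  note gi = sq_integrable_imp_integrable[OF finite_measure_Icc g]
  have I: "I = (LINT x|?M. g x)" using integrable_imp_integrable_on_Icc(2)[OF gi ab(1,3)] by (simp add: I_def)
  have gs: "sq_integrable ?M g"
    using integrable_imp_integrable_on_Icc(3)[OF gi ab(1,3)] integrable_imp_integrable_on_Icc(3)[OF sq_integrable_norm_sq[OF g] ab(1,3)]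
    by (auto simp: sq_integrable_def)
  \<comment> \<open>Pairing g with its own integral I produces the square of \<open>norm I\<close>
    on the left; Cauchy-Schwarz then leaves one such factor to cancel.\<close>
  have "sq_integrable ?M (\<lambda>_. I)" by (intro continuous_on_imp_sq_integrable continuous_intros)
  from Cauchy_Schwarz_integral[OF gs this]
  have "((norm I)\<^sup>2)\<^sup>2 \<le> (LINT x|?M. (norm (g x))\<^sup>2) * ((b - a) * (norm I)\<^sup>2)"
    using integrable_imp_integrable_on_Icc(3)[OF gi ab(1,3)] ab
    by (simp add: I[symmetric] measure_restrict_space power2_norm_eq_inner)
  also have "\<dots> \<le> (LINT x|lebesgue_on {0..L}. (norm (g x))\<^sup>2) * ((b - a) * (norm I)\<^sup>2)"
    by (intro mult_right_mono lebesgue_integral_subinterval_le sq_integrable_norm_sq g) (use ab in auto)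
  finally have *: "(norm I)\<^sup>2 * (norm I)\<^sup>2 \<le> ((b - a) * (LINT x|lebesgue_on {0..L}. (norm (g x))\<^sup>2)) * (norm I)\<^sup>2"
    by (simp add: power2_eq_square[of "(norm I)\<^sup>2"] mult_ac)
  show ?thesis
  proof (cases "I = 0")
    case True
    then show ?thesis using ab by (simp add: I_def[symmetric])
  next
    case False
    then have "(norm I)\<^sup>2 > 0" by simp
    then show ?thesis using mult_right_le_imp_le[OF *] by (simp add: I_def)
  qed
qed

text \<open>The modulus of continuity depends on f only through the derivative bound. This is the
  equicontinuity used whenever discrete values are compared at nearby points.\<close>

lemma H1_Hoelder:
  assumes "f \<in> H1 L" "x \<in> {0..L}" "y \<in> {0..L}"
  shows "(norm (f x - f y))\<^sup>2 \<le> \<bar>x - y\<bar> * (LINT x|lebesgue_on {0..L}. (norm (wderiv L f x))\<^sup>2)"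
proof -
  have *: "(norm (f b - f a))\<^sup>2 \<le> (b - a) * (LINT x|lebesgue_on {0..L}. (norm (wderiv L f x))\<^sup>2)"
    if "0 \<le> a" "a \<le> b" "b \<le> L" for a b
    using norm_integral_sq_le[OF wderiv(3)[OF assms(1)] that] H1_FTC[OF assms(1) that] by simp
  show ?thesis
  proof (cases "y \<le> x")
    case True
    then show ?thesis using *[of y x] assms by simp
  next
    case False
    then show ?thesis using *[of x y] assms by (simp add: norm_minus_commute)
  qed
qed

lemma measure_lebesgue_on_Icc: "0 \<le> L \<Longrightarrow> measure (lebesgue_on {0..L}) {0..L} = (L::real)"
  by (simp add: measure_restrict_space)

lemma H1_Poincare:
  assumes L: "0 \<le> L" and f: "f \<in> H1 L" "f 0 = 0"
  shows "(LINT x|lebesgue_on {0..L}. (norm (f x))\<^sup>2) \<le> L\<^sup>2 * (LINT x|lebesgue_on {0..L}. (norm (wderiv L f x))\<^sup>2)"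
proof -
  define D where "D = (LINT x|lebesgue_on {0..L}. (norm (wderiv L f x))\<^sup>2)"
  have D: "D \<ge> 0" by (simp add: D_def)
  have "(LINT x|lebesgue_on {0..L}. (norm (f x))\<^sup>2) \<le> (LINT x|lebesgue_on {0..L}. L * D)"
  proof (rule integral_mono)
    fix x assume x: "x \<in> space (lebesgue_on {0..L})"
    then have "(norm (f x))\<^sup>2 \<le> x * D" using H1_Hoelder[OF f(1), of x 0] f(2) by (simp add: D_def)
    also have "\<dots> \<le> L * D" using x D by (intro mult_right_mono) auto
    finally show "(norm (f x))\<^sup>2 \<le> L * D" .
  qed (use sq_integrable_norm_sq[OF H1_sq_integrable[OF f(1)]] in auto)
  also have "\<dots> = L\<^sup>2 * D"
    using measure_lebesgue_on_Icc[OF L] by (simp add: power2_eq_square)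
  finally show ?thesis by (simp add: D_def)
qed

text \<open>With D the squared norm of the derivative, Hoelder gives
  \<open>|f x|^2 \<le> 2 |f s|^2 + 2 L D\<close> for every s. Averaging over s produces the
  coefficients 2/L and 2L, whose sum serves as a common factor.\<close>

lemma H1_Sobolev:
  assumes L: "0 < L" and f: "f \<in> H1 L" and x: "x \<in> {0..L}"
  shows "norm (f x) \<le> sqrt (2 / L + 2 * L) * H1_norm L f"
proof -
  define A D where "A = (LINT x|lebesgue_on {0..L}. (norm (f x))\<^sup>2)"
    and "D = (LINT x|lebesgue_on {0..L}. (norm (wderiv L f x))\<^sup>2)"
  have D: "D \<ge> 0" "A \<ge> 0" by (simp_all add: D_def A_def)
  note fi = sq_integrable_norm_sq[OF H1_sq_integrable[OF f]]
  have "(LINT s|lebesgue_on {0..L}. (norm (f x))\<^sup>2) \<le> (LINT s|lebesgue_on {0..L}. 2 * (norm (f s))\<^sup>2 + 2 * (L * D))"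
  proof (rule integral_mono)
    fix s assume s: "s \<in> space (lebesgue_on {0..L})"
    have "(norm (f x - f s))\<^sup>2 \<le> \<bar>x - s\<bar> * D" using H1_Hoelder[OF f x, of s] s by (simp add: D_def)
    also have "\<dots> \<le> L * D" using x s D by (intro mult_right_mono) auto
    finally have d: "(norm (f x - f s))\<^sup>2 \<le> L * D" .
    have "norm (f x) \<le> norm (f s) + norm (f x - f s)" using norm_triangle_sub[of "f x" "f s"] .
    then have "(norm (f x))\<^sup>2 \<le> (norm (f s) + norm (f x - f s))\<^sup>2" by (intro power_mono) auto
    also have "\<dots> \<le> 2 * (norm (f s))\<^sup>2 + 2 * (norm (f x - f s))\<^sup>2"
      using sum_squares_bound[of "norm (f s)" "norm (f x - f s)"] by (simp add: power2_sum)
    finally show "(norm (f x))\<^sup>2 \<le> 2 * (norm (f s))\<^sup>2 + 2 * (L * D)" using d by linarith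
  qed (use fi in auto)
  also have "\<dots> = 2 * A + L * (2 * (L * D))"
    using fi measure_lebesgue_on_Icc[of L] L by (simp add: A_def)
  finally have "L * (norm (f x))\<^sup>2 \<le> 2 * A + 2 * L\<^sup>2 * D"
    using measure_lebesgue_on_Icc[of L] L by (simp add: power2_eq_square)
  then have "(norm (f x))\<^sup>2 \<le> 2 / L * A + 2 * L * D"
    using L by (simp add: field_simps power2_eq_square)
  also have "\<dots> \<le> (2 / L + 2 * L) * A + (2 / L + 2 * L) * D"
    using L D by (intro add_mono mult_right_mono) auto
  finally have "(norm (f x))\<^sup>2 \<le> (2 / L + 2 * L) * (A + D)" by (simp add: distrib_left)
  from real_sqrt_le_mono[OF this] show ?thesis
    by (simp add: real_sqrt_mult H1_norm_def A_def D_def)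
qed

subsection \<open>Bounded functionals and weak convergence\<close>

lemma H1_norm_nonneg: "H1_norm L f \<ge> 0" by (simp add: H1_norm_def)

lemma dual_functional_add:
  "dual_functional X nrm F \<Longrightarrow> u \<in> X \<Longrightarrow> v \<in> X \<Longrightarrow> F (\<lambda>x. u x + v x) = F u + F v"
  by (simp add: dual_functional_def)

lemma dual_functional_scaleR:
  "dual_functional X nrm F \<Longrightarrow> u \<in> X \<Longrightarrow> F (\<lambda>x. c *\<^sub>R u x) = c * F u"
  by (simp add: dual_functional_def)

lemma dual_functional_bound:
  assumes "dual_functional X nrm F"
  shows "\<exists>C. \<forall>u\<in>X. \<bar>F u\<bar> \<le> C * nrm u"
  using assms by (simp add: dual_functional_def)

lemma weakly_convergesD:
  "weakly_converges X nrm u v \<Longrightarrow> dual_functional X nrm F \<Longrightarrow> (\<lambda>n. F (u n)) \<longlonglongrightarrow> F v"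
  by (simp add: weakly_converges_def)

lemma weakly_converges_mem:
  assumes "weakly_converges X nrm u v"
  shows "u n \<in> X" "v \<in> X"
proof -
  note * = assms[unfolded weakly_converges_def]
  show "u n \<in> X" using conjunct1[OF *] by (rule spec)
  show "v \<in> X" by (rule conjunct1[OF conjunct2[OF *]])
qed

text \<open>Boundedness of point evaluations is the Sobolev inequality; through it weak convergence
  becomes pointwise convergence, at the boundary points as well.\<close>

lemma dual_H1_eval:
  assumes L: "0 < L" and x: "x \<in> {0..L}"
  shows "dual_functional (H1 L) (H1_norm L) (\<lambda>u. u x \<bullet> e)"
  unfolding dual_functional_def
proof (intro conjI ballI allI exI)
  fix u assume u: "u \<in> H1 L"
  have "\<bar>u x \<bullet> e\<bar> \<le> norm (u x) * norm e" by (rule Cauchy_Schwarz_ineq2)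
  also have "\<dots> \<le> (sqrt (2 / L + 2 * L) * H1_norm L u) * norm e"
    by (intro mult_right_mono H1_Sobolev[OF L u x]) simp
  finally show "\<bar>u x \<bullet> e\<bar> \<le> (sqrt (2 / L + 2 * L) * norm e) * H1_norm L u" by (simp add: mult_ac)
qed (simp_all add: inner_add_left)

lemma dual_H1_wderiv:
  assumes w: "sq_integrable (lebesgue_on {0..L}) w"
  shows "dual_functional (H1 L) (H1_norm L) (\<lambda>u. LINT x|lebesgue_on {0..L}. wderiv L u x \<bullet> w x)"
  unfolding dual_functional_def
proof (intro conjI ballI allI exI)
  fix u v assume u: "u \<in> H1 L" and v: "v \<in> H1 L"
  note m = sq_integrable_measurable[OF w] sq_integrable_measurable[OF wderiv(3)]
  have "(LINT x|lebesgue_on {0..L}. wderiv L (\<lambda>x. u x + v x) x \<bullet> w x)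
      = (LINT x|lebesgue_on {0..L}. wderiv L u x \<bullet> w x + wderiv L v x \<bullet> w x)"
  proof (rule integral_cong_AE)
    show "AE x in lebesgue_on {0..L}. wderiv L (\<lambda>x. u x + v x) x \<bullet> w x = wderiv L u x \<bullet> w x + wderiv L v x \<bullet> w x"
      using H1_add(2)[OF u v] by eventually_elim (simp add: inner_add_left)
  qed (intro borel_measurable_inner borel_measurable_add m u v H1_add(1))+
  then show "(LINT x|lebesgue_on {0..L}. wderiv L (\<lambda>x. u x + v x) x \<bullet> w x)
      = (LINT x|lebesgue_on {0..L}. wderiv L u x \<bullet> w x) + (LINT x|lebesgue_on {0..L}. wderiv L v x \<bullet> w x)"
    using sq_integrable_inner[OF wderiv(3)[OF u] w] sq_integrable_inner[OF wderiv(3)[OF v] w] by simp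
next
  fix c u assume u: "u \<in> H1 L"
  note m = sq_integrable_measurable[OF w] sq_integrable_measurable[OF wderiv(3)]
  have "(LINT x|lebesgue_on {0..L}. wderiv L (\<lambda>x. c *\<^sub>R u x) x \<bullet> w x)
      = (LINT x|lebesgue_on {0..L}. c * (wderiv L u x \<bullet> w x))"
  proof (rule integral_cong_AE)
    show "AE x in lebesgue_on {0..L}. wderiv L (\<lambda>x. c *\<^sub>R u x) x \<bullet> w x = c * (wderiv L u x \<bullet> w x)"
      using H1_scaleR(2)[OF u, of c] by eventually_elim simp
  qed (intro borel_measurable_inner borel_measurable_times borel_measurable_const m u H1_scaleR(1))+
  then show "(LINT x|lebesgue_on {0..L}. wderiv L (\<lambda>x. c *\<^sub>R u x) x \<bullet> w x)
      = c * (LINT x|lebesgue_on {0..L}. wderiv L u x \<bullet> w x)" by simp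
next
  fix u assume u: "u \<in> H1 L"
  have "\<bar>LINT x|lebesgue_on {0..L}. wderiv L u x \<bullet> w x\<bar>
    \<le> sqrt (LINT x|lebesgue_on {0..L}. (norm (wderiv L u x))\<^sup>2) * sqrt (LINT x|lebesgue_on {0..L}. (norm (w x))\<^sup>2)"
    by (rule Cauchy_Schwarz_integral_sqrt[OF wderiv(3)[OF u] w])
  also have "\<dots> \<le> H1_norm L u * sqrt (LINT x|lebesgue_on {0..L}. (norm (w x))\<^sup>2)"
    unfolding H1_norm_def by (intro mult_right_mono real_sqrt_le_mono) auto
  finally show "\<bar>LINT x|lebesgue_on {0..L}. wderiv L u x \<bullet> w x\<bar>
    \<le> sqrt (LINT x|lebesgue_on {0..L}. (norm (w x))\<^sup>2) * H1_norm L u" by (simp add: mult.commute)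
qed

text \<open>Functionals act on total functions, while identities such as the additivity of
  \<open>cderiv\<close> hold on [0, L] only. The difference of two functions agreeing there has norm
  zero, so a bounded functional cannot distinguish them.\<close>

lemma dual_H1_cong:
  assumes F: "dual_functional (H1 L) (H1_norm L) F" and u: "u \<in> H1 L" and uv: "\<And>x. x \<in> {0..L} \<Longrightarrow> u x = v x"
  shows "F u = F v"
proof -
  have v: "v \<in> H1 L" using H1_cong[of L u v] uv u by simp
  define d where "d x = u x + (-1) *\<^sub>R v x" for x
  have d: "d \<in> H1 L" unfolding d_def using H1_add(1)[OF u H1_scaleR(1)[OF v]] .
  have d0: "d x = 0" if "x \<in> {0..L}" for x using uv[OF that] by (simp add: d_def)
  \<comment> \<open>The zero function is represented as \<open>0 *\<^sub>R u\<close>, so that the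
    scaling rule determines its weak derivative.\<close>
  have "AE x in lebesgue_on {0..L}. wderiv L d x = 0"
    using H1_scaleR(2)[OF u, of 0] wderiv_cong[of L d "\<lambda>x. 0 *\<^sub>R u x"] d0 by simp
  then have "AE x in lebesgue_on {0..L}. (norm (wderiv L d x))\<^sup>2 = 0"
    by eventually_elim simp
  then have "(LINT x|lebesgue_on {0..L}. (norm (wderiv L d x))\<^sup>2) = 0"
    by (rule integral_eq_zero_AE)
  moreover have "(LINT x|lebesgue_on {0..L}. (norm (d x))\<^sup>2) = 0"
    by (intro integral_eq_zero_AE AE_I2) (use d0 in auto)
  ultimately have "H1_norm L d = 0" by (simp add: H1_norm_def)
  moreover obtain C where "\<forall>u\<in>H1 L. \<bar>F u\<bar> \<le> C * H1_norm L u"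
    using dual_functional_bound[OF F] ..
  note this[rule_format, OF d]
  ultimately have "F d = 0" by simp
  moreover have "F d = F u + F (\<lambda>x. (-1) *\<^sub>R v x)"
    unfolding d_def[abs_def] by (rule dual_functional_add[OF F u H1_scaleR(1)[OF v]])
  moreover have "F (\<lambda>x. (-1) *\<^sub>R v x) = (-1) * F v"
    by (rule dual_functional_scaleR[OF F v])
  ultimately show ?thesis by simp
qed

lemma H2_wderiv_AE:
  assumes L: "0 < L" and y: "y \<in> H2 L"
  shows "AE x in lebesgue_on {0..L}. wderiv L y x = cderiv L y x"
  by (rule wderiv_AE_eq[OF H1_continuous[OF H2_D(1)[OF L y]] _ H2_D(4)[OF L y]])
    (simp only: L2_fun_iff H1_sq_integrable[OF H2_D(2)[OF L y]])

lemma H2_norm_ge: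
  assumes L: "0 < L" and y: "y \<in> H2 L"
  shows "H1_norm L y \<le> H2_norm L y" "H1_norm L (cderiv L y) \<le> H2_norm L y"
proof -
  have "(LINT x|lebesgue_on {0..L}. (norm (wderiv L y x))\<^sup>2) = (LINT x|lebesgue_on {0..L}. (norm (cderiv L y x))\<^sup>2)"
    by (intro integral_norm_sq_cong_AE H2_wderiv_AE[OF L y] sq_integrable_measurable wderiv(3) H2_D(1)[OF L y]
        H1_sq_integrable[OF H2_D(2)[OF L y]])
  then show "H1_norm L y \<le> H2_norm L y"
    unfolding H1_norm_def H2_norm_def by (intro real_sqrt_le_mono) simp
  show "H1_norm L (cderiv L y) \<le> H2_norm L y"
    unfolding H1_norm_def H2_norm_def by (intro real_sqrt_le_mono) simp
qed

text \<open>The inclusion and differentiation are both bounded from H2 to H1, so functionals pull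
  back along them. The constant C may be negative, hence its absolute value.\<close>

lemma dual_H2_of_H1:
  assumes L: "0 < L" and F: "dual_functional (H1 L) (H1_norm L) F"
  shows "dual_functional (H2 L) (H2_norm L) F" "dual_functional (H2 L) (H2_norm L) (\<lambda>u. F (cderiv L u))"
proof -
  obtain C where "\<forall>u\<in>H1 L. \<bar>F u\<bar> \<le> C * H1_norm L u"
    using dual_functional_bound[OF F] ..
  note C = this[rule_format]
  have C': "\<bar>F u\<bar> \<le> \<bar>C\<bar> * N" if "u \<in> H1 L" "H1_norm L u \<le> N" for u N
  proof -
    have "\<bar>F u\<bar> \<le> C * H1_norm L u" by (rule C[OF that(1)])
    also have "\<dots> \<le> \<bar>C\<bar> * H1_norm L u" by (intro mult_right_mono H1_norm_nonneg) simp
    also have "\<dots> \<le> \<bar>C\<bar> * N" by (intro mult_left_mono that) simp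
    finally show ?thesis .
  qed
  have add: "F (\<lambda>x. u x + v x) = F u + F v" if "u \<in> H1 L" "v \<in> H1 L" for u v
    by (rule dual_functional_add[OF F that])
  have sc: "F (\<lambda>x. c *\<^sub>R u x) = c * F u" if "u \<in> H1 L" for u c
    by (rule dual_functional_scaleR[OF F that])
  show "dual_functional (H2 L) (H2_norm L) F"
    unfolding dual_functional_def
    by (intro conjI ballI allI exI[of _ "\<bar>C\<bar>"] add sc C' H2_D(1)[OF L] H2_norm_ge(1)[OF L])
  show "dual_functional (H2 L) (H2_norm L) (\<lambda>u. F (cderiv L u))"
    unfolding dual_functional_def
  proof (intro conjI ballI allI exI[of _ "\<bar>C\<bar>"])
    fix u v assume u: "u \<in> H2 L" and v: "v \<in> H2 L"
    have "F (cderiv L (\<lambda>x. u x + v x)) = F (\<lambda>x. cderiv L u x + cderiv L v x)"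
      by (rule dual_H1_cong[OF F H2_D(2)[OF L H2_add(1)[OF L u v]] H2_add(2)[OF L u v]])
    then show "F (cderiv L (\<lambda>x. u x + v x)) = F (cderiv L u) + F (cderiv L v)"
      using add[OF H2_D(2)[OF L u] H2_D(2)[OF L v]] by simp
  next
    fix c u assume u: "u \<in> H2 L"
    have "F (cderiv L (\<lambda>x. c *\<^sub>R u x)) = F (\<lambda>x. c *\<^sub>R cderiv L u x)"
      by (rule dual_H1_cong[OF F H2_D(2)[OF L H2_scaleR(1)[OF L u]] H2_scaleR(2)[OF L u]])
    then show "F (cderiv L (\<lambda>x. c *\<^sub>R u x)) = c * F (cderiv L u)"
      using sc[OF H2_D(2)[OF L u]] by simp
  next
    fix u assume u: "u \<in> H2 L"
    show "\<bar>F (cderiv L u)\<bar> \<le> \<bar>C\<bar> * H2_norm L u"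
      by (rule C'[OF H2_D(2)[OF L u] H2_norm_ge(2)[OF L u]])
  qed
qed

lemma weakly_H2_imp_weakly_H1:
  assumes L: "0 < L" and uv: "weakly_H2 L u v"
  shows "weakly_H1 L u v" "weakly_H1 L (\<lambda>n. cderiv L (u n)) (cderiv L v)"
proof -
  have H2: "u n \<in> H2 L" "v \<in> H2 L" for n by (rule weakly_converges_mem[OF uv])+
  have "(\<lambda>n. F (u n)) \<longlonglongrightarrow> F v" "(\<lambda>n. F (cderiv L (u n))) \<longlonglongrightarrow> F (cderiv L v)"
    if "dual_functional (H1 L) (H1_norm L) F" for F
    by (rule weakly_convergesD[OF uv dual_H2_of_H1(1)[OF L that]],
        rule weakly_convergesD[OF uv dual_H2_of_H1(2)[OF L that]])
  note lim = this
  show "weakly_H1 L u v" unfolding weakly_converges_def[of "H1 L"]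
  proof (intro conjI allI impI)
    fix F assume "dual_functional (H1 L) (H1_norm L) F"
    then show "(\<lambda>n. F (u n)) \<longlonglongrightarrow> F v" by (rule lim(1))
  qed (rule H2_D(1)[OF L H2(1)] H2_D(1)[OF L H2(2)])+
  show "weakly_H1 L (\<lambda>n. cderiv L (u n)) (cderiv L v)" unfolding weakly_converges_def[of "H1 L"]
  proof (intro conjI allI impI)
    fix F assume "dual_functional (H1 L) (H1_norm L) F"
    then show "(\<lambda>n. F (cderiv L (u n))) \<longlonglongrightarrow> F (cderiv L v)" by (rule lim(2))
  qed (rule H2_D(2)[OF L H2(1)] H2_D(2)[OF L H2(2)])+
qed

lemma weakly_H1_pointwise:
  assumes L: "0 < L" and "weakly_H1 L u v" "x \<in> {0..L}"
  shows "(\<lambda>n. u n x) \<longlonglongrightarrow> v x"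
proof -
  have "(\<lambda>n. u n x \<bullet> i) \<longlonglongrightarrow> v x \<bullet> i" for i :: "real^3"
    using weakly_convergesD[OF assms(2) dual_H1_eval[OF L assms(3), of i]] .
  then show ?thesis
    using tendsto_componentwise_iff[where f="\<lambda>n. u n x" and l="v x"] by blast
qed

lemma weakly_H1_wderiv:
  assumes "weakly_H1 L u v" "sq_integrable (lebesgue_on {0..L}) w"
  shows "(\<lambda>n. LINT x|lebesgue_on {0..L}. wderiv L (u n) x \<bullet> w x) \<longlonglongrightarrow> (LINT x|lebesgue_on {0..L}. wderiv L v x \<bullet> w x)"
  using weakly_convergesD[OF assms(1) dual_H1_wderiv[OF assms(2)]] .

lemma weakly_converges_of_norm:
  assumes "\<And>n. u n \<in> X" "v \<in> X" "\<And>n. (\<lambda>x. u n x - v x) \<in> X" "(\<lambda>n. nrm (\<lambda>x. u n x - v x)) \<longlonglongrightarrow> 0"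
  shows "weakly_converges X nrm u v"
  unfolding weakly_converges_def
proof (intro conjI allI impI assms)
  fix F assume F: "dual_functional X nrm F"
  obtain C where C: "\<forall>u\<in>X. \<bar>F u\<bar> \<le> C * nrm u" using dual_functional_bound[OF F] ..
  have eq: "F (u n) = F (\<lambda>x. u n x - v x) + F v" for n
  proof -
    have "F (\<lambda>x. (u n x - v x) + v x) = F (\<lambda>x. u n x - v x) + F v"
      by (rule dual_functional_add[OF F assms(3,2)])
    then show ?thesis by simp
  qed
  have "(\<lambda>n. F (\<lambda>x. u n x - v x)) \<longlonglongrightarrow> 0"
    by (rule Lim_null_comparison[OF always_eventually[OF allI] tendsto_mult_right_zero[OF assms(4), of C]])
      (use C assms(3) in simp)
  from tendsto_add[OF this tendsto_const[of "F v"]] show "(\<lambda>n. F (u n)) \<longlonglongrightarrow> F v"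
    by (simp add: eq)
qed

lemma wderiv_diff_integral:
  assumes "f \<in> H1 L" "g \<in> H1 L"
  shows "(LINT x|lebesgue_on {0..L}. (norm (wderiv L (\<lambda>x. f x - g x) x))\<^sup>2)
    = (LINT x|lebesgue_on {0..L}. (norm (wderiv L f x - wderiv L g x))\<^sup>2)"
  by (rule integral_norm_sq_cong_AE[OF _ _ H1_diff(2)[OF assms]])
    (intro borel_measurable_diff sq_integrable_measurable wderiv(3) assms H1_diff(1))+

text \<open>Equal values at 0 let the Poincare inequality bound the full norm of the difference by
  that of its derivative; the interpolants below share this value.\<close>

lemma weakly_H1_of_strong:
  assumes L: "0 \<le> L" and u: "\<And>n. u n \<in> H1 L" "v \<in> H1 L" "\<And>n. u n 0 = v 0"
    and D: "(\<lambda>n. LINT x|lebesgue_on {0..L}. (norm (wderiv L (u n) x - wderiv L v x))\<^sup>2) \<longlonglongrightarrow> 0"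
  shows "weakly_H1 L u v"
proof (rule weakly_converges_of_norm)
  show d: "(\<lambda>x. u n x - v x) \<in> H1 L" for n by (rule H1_diff(1)[OF u(1,2)])
  define E where "E n = (LINT x|lebesgue_on {0..L}. (norm (wderiv L (\<lambda>x. u n x - v x) x))\<^sup>2)" for n
  have E: "E \<longlonglongrightarrow> 0" using D unfolding E_def wderiv_diff_integral[OF u(1,2)] .
  have le: "norm (H1_norm L (\<lambda>x. u n x - v x)) \<le> sqrt ((L\<^sup>2 + 1) * E n)" for n
  proof -
    have "(L\<^sup>2 + 1) * E n = L\<^sup>2 * E n + E n" by (simp only: distrib_right mult_1_left)
    moreover have "(LINT x|lebesgue_on {0..L}. (norm (u n x - v x))\<^sup>2) \<le> L\<^sup>2 * E n"
      using H1_Poincare[OF L d[of n]] u(3)[of n] by (simp add: E_def)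
    ultimately have "H1_norm L (\<lambda>x. u n x - v x) \<le> sqrt ((L\<^sup>2 + 1) * E n)"
      unfolding H1_norm_def E_def[symmetric] by (intro real_sqrt_le_mono) linarith
    then show ?thesis by (simp only: real_norm_def abs_of_nonneg[OF H1_norm_nonneg])
  qed
  have "(\<lambda>n. sqrt ((L\<^sup>2 + 1) * E n)) \<longlonglongrightarrow> 0"
    using tendsto_real_sqrt[OF tendsto_mult_right_zero[OF E, of "L\<^sup>2 + 1"]] by simp
  then show "(\<lambda>n. H1_norm L (\<lambda>x. u n x - v x)) \<longlonglongrightarrow> 0"
    by (rule Lim_null_comparison[OF always_eventually[OF allI[OF le]]])
qed (use u in auto)

text \<open>The Poincare inequality is used twice, for the derivative and then for the function,
  which gives the factor \<open>L\<^sup>2 * L\<^sup>2 + L\<^sup>2 + 1\<close>.\<close>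

lemma weakly_H2_of_strong:
  assumes L: "0 < L" and u: "\<And>n. u n \<in> H2 L" "v \<in> H2 L" "\<And>n. u n 0 = v 0" "\<And>n. cderiv L (u n) 0 = cderiv L v 0"
    and D: "(\<lambda>n. LINT x|lebesgue_on {0..L}. (norm (wderiv2 L (u n) x - wderiv2 L v x))\<^sup>2) \<longlonglongrightarrow> 0"
  shows "weakly_H2 L u v"
proof (rule weakly_converges_of_norm)
  define d where "d n x = u n x + (-1) *\<^sub>R v x" for n x
  have d_eq: "(\<lambda>x. u n x - v x) = d n" for n by (auto simp: d_def)
  note v' = H2_scaleR[OF L u(2), where c="-1"]
  note add = H2_add[OF L u(1) v'(1)]
  have dH2: "d n \<in> H2 L" for n using add(1) unfolding d_def .
  show "(\<lambda>x. u n x - v x) \<in> H2 L" for n unfolding d_eq by (rule dH2)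
  note dH1 = H2_D[OF L dH2]
  define E where "E n = (LINT x|lebesgue_on {0..L}. (norm (wderiv2 L (d n) x))\<^sup>2)" for n
  have "AE x in lebesgue_on {0..L}. wderiv2 L (d n) x = wderiv2 L (u n) x - wderiv2 L v x" for n
    using add(3)[of n] v'(3) unfolding d_def[abs_def] by eventually_elim simp
  then have En: "E n = (LINT x|lebesgue_on {0..L}. (norm (wderiv2 L (u n) x - wderiv2 L v x))\<^sup>2)" for n
    unfolding E_def
    by (intro integral_norm_sq_cong_AE borel_measurable_diff sq_integrable_measurable wderiv(3) H2_D(2)[OF L] u dH2)
  have E: "E \<longlonglongrightarrow> 0" using D unfolding En[symmetric] .
  have c0: "cderiv L (d n) 0 = 0" for n
  proof -
    have "cderiv L (d n) 0 = cderiv L (u n) 0 + cderiv L (\<lambda>x. (-1) *\<^sub>R v x) 0"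
      unfolding d_def[abs_def] by (rule add(2)) (use L in simp)
    also have "cderiv L (\<lambda>x. (-1) *\<^sub>R v x) 0 = (-1) *\<^sub>R cderiv L v 0"
      by (rule H2_scaleR(2)[OF L u(2)]) (use L in simp)
    finally show ?thesis using u(4)[of n] by simp
  qed
  have 1: "(LINT x|lebesgue_on {0..L}. (norm (cderiv L (d n) x))\<^sup>2) \<le> L\<^sup>2 * E n" for n
    unfolding E_def by (rule H1_Poincare[OF _ dH1(2) c0]) (use L in simp)
  have "(LINT x|lebesgue_on {0..L}. (norm (wderiv L (d n) x))\<^sup>2) = (LINT x|lebesgue_on {0..L}. (norm (cderiv L (d n) x))\<^sup>2)" for n
    by (intro integral_norm_sq_cong_AE H2_wderiv_AE[OF L dH2] sq_integrable_measurable wderiv(3) dH1(1) H1_sq_integrable[OF dH1(2)])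
  note w = this
  have 2: "(LINT x|lebesgue_on {0..L}. (norm (d n x))\<^sup>2) \<le> L\<^sup>2 * (L\<^sup>2 * E n)" for n
  proof -
    have "(LINT x|lebesgue_on {0..L}. (norm (d n x))\<^sup>2) \<le> L\<^sup>2 * (LINT x|lebesgue_on {0..L}. (norm (wderiv L (d n) x))\<^sup>2)"
      by (rule H1_Poincare[OF _ dH1(1)]) (use L u(3)[of n] in \<open>auto simp: d_def\<close>)
    also have "\<dots> \<le> L\<^sup>2 * (L\<^sup>2 * E n)" unfolding w by (intro mult_left_mono 1) simp
    finally show ?thesis .
  qed
  have le: "norm (H2_norm L (d n)) \<le> sqrt ((L\<^sup>2 * L\<^sup>2 + L\<^sup>2 + 1) * E n)" for n
  proof -
    have "(L\<^sup>2 * L\<^sup>2 + L\<^sup>2 + 1) * E n = L\<^sup>2 * (L\<^sup>2 * E n) + L\<^sup>2 * E n + E n"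
      by (simp only: distrib_right mult.assoc mult_1_left)
    then have "H2_norm L (d n) \<le> sqrt ((L\<^sup>2 * L\<^sup>2 + L\<^sup>2 + 1) * E n)"
      using 1[of n] 2[of n] unfolding H2_norm_def E_def[symmetric] by (intro real_sqrt_le_mono) linarith
    moreover have "H2_norm L (d n) \<ge> 0" by (simp add: H2_norm_def)
    ultimately show ?thesis by (simp only: real_norm_def abs_of_nonneg)
  qed
  have "(\<lambda>n. sqrt ((L\<^sup>2 * L\<^sup>2 + L\<^sup>2 + 1) * E n)) \<longlonglongrightarrow> 0"
    using tendsto_real_sqrt[OF tendsto_mult_right_zero[OF E, of "L\<^sup>2 * L\<^sup>2 + L\<^sup>2 + 1"]] by simp
  then show "(\<lambda>n. H2_norm L (\<lambda>x. u n x - v x)) \<longlonglongrightarrow> 0"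
    unfolding d_eq by (rule Lim_null_comparison[OF always_eventually[OF allI[OF le]]])
qed (use u in auto)

section \<open>Partitions of the interval\<close>

lemma neighboursD:
  assumes "neighbours N z z'"
  shows "z \<in> N" "z' \<in> N" "z < z'" "\<And>x. z < x \<Longrightarrow> x < z' \<Longrightarrow> x \<notin> N"
  using assms by (auto simp: neighbours_def)

lemma mesh_size_ge:
  assumes "node_set L N" "neighbours N z z'"
  shows "z' - z \<le> mesh_size N"
proof -
  have "{z' - z | z z'. neighbours N z z'} \<subseteq> (\<lambda>(z, z'). z' - z) ` (N \<times> N)"
    unfolding neighbours_def by auto
  moreover have "finite ((\<lambda>(z, z'). z' - z) ` (N \<times> N))"
    using assms(1) by (auto simp: node_set_def)
  ultimately have "finite {z' - z | z z'. neighbours N z z'}" by (rule finite_subset)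
  then show ?thesis unfolding mesh_size_def using assms(2) by (intro Max_ge) auto
qed

lemma node_pred:
  assumes N: "finite N" "a \<in> N" "x \<in> N" "a < x"
  obtains z where "neighbours N z x"
proof -
  let ?S = "{z \<in> N. z < x}"
  have fin: "finite ?S" and ne: "?S \<noteq> {}" using N by auto
  have "neighbours N (Max ?S) x"
  proof -
    define m where "m = Max ?S"
    have m: "m \<in> N \<and> m < x" using CollectD[OF Max_in[OF fin ne]] by (simp only: m_def)
    have "t \<le> m" if "t \<in> N" "t < x" for t
      unfolding m_def by (rule Max_ge[OF fin]) (use that in simp)
    then have "N \<inter> {m<..<x} = {}" by force
    with m N show ?thesis unfolding neighbours_def m_def[symmetric] by blast
  qed
  then show thesis by (rule that)
qed

lemma left_right_node:
  assumes N: "node_set L N" and x: "x \<in> {0..L}"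
  shows "left_node N x \<in> N" "left_node N x \<le> x" "right_node N x \<in> N" "x \<le> right_node N x"
    "x \<in> N \<Longrightarrow> left_node N x = x" "x \<in> N \<Longrightarrow> right_node N x = x"
    "x \<notin> N \<Longrightarrow> neighbours N (left_node N x) (right_node N x)"
    "x \<notin> N \<Longrightarrow> left_node N x < x \<and> x < right_node N x"
proof -
  let ?S = "{z \<in> N. z \<le> x}" and ?T = "{z \<in> N. x \<le> z}"
  have fin: "finite ?S" "finite ?T" using N by (auto simp: node_set_def)
  have ne: "?S \<noteq> {}" "?T \<noteq> {}" using N x by (auto simp: node_set_def)
  note S = Max_in[OF fin(1) ne(1)] and T = Min_in[OF fin(2) ne(2)]
  show l: "left_node N x \<in> N" "left_node N x \<le> x" and r: "right_node N x \<in> N" "x \<le> right_node N x"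
    using S T unfolding left_node_def right_node_def by simp_all
  have le: "t \<le> left_node N x" if "t \<in> N" "t \<le> x" for t
    unfolding left_node_def by (rule Max_ge[OF fin(1)]) (use that in simp)
  have ge: "right_node N x \<le> t" if "t \<in> N" "x \<le> t" for t
    unfolding right_node_def by (rule Min_le[OF fin(2)]) (use that in simp)
  show "left_node N x = x" if "x \<in> N"
    by (rule antisym[OF l(2) le[OF that order_refl]])
  show "right_node N x = x" if "x \<in> N"
    by (rule antisym[OF ge[OF that order_refl] r(2)])
  assume xN: "x \<notin> N"
  show lt: "left_node N x < x \<and> x < right_node N x"
    using l r xN by (auto simp: less_le)
  have "t \<notin> N" if "left_node N x < t" "t < right_node N x" for t
  proof
    assume "t \<in> N"
    then show False
      using le[of t] ge[of t] that by linarith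
  qed
  then show "neighbours N (left_node N x) (right_node N x)"
    using l r lt unfolding neighbours_def by auto
qed

lemma node_eqI:
  assumes N: "node_set L N" and nb: "neighbours N z z'" and x: "z < x" "x < z'"
  shows "left_node N x = z" "right_node N x = z'"
proof -
  have fin: "finite {t \<in> N. t \<le> x}" "finite {t \<in> N. x \<le> t}" using N by (auto simp: node_set_def)
  note n = neighboursD[OF nb]
  show "left_node N x = z" unfolding left_node_def
  proof (rule Max_eqI[OF fin(1)])
    fix t assume "t \<in> {t \<in> N. t \<le> x}"
    then show "t \<le> z" using n(4)[of t] x by force
  qed (use n x in auto)
  show "right_node N x = z'" unfolding right_node_def
  proof (rule Min_eqI[OF fin(2)])
    fix t assume "t \<in> {t \<in> N. x \<le> t}"
    then show "z' \<le> t" using n(4)[of t] x by force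
  qed (use n x in auto)
qed

lemma neighbours_Icc:
  assumes "node_set L N" "neighbours N z z'"
  shows "0 \<le> z" "z' \<le> L" "z < z'" "{z..z'} \<subseteq> {0..L}"
  using assms by (auto simp: node_set_def neighbours_def)

text \<open>Induction along the nodes in the form of a least counterexample: its left neighbour
  already has integral zero, and the element between them adds nothing.\<close>

lemma elementwise_integral_zero:
  fixes f :: "real \<Rightarrow> 'b::euclidean_space"
  assumes N: "node_set L N" and f: "integrable (lebesgue_on {0..L}) f"
    and zero: "\<And>z z'. neighbours N z z' \<Longrightarrow> integral {z..z'} f = 0"
    and x: "x \<in> N"
  shows "integral {0..x} f = 0"
proof (rule ccontr)
  let ?S = "{x \<in> N. integral {0..x} f \<noteq> 0}"
  assume "integral {0..x} f \<noteq> 0"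
  then have ne: "?S \<noteq> {}" using x by auto
  have fin: "finite ?S" using N by (auto simp: node_set_def)
  define m where "m = Min ?S"
  have m: "m \<in> N" "integral {0..m} f \<noteq> 0" using Min_in[OF fin ne] by (auto simp: m_def)
  have "m \<noteq> 0" using m by auto
  then have "0 < m" using m N by (auto simp: node_set_def less_le)
  then obtain z where z: "neighbours N z m"
    using node_pred[of N 0 m] N m by (auto simp: node_set_def)
  note n = neighboursD[OF z]
  have "z \<notin> ?S"
  proof
    assume "z \<in> ?S"
    from Min_le[OF fin this] n(3) show False by (simp add: m_def)
  qed
  then have "integral {0..z} f = 0" using n by simp
  moreover have "integral {0..m} f = integral {0..z} f + integral {z..m} f"
    using N n m by (intro integral_Icc_combine[OF f]) (auto simp: node_set_def)
  ultimately show False using m zero[OF z] by simp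
qed

lemma elementwise_lebesgue_integral_zero:
  fixes f :: "real \<Rightarrow> 'b::euclidean_space"
  assumes N: "node_set L N" and f: "integrable (lebesgue_on {0..L}) f"
    and zero: "\<And>z z'. neighbours N z z' \<Longrightarrow> integral {z..z'} f = 0"
  shows "(LINT x|lebesgue_on {0..L}. f x) = 0"
proof -
  have "L \<in> N" "0 \<le> L" using N by (auto simp: node_set_def)
  then show ?thesis
    using elementwise_integral_zero[OF assms] integrable_imp_integrable_on_Icc(2)[OF f, of 0 L] by simp
qed

lemma null_sets_node_set: "node_set L N \<Longrightarrow> N \<in> null_sets lebesgue"
  by (simp add: node_set_def finite_imp_null_set_lborel null_sets_completionI)

text \<open>Meant for averages, interpolants and projections, which may jump at nodes: the open
  elements form an open set that differs from [0, L] by a finite set.\<close>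

lemma elementwise_continuous_measurable:
  fixes f :: "real \<Rightarrow> 'b::euclidean_space"
  assumes N: "node_set L N" and f: "\<And>z z'. neighbours N z z' \<Longrightarrow> continuous_on {z<..<z'} f"
  shows "f \<in> borel_measurable (lebesgue_on {0..L})"
proof -
  define \<U> where "\<U> = {{z<..<z'} | z z'. neighbours N z z'}"
  have cover: "{0..L} - N \<subseteq> \<Union>\<U>"
  proof
    fix x assume "x \<in> {0..L} - N"
    then show "x \<in> \<Union>\<U>"
      using left_right_node(7,8)[OF N, of x] unfolding \<U>_def
      by (intro UnionI[of "{left_node N x<..<right_node N x}"]) auto
  qed
  have "continuous_on (\<Union>\<U>) f"
    by (rule continuous_on_open_Union) (auto simp: \<U>_def f)
  moreover have U: "\<Union>\<U> \<in> sets lebesgue"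
  proof -
    have "open (\<Union>\<U>)" by (rule open_Union) (auto simp: \<U>_def)
    then show ?thesis by (simp add: borel_open sets_completionI_sets)
  qed
  ultimately have "f \<in> borel_measurable (lebesgue_on (\<Union>\<U>))"
    by (rule continuous_imp_measurable_on_sets_lebesgue)
  then have "f measurable_on (\<Union>\<U>)" using U by (simp add: measurable_on_iff_borel_measurable)
  moreover have "negligible ((\<Union>\<U> - {0..L}) \<union> ({0..L} - \<Union>\<U>))"
  proof (rule negligible_subset)
    show "negligible N" using null_sets_node_set[OF N] by (simp add: negligible_iff_null_sets)
    have "\<Union>\<U> \<subseteq> {0..L}"
    proof
      fix x assume "x \<in> \<Union>\<U>"
      then obtain z z' where "neighbours N z z'" "z < x" "x < z'" unfolding \<U>_def by auto
      then show "x \<in> {0..L}" using neighbours_Icc(1,2)[OF N, of z z'] by simp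
    qed
    then show "(\<Union>\<U> - {0..L}) \<union> ({0..L} - \<Union>\<U>) \<subseteq> N" using cover by auto
  qed
  ultimately have "f measurable_on {0..L}" by (rule measurable_on_spike_set)
  then show ?thesis by (simp add: measurable_on_iff_borel_measurable)
qed

text \<open>The free centre c covers two uses: c = 0 bounds an average, and c = \<open>v x\<close>
  compares it with the function.\<close>

lemma norm_average_diff_le:
  fixes v :: "real \<Rightarrow> 'b::euclidean_space"
  assumes "z < z'" "continuous_on {z..z'} v" "\<And>\<xi>. \<xi> \<in> {z..z'} \<Longrightarrow> norm (v \<xi> - c) \<le> r"
  shows "norm ((1 / (z' - z)) *\<^sub>R (LINT \<xi>|lebesgue_on {z..z'}. v \<xi>) - c) \<le> r"
proof -
  have i: "v integrable_on {z..z'}" by (rule integrable_continuous_interval[OF assms(2)])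
  have "(LINT \<xi>|lebesgue_on {z..z'}. v \<xi>) = integral {z..z'} v"
    by (rule lebesgue_integral_eq_integral[OF continuous_imp_integrable_real[OF assms(2)]]) simp
  moreover have "integral {z..z'} (\<lambda>\<xi>. v \<xi> - c) = integral {z..z'} v - (z' - z) *\<^sub>R c"
    using assms(1) by (subst Henstock_Kurzweil_Integration.integral_diff[OF i]) auto
  ultimately have eq: "(1 / (z' - z)) *\<^sub>R (LINT \<xi>|lebesgue_on {z..z'}. v \<xi>) - c
      = (1 / (z' - z)) *\<^sub>R integral {z..z'} (\<lambda>\<xi>. v \<xi> - c)"
    using assms(1) by (simp add: scaleR_diff_right)
  have "norm (integral {z..z'} (\<lambda>\<xi>. v \<xi> - c)) \<le> r * (z' - z)"
    by (rule integral_bound) (use assms in \<open>auto intro!: continuous_intros\<close>)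
  then show ?thesis unfolding eq norm_scaleR using assms(1) by (simp add: divide_le_eq)
qed

lemma Q_avg_element:
  assumes "node_set L N" "neighbours N z z'" "z < x" "x < z'"
  shows "Q_avg N v x = (1 / (z' - z)) *\<^sub>R (LINT \<xi>|lebesgue_on {z..z'}. v \<xi>)"
  using node_eqI[OF assms] by (simp add: Q_avg_def)

lemma Q_avg_measurable:
  assumes N: "node_set L N"
  shows "Q_avg N v \<in> borel_measurable (lebesgue_on {0..L})"
proof (rule elementwise_continuous_measurable[OF N])
  fix z z' assume nb: "neighbours N z z'"
  have "continuous_on {z<..<z'} (Q_avg N v) \<longleftrightarrow>
    continuous_on {z<..<z'} (\<lambda>x. (1 / (z' - z)) *\<^sub>R (LINT \<xi>|lebesgue_on {z..z'}. v \<xi>))"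
    by (rule continuous_on_cong) (use Q_avg_element[OF N nb] in auto)
  then show "continuous_on {z<..<z'} (Q_avg N v)" by simp
qed

lemma Q_avg_norm_le:
  assumes N: "node_set L N" and v: "continuous_on {0..L} v" "\<And>x. x \<in> {0..L} \<Longrightarrow> norm (v x) \<le> r"
    and x: "x \<in> {0..L}" "x \<notin> N"
  shows "norm (Q_avg N v x) \<le> r"
proof -
  note n = left_right_node(7,8)[OF N x]
  let ?z = "left_node N x" and ?z' = "right_node N x"
  note I = neighbours_Icc[OF N n(1)]
  have "norm ((1 / (?z' - ?z)) *\<^sub>R (LINT \<xi>|lebesgue_on {?z..?z'}. v \<xi>) - 0) \<le> r"
    by (rule norm_average_diff_le[OF _ continuous_on_subset[OF v(1)]]) (use I v(2) in auto)
  then show ?thesis using Q_avg_element[OF N n(1)] n(2) by simp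
qed

lemma Q_avg_diff_le:
  assumes N: "node_set L N" and v: "continuous_on {0..L} v"
    and r: "\<And>y. y \<in> {0..L} \<Longrightarrow> \<bar>y - x\<bar> \<le> mesh_size N \<Longrightarrow> norm (v y - v x) \<le> r"
    and x: "x \<in> {0..L}" "x \<notin> N"
  shows "norm (Q_avg N v x - v x) \<le> r"
proof -
  note n = left_right_node(7,8)[OF N x]
  let ?z = "left_node N x" and ?z' = "right_node N x"
  note I = neighbours_Icc[OF N n(1)]
  have "norm ((1 / (?z' - ?z)) *\<^sub>R (LINT \<xi>|lebesgue_on {?z..?z'}. v \<xi>) - v x) \<le> r"
  proof (rule norm_average_diff_le[OF _ continuous_on_subset[OF v]])
    fix \<xi> assume \<xi>: "\<xi> \<in> {?z..?z'}"
    then have "\<bar>\<xi> - x\<bar> \<le> ?z' - ?z" using n(2) by auto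
    then show "norm (v \<xi> - v x) \<le> r"
      using mesh_size_ge[OF N n(1)] \<xi> I by (intro r) auto
  qed (use I in auto)
  then show ?thesis using Q_avg_element[OF N n(1)] n(2) by simp
qed

lemma mesh_size_pos:
  assumes N: "node_set L N" and L: "0 < L"
  shows "0 < mesh_size N"
proof -
  obtain z where "neighbours N z L" using node_pred[of N 0 L] N L by (auto simp: node_set_def)
  from mesh_size_ge[OF N this] neighboursD(3)[OF this] show ?thesis by linarith
qed

lemma left_right_node_dist:
  assumes N: "node_set L N" and L: "0 < L" and x: "x \<in> {0..L}"
  shows "\<bar>left_node N x - x\<bar> \<le> mesh_size N" "\<bar>right_node N x - x\<bar> \<le> mesh_size N"
proof -
  have "\<bar>left_node N x - x\<bar> \<le> mesh_size N \<and> \<bar>right_node N x - x\<bar> \<le> mesh_size N"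
  proof (cases "x \<in> N")
    case True
    then show ?thesis using left_right_node(5,6)[OF N x] mesh_size_pos[OF N L] by simp
  next
    case False
    then show ?thesis
      using left_right_node(7,8)[OF N x False] mesh_size_ge[OF N, of "left_node N x" "right_node N x"] by auto
  qed
  then show "\<bar>left_node N x - x\<bar> \<le> mesh_size N" "\<bar>right_node N x - x\<bar> \<le> mesh_size N" by auto
qed

text \<open>At a node both enclosing nodes coincide, so the convex form also covers that branch;
  bounds and limits then need no further case distinction.\<close>

lemma nodal_interp_convex:
  assumes N: "node_set L N" and x: "x \<in> {0..L}"
  shows "\<exists>s. 0 \<le> s \<and> s \<le> 1 \<and>
    nodal_interp N v x = (1 - s) * v (left_node N x) + s * v (right_node N x)"
proof (cases "x \<in> N")
  case True
  then show ?thesis using left_right_node(5,6)[OF N x] by (intro exI[of _ 0]) (simp add: nodal_interp_def)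
next
  case False
  let ?z = "left_node N x" and ?z' = "right_node N x"
  have n: "?z < x" "x < ?z'" using left_right_node(8)[OF N x False] by auto
  show ?thesis
  proof (intro exI[of _ "(x - ?z) / (?z' - ?z)"] conjI)
    have ne: "?z' - ?z \<noteq> 0" "?z \<noteq> ?z'" using n by auto
    have 1: "1 - (x - ?z) / (?z' - ?z) = (?z' - x) / (?z' - ?z)"
      using ne(1) by (simp add: field_simps)
    show "nodal_interp N v x = (1 - (x - ?z) / (?z' - ?z)) * v ?z + (x - ?z) / (?z' - ?z) * v ?z'"
      unfolding 1 using ne(2)
      by (simp only: nodal_interp_def Let_def if_False add_divide_distrib times_divide_eq_left)
  qed (use n in auto)
qed

lemma nodal_interp_bounds:
  assumes N: "node_set L N" and x: "x \<in> {0..L}"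
    and v: "\<And>z. z \<in> N \<Longrightarrow> a \<le> v z" "\<And>z. z \<in> N \<Longrightarrow> v z \<le> b"
  shows "a \<le> nodal_interp N v x" "nodal_interp N v x \<le> b"
proof -
  obtain s where s: "0 \<le> s" "s \<le> 1"
    "nodal_interp N v x = (1 - s) * v (left_node N x) + s * v (right_node N x)"
    using nodal_interp_convex[OF N x, of v] by blast
  note l = left_right_node(1,3)[OF N x]
  have s': "0 \<le> 1 - s" using s(2) by simp
  have d: "(1 - s) * t = t - s * t" for t by (simp only: left_diff_distrib mult_1_left)
  show "a \<le> nodal_interp N v x"
    using mult_left_mono[OF v(1)[OF l(1)] s'] mult_left_mono[OF v(1)[OF l(2)] s(1)] d[of a] s(3) by linarith
  show "nodal_interp N v x \<le> b"
    using mult_left_mono[OF v(2)[OF l(1)] s'] mult_left_mono[OF v(2)[OF l(2)] s(1)] d[of b] s(3) by linarith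
qed

lemma nodal_interp_measurable:
  assumes N: "node_set L N"
  shows "nodal_interp N v \<in> borel_measurable (lebesgue_on {0..L})"
proof (rule elementwise_continuous_measurable[OF N])
  fix z z' assume nb: "neighbours N z z'"
  have "nodal_interp N v x = ((z' - x) * v z + (x - z) * v z') / (z' - z)" if "x \<in> {z<..<z'}" for x
    using node_eqI[OF N nb, of x] that by (simp add: nodal_interp_def)
  then have "continuous_on {z<..<z'} (nodal_interp N v) \<longleftrightarrow>
    continuous_on {z<..<z'} (\<lambda>x. ((z' - x) * v z + (x - z) * v z') / (z' - z))"
    by (intro continuous_on_cong) auto
  moreover have "continuous_on {z<..<z'} (\<lambda>x. ((z' - x) * v z + (x - z) * v z') / (z' - z))"
    using neighboursD(3)[OF nb] by (intro continuous_intros) auto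
  ultimately show "continuous_on {z<..<z'} (nodal_interp N v)" by simp
qed

section \<open>Sequences of discrete rods\<close>

lemma cross3_bounded_bilinear: "bounded_bilinear cross3"
  using bilinear_cross bilinear_conv_bounded_bilinear by blast

lemma norm_cross3_le: "norm (cross3 x y) \<le> norm x * norm y"
proof (rule power2_le_imp_le)
  have "0 \<le> (x \<bullet> y)\<^sup>2" by simp
  then show "(norm (cross3 x y))\<^sup>2 \<le> (norm x * norm y)\<^sup>2" using norm_cross_dot[of x y] by linarith
qed simp

text \<open>For the unit vector d = t x b, the square of q splits into that of q . d and that of |q
  x d|. By the Lagrange formula q x d = (q . b) t - (q . t) b, which accounts for the other two
  components.\<close>

lemma orthonormal_frame_norm_sq:
  fixes q t b :: "real^3"
  assumes "norm t = 1" "norm b = 1" "t \<bullet> b = 0"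
  shows "(norm q)\<^sup>2 = (q \<bullet> t)\<^sup>2 + (q \<bullet> b)\<^sup>2 + (q \<bullet> cross3 t b)\<^sup>2"
proof -
  have tt: "t \<bullet> t = 1" "b \<bullet> b = 1" using assms(1,2) by (simp_all add: norm_eq_1)
  have d: "norm (cross3 t b) = 1"
    using norm_cross_dot[of t b] assms by (intro power2_eq_imp_eq[OF _ norm_ge_zero zero_le_one]) simp
  have "(\<alpha> *\<^sub>R t - \<beta> *\<^sub>R b) \<bullet> (\<alpha> *\<^sub>R t - \<beta> *\<^sub>R b) = \<alpha>\<^sup>2 + \<beta>\<^sup>2" for \<alpha> \<beta>
    using assms(3) tt by (simp add: inner_diff_left inner_diff_right inner_commute[of b t] power2_eq_square)
  then have "(norm (cross3 q (cross3 t b)))\<^sup>2 = (q \<bullet> b)\<^sup>2 + (q \<bullet> t)\<^sup>2"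
    unfolding power2_norm_eq_inner Lagrange by (simp only:)
  then show ?thesis using norm_cross_dot[of q "cross3 t b"] d by simp
qed

lemma admissible_hD:
  assumes "(y, b) \<in> admissible_h L N Lbc lbc"
  shows "(y, b) \<in> V_rod L N" "Lbc y b = lbc"
    "\<And>z. z \<in> N \<Longrightarrow> norm (cderiv L y z) = 1" "\<And>z. z \<in> N \<Longrightarrow> norm (b z) = 1"
  using assms by (auto simp: admissible_h_def)

text \<open>On an element the director is a convex combination of two unit vectors. This is what
  keeps its averages in the unit ball, as the comparison of the subtracted term with the bending
  term demands.\<close>

lemma admissible_h_norm_le:
  assumes N: "node_set L N" and adm: "(y, b) \<in> admissible_h L N Lbc lbc" and x: "x \<in> {0..L}"
  shows "norm (b x) \<le> 1"
proof (cases "x \<in> N")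
  case True
  then show ?thesis using admissible_hD(4)[OF adm] by simp
next
  case False
  define z z' where "z = left_node N x" and "z' = right_node N x"
  have nb: "neighbours N z z'" and lt: "z < x" "x < z'"
    using left_right_node(7,8)[OF N x False] by (auto simp: z_def z'_def)
  have "polynomial_on 1 {z..z'} b"
    using admissible_hD(1)[OF adm] nb by (simp add: V_rod_def)
  then obtain c where c: "\<And>x. x \<in> {z..z'} \<Longrightarrow> b x = (\<Sum>i\<le>1. x ^ i *\<^sub>R c i)"
    unfolding polynomial_on_def by blast
  have b: "b t = c 0 + t *\<^sub>R c 1" if "t \<in> {z..z'}" for t
    using c[OF that] by simp
  define s where "s = (x - z) / (z' - z)"
  have s: "0 \<le> s" "s \<le> 1" and xs: "x = (1 - s) * z + s * z'"
  proof -
    show "0 \<le> s" "s \<le> 1" using lt by (simp_all add: s_def)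
    have "s * (z' - z) = x - z" using lt by (simp add: s_def)
    then show "x = (1 - s) * z + s * z'" by (simp add: algebra_simps)
  qed
  have "b x = c 0 + ((1 - s) * z + s * z') *\<^sub>R c 1" using b[of x] lt xs by simp
  also have "\<dots> = (1 - s) *\<^sub>R (c 0 + z *\<^sub>R c 1) + s *\<^sub>R (c 0 + z' *\<^sub>R c 1)"
    by (simp add: algebra_simps)
  also have "\<dots> = (1 - s) *\<^sub>R b z + s *\<^sub>R b z'" using b[of z] b[of z'] lt by simp
  finally have "norm (b x) \<le> (1 - s) * norm (b z) + s * norm (b z')"
    using norm_triangle_ineq[of "(1 - s) *\<^sub>R b z" "s *\<^sub>R b z'"] s by simp
  then show ?thesis using admissible_hD(4)[OF adm] neighboursD(1,2)[OF nb] by simp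
qed

text \<open>The target is a bare vector space without topology, so the condition is not passed to
  the limit by continuity of \<open>\<Lambda>\<close>. Its kernel, however, is a subspace of a
  finite-dimensional space and therefore closed; it contains all differences of boundary data and
  hence the limiting difference.\<close>

lemma boundary_values_limit:
  fixes Lbc :: "curve \<Rightarrow> curve \<Rightarrow> 'y::real_vector"
  assumes L: "0 < L" and bo: "boundary_operator L Lbc"
    and y: "weakly_H2 L yh y" and b: "weakly_H1 L bh b" and eq: "\<And>n. Lbc (yh n) (bh n) = lbc"
  shows "Lbc y b = lbc"
proof -
  obtain \<Lambda> :: "(real^3) \<times> (real^3) \<times> (real^3) \<times> (real^3) \<times> (real^3) \<times> (real^3) \<Rightarrow> 'y"
    where *: "linear \<Lambda> \<and> (\<forall>y\<in>H2 L. \<forall>b\<in>H1 L.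
      Lbc y b = \<Lambda> (y 0, y L, cderiv L y 0, cderiv L y L, b 0, b L))"
    using bo unfolding boundary_operator_def ..
  note lin = conjunct1[OF *]
  have \<Lambda>: "Lbc y b = \<Lambda> (y 0, y L, cderiv L y 0, cderiv L y L, b 0, b L)" if "y \<in> H2 L" "b \<in> H1 L" for y b
    using bspec[OF bspec[OF conjunct2[OF *] that(1)] that(2)] .
  define v where "v n = (yh n 0, yh n L, cderiv L (yh n) 0, cderiv L (yh n) L, bh n 0, bh n L)" for n
  define v0 where "v0 = (y 0, y L, cderiv L y 0, cderiv L y L, b 0, b L)"
  have 0: "0 \<in> {0..L}" "L \<in> {0..L}" using L by auto
  note p = weakly_H1_pointwise[OF L weakly_H2_imp_weakly_H1(1)[OF L y]]
    weakly_H1_pointwise[OF L weakly_H2_imp_weakly_H1(2)[OF L y]] weakly_H1_pointwise[OF L b]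
  have lim: "v \<longlonglongrightarrow> v0"
    unfolding v_def[abs_def] v0_def by (intro tendsto_Pair p 0)
  define K where "K = {w. \<Lambda> w = 0}"
  have "subspace K"
    unfolding K_def subspace_def using linear_0[OF lin] linear_add[OF lin] linear_scale[OF lin] by simp
  then have "closed K" by (rule closed_subspace)
  moreover have inK: "v n - v 0 \<in> K" for n
  proof -
    have "\<Lambda> (v n) = lbc" for n
      unfolding v_def \<Lambda>[OF weakly_converges_mem(1)[OF y] weakly_converges_mem(1)[OF b], symmetric] by (rule eq)
    then show ?thesis by (simp add: K_def linear_diff[OF lin])
  qed
  moreover have "(\<lambda>n. v n - v 0) \<longlonglongrightarrow> v0 - v 0" by (intro tendsto_diff lim tendsto_const)
  ultimately have "v0 - v 0 \<in> K" by (rule closed_sequentially)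
  then have "\<Lambda> v0 = \<Lambda> (v 0)" by (simp add: K_def linear_diff[OF lin])
  then show ?thesis
    unfolding v_def v0_def \<Lambda>[OF weakly_converges_mem(1)[OF y] weakly_converges_mem(1)[OF b], symmetric]
      \<Lambda>[OF weakly_converges_mem(2)[OF y] weakly_converges_mem(2)[OF b], symmetric] eq .
qed

text \<open>A uniform derivative bound gives a common Hoelder modulus, so evaluation points may move
  with n; they will be the nodes next to x.\<close>

lemma H1_limit_at_nearby_points:
  assumes f: "\<And>n. f n \<in> H1 L" "\<And>n. (LINT x|lebesgue_on {0..L}. (norm (wderiv L (f n) x))\<^sup>2) \<le> K"
    and lim: "(\<lambda>n. f n x) \<longlonglongrightarrow> l" and x: "x \<in> {0..L}"
    and \<xi>: "\<And>n. \<xi> n \<in> {0..L}" "\<And>n. \<bar>\<xi> n - x\<bar> \<le> \<delta> n" and \<delta>: "\<delta> \<longlonglongrightarrow> 0"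
  shows "(\<lambda>n. f n (\<xi> n)) \<longlonglongrightarrow> l"
proof -
  have le: "norm (f n (\<xi> n) - f n x) \<le> sqrt (\<delta> n * K)" for n
  proof (rule real_le_rsqrt)
    have "(norm (f n (\<xi> n) - f n x))\<^sup>2 \<le> \<bar>\<xi> n - x\<bar> * (LINT x|lebesgue_on {0..L}. (norm (wderiv L (f n) x))\<^sup>2)"
      by (rule H1_Hoelder[OF f(1) \<xi>(1) x])
    also have "\<dots> \<le> \<delta> n * K"
      using \<xi>(2)[of n] by (intro mult_mono f(2)) auto
    finally show "(norm (f n (\<xi> n) - f n x))\<^sup>2 \<le> \<delta> n * K" .
  qed
  have "(\<lambda>n. sqrt (\<delta> n * K)) \<longlonglongrightarrow> 0"
    using tendsto_real_sqrt[OF tendsto_mult_left_zero[OF \<delta>, of K]] by simp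
  then have "(\<lambda>n. f n (\<xi> n) - f n x) \<longlonglongrightarrow> 0"
    by (rule Lim_null_comparison[OF always_eventually[OF allI[OF le]]])
  from tendsto_add[OF this lim] show ?thesis by simp
qed

text \<open>Common setting of both bounds. The constant K comes from the energy in the lower bound
  and from stability of the projections for recovery sequences.\<close>

locale discrete_sequence =
  fixes L :: real and N :: "nat \<Rightarrow> real set" and Lbc :: "curve \<Rightarrow> curve \<Rightarrow> 'y::real_vector" and lbc :: 'y
    and yh bh :: "nat \<Rightarrow> curve" and y b :: curve and K :: real
  assumes L: "0 < L" and bo: "boundary_operator L Lbc"
    and N: "\<And>n. node_set L (N n)" and mesh: "(\<lambda>n. mesh_size (N n)) \<longlonglongrightarrow> 0"
    and y: "weakly_H2 L yh y" and b: "weakly_H1 L bh b"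
    and adm: "\<And>n. (yh n, bh n) \<in> admissible_h L (N n) Lbc lbc"
    and y_bound: "\<And>n. (LINT x|lebesgue_on {0..L}. (norm (wderiv2 L (yh n) x))\<^sup>2) \<le> K"
    and b_bound: "\<And>n. (LINT x|lebesgue_on {0..L}. (norm (wderiv L (bh n) x))\<^sup>2) \<le> K"
begin

abbreviation "M \<equiv> lebesgue_on {0..L}"

lemma yh_H2: "yh n \<in> H2 L" and y_H2: "y \<in> H2 L" and bh_H1: "bh n \<in> H1 L" and b_H1: "b \<in> H1 L"
  by (rule weakly_converges_mem[OF y] weakly_converges_mem[OF b])+

lemma th_H1: "cderiv L (yh n) \<in> H1 L" and t_H1: "cderiv L y \<in> H1 L"
  by (rule H2_D(2)[OF L yh_H2] H2_D(2)[OF L y_H2])+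

lemma t_weak: "weakly_H1 L (\<lambda>n. cderiv L (yh n)) (cderiv L y)"
  by (rule weakly_H2_imp_weakly_H1(2)[OF L y])

lemmas t_lim = weakly_H1_pointwise[OF L t_weak]
lemmas b_lim = weakly_H1_pointwise[OF L b]

lemma K_nonneg: "0 \<le> K"
  by (rule order_trans[OF _ y_bound[of 0]]) simp

lemma t_near: "x \<in> {0..L} \<Longrightarrow> (\<And>n. \<xi> n \<in> {0..L}) \<Longrightarrow> (\<And>n. \<bar>\<xi> n - x\<bar> \<le> mesh_size (N n)) \<Longrightarrow>
    (\<lambda>n. cderiv L (yh n) (\<xi> n)) \<longlonglongrightarrow> cderiv L y x"
  and b_near: "x \<in> {0..L} \<Longrightarrow> (\<And>n. \<xi> n \<in> {0..L}) \<Longrightarrow> (\<And>n. \<bar>\<xi> n - x\<bar> \<le> mesh_size (N n)) \<Longrightarrow>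
    (\<lambda>n. bh n (\<xi> n)) \<longlonglongrightarrow> b x"
  by (rule H1_limit_at_nearby_points[OF th_H1 y_bound t_lim _ _ _ mesh]; assumption)
     (rule H1_limit_at_nearby_points[OF bh_H1 b_bound b_lim _ _ _ mesh]; assumption)

lemma left_node_near: "x \<in> {0..L} \<Longrightarrow> left_node (N n) x \<in> {0..L}" "x \<in> {0..L} \<Longrightarrow> \<bar>left_node (N n) x - x\<bar> \<le> mesh_size (N n)"
  "x \<in> {0..L} \<Longrightarrow> left_node (N n) x \<in> N n"
  "x \<in> {0..L} \<Longrightarrow> right_node (N n) x \<in> {0..L}" "x \<in> {0..L} \<Longrightarrow> \<bar>right_node (N n) x - x\<bar> \<le> mesh_size (N n)"
  "x \<in> {0..L} \<Longrightarrow> right_node (N n) x \<in> N n"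
  using left_right_node(1,3)[OF N, of x n] left_right_node_dist[OF N L, of x n] N[of n]
  by (auto simp: node_set_def)

text \<open>The constraint is known at nodes only, but the left nodes of x approach x, and the
  values there have the same limit as those at x.\<close>

lemma limit_unit:
  assumes x: "x \<in> {0..L}"
  shows "norm (cderiv L y x) = 1" "norm (b x) = 1"
proof -
  have "(\<lambda>n. norm (cderiv L (yh n) (left_node (N n) x))) \<longlonglongrightarrow> norm (cderiv L y x)"
    by (intro tendsto_norm t_near x left_node_near)
  moreover have "norm (cderiv L (yh n) (left_node (N n) x)) = 1" for n
    by (rule admissible_hD(3)[OF adm left_node_near(3)[OF x]])
  ultimately show "norm (cderiv L y x) = 1" by (simp add: LIMSEQ_const_iff)
  have "(\<lambda>n. norm (bh n (left_node (N n) x))) \<longlonglongrightarrow> norm (b x)"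
    by (intro tendsto_norm b_near x left_node_near)
  moreover have "norm (bh n (left_node (N n) x)) = 1" for n
    by (rule admissible_hD(4)[OF adm left_node_near(3)[OF x]])
  ultimately show "norm (b x) = 1" by (simp add: LIMSEQ_const_iff)
qed

lemma boundary_limit: "Lbc y b = lbc"
  by (rule boundary_values_limit[OF L bo y b admissible_hD(2)[OF adm]])

text \<open>Between nodes the tangent is quadratic and may exceed length one, so it is compared with
  its unit value at the node 0.\<close>

lemma th_bound:
  assumes x: "x \<in> {0..L}"
  shows "norm (cderiv L (yh n) x) \<le> 1 + sqrt (L * K)"
proof -
  have 0: "0 \<in> {0..L}" "0 \<in> N n" using L N[of n] by (auto simp: node_set_def)
  have "(norm (cderiv L (yh n) x - cderiv L (yh n) 0))\<^sup>2
      \<le> \<bar>x - 0\<bar> * (LINT x|M. (norm (wderiv2 L (yh n) x))\<^sup>2)"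
    by (rule H1_Hoelder[OF th_H1 x 0(1)])
  also have "\<dots> \<le> L * K" using x L by (intro mult_mono y_bound) auto
  finally have "norm (cderiv L (yh n) x - cderiv L (yh n) 0) \<le> sqrt (L * K)" by (rule real_le_rsqrt)
  then show ?thesis
    using norm_triangle_sub[of "cderiv L (yh n) x" "cderiv L (yh n) 0"] admissible_hD(3)[OF adm 0(2)] by simp
qed

abbreviation "Q n \<equiv> Q_avg (N n) (bh n)"

text \<open>At a node the enclosing nodes coincide and \<open>Q_avg\<close> takes the default value
  0. The nodes of all meshes together are countable and can be excluded at once.\<close>

lemma AE_not_node: "AE x in M. x \<in> {0..L} \<and> (\<forall>n. x \<notin> N n)"
proof -
  have "AE x in M. x \<notin> N n" for n
    by (rule AE_lebesgue_on_notin[OF null_sets_node_set[OF N]]) simp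
  then have "AE x in M. \<forall>n. x \<notin> N n" by (simp add: AE_all_countable)
  then show ?thesis using AE_space by eventually_elim auto
qed

lemma Q_bound: "AE x in M. norm (Q n x) \<le> 1"
  using AE_not_node
proof eventually_elim
  case (elim x)
  then show ?case
    by (intro Q_avg_norm_le[OF N H1_continuous[OF bh_H1]] admissible_h_norm_le[OF N adm]) auto
qed

text \<open>The average differs from \<open>bh n x\<close> by at most the oscillation over one
  element, which the Hoelder bound makes \<open>sqrt (mesh_size (N n) * K)\<close>.\<close>

lemma Q_lim: "AE x in M. (\<lambda>n. Q n x) \<longlonglongrightarrow> b x"
  using AE_not_node
proof eventually_elim
  case (elim x)
  then have x: "x \<in> {0..L}" "\<And>n. x \<notin> N n" by auto
  have le: "norm (Q n x - bh n x) \<le> sqrt (mesh_size (N n) * K)" for n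
  proof (rule Q_avg_diff_le[OF N H1_continuous[OF bh_H1] _ x])
    fix y assume y: "y \<in> {0..L}" "\<bar>y - x\<bar> \<le> mesh_size (N n)"
    have "(norm (bh n y - bh n x))\<^sup>2 \<le> \<bar>y - x\<bar> * (LINT x|M. (norm (wderiv L (bh n) x))\<^sup>2)"
      by (rule H1_Hoelder[OF bh_H1 y(1) x(1)])
    also have "\<dots> \<le> mesh_size (N n) * K" using y by (intro mult_mono b_bound) auto
    finally show "norm (bh n y - bh n x) \<le> sqrt (mesh_size (N n) * K)" by (rule real_le_rsqrt)
  qed
  have "(\<lambda>n. sqrt (mesh_size (N n) * K)) \<longlonglongrightarrow> 0"
    using tendsto_real_sqrt[OF tendsto_mult_left_zero[OF mesh, of K]] by simp
  then have "(\<lambda>n. Q n x - bh n x) \<longlonglongrightarrow> 0"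
    by (rule Lim_null_comparison[OF always_eventually[OF allI[OF le]]])
  from tendsto_add[OF this b_lim[OF x(1)]] show "(\<lambda>n. Q n x) \<longlonglongrightarrow> b x" by simp
qed

lemma H1_measurable: "f \<in> H1 L \<Longrightarrow> f \<in> borel_measurable M"
  by (rule continuous_on_imp_measurable_Icc[OF H1_continuous])

lemmas Q_meas = Q_avg_measurable[OF N]

abbreviation "d n x \<equiv> cross3 (cderiv L (yh n) x) (Q n x)"
abbreviation "d0 x \<equiv> cross3 (cderiv L y x) (b x)"

lemma d_meas: "d n \<in> borel_measurable M" and d0_meas: "d0 \<in> borel_measurable M"
  by (rule borel_measurable_bilinear[OF bilinear_cross H1_measurable[OF th_H1] Q_meas], simp)
     (rule borel_measurable_bilinear[OF bilinear_cross H1_measurable[OF t_H1] H1_measurable[OF b_H1]], simp)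

lemma d_bound: "AE x in M. norm (d n x) \<le> 1 + sqrt (L * K)"
  using Q_bound[of n] AE_space
proof eventually_elim
  case (elim x)
  have "norm (d n x) \<le> norm (cderiv L (yh n) x) * norm (Q n x)" by (rule norm_cross3_le)
  also have "\<dots> \<le> (1 + sqrt (L * K)) * 1"
    using elim L K_nonneg by (intro mult_mono th_bound) auto
  finally show ?case by simp
qed

lemma d_lim: "AE x in M. (\<lambda>n. d n x) \<longlonglongrightarrow> d0 x"
  using Q_lim AE_space
proof eventually_elim
  case (elim x)
  then show ?case by (intro bounded_bilinear.tendsto[OF cross3_bounded_bilinear] t_lim) auto
qed

abbreviation "pen n \<equiv> nodal_interp (N n) (\<lambda>t. (cderiv L (yh n) t \<bullet> bh n t)\<^sup>2)"

lemma pen_nodal: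
  assumes "z \<in> N n"
  shows "0 \<le> (cderiv L (yh n) z \<bullet> bh n z)\<^sup>2" "(cderiv L (yh n) z \<bullet> bh n z)\<^sup>2 \<le> 1"
proof -
  show "0 \<le> (cderiv L (yh n) z \<bullet> bh n z)\<^sup>2" by simp
  have "\<bar>cderiv L (yh n) z \<bullet> bh n z\<bar> \<le> 1"
    using Cauchy_Schwarz_ineq2[of "cderiv L (yh n) z" "bh n z"] admissible_hD(3,4)[OF adm assms] by simp
  then show "(cderiv L (yh n) z \<bullet> bh n z)\<^sup>2 \<le> 1" by (simp add: abs_square_le_1)
qed

lemma pen_nonneg: "0 \<le> (LINT x|M. pen n x)"
  using nodal_interp_bounds(1)[OF N _ pen_nodal] by (intro integral_nonneg_AE AE_I2) auto

text \<open>The interpolated penalty at x is a convex combination of its values at the two enclosing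
  nodes, and both of these tend to the value of the limit at x.\<close>

lemma pen_lim_pointwise:
  assumes x: "x \<in> {0..L}"
  shows "(\<lambda>n. pen n x) \<longlonglongrightarrow> (cderiv L y x \<bullet> b x)\<^sup>2"
proof -
  define v where "v n t = (cderiv L (yh n) t \<bullet> bh n t)\<^sup>2" for n t
  define v0 where "v0 = (cderiv L y x \<bullet> b x)\<^sup>2"
  have l: "(\<lambda>n. v n (left_node (N n) x)) \<longlonglongrightarrow> v0"
    unfolding v_def v0_def by (intro tendsto_power tendsto_inner t_near b_near x left_node_near)
  have r: "(\<lambda>n. v n (right_node (N n) x)) \<longlonglongrightarrow> v0"
    unfolding v_def v0_def by (intro tendsto_power tendsto_inner t_near b_near x left_node_near)
  have le: "norm (pen n x - v0) \<le> \<bar>v n (left_node (N n) x) - v0\<bar> + \<bar>v n (right_node (N n) x) - v0\<bar>" for n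
  proof -
    obtain s where s: "0 \<le> s" "s \<le> 1"
      "nodal_interp (N n) (v n) x = (1 - s) * v n (left_node (N n) x) + s * v n (right_node (N n) x)"
      using nodal_interp_convex[OF N x, of n "v n"] by blast
    have "pen n x - v0 = (1 - s) * (v n (left_node (N n) x) - v0) + s * (v n (right_node (N n) x) - v0)"
      using s(3) unfolding v_def[symmetric] by (simp add: algebra_simps)
    also have "\<bar>\<dots>\<bar> \<le> (1 - s) * \<bar>v n (left_node (N n) x) - v0\<bar> + s * \<bar>v n (right_node (N n) x) - v0\<bar>"
      using s by (intro order_trans[OF abs_triangle_ineq]) (simp add: abs_mult)
    also have "\<dots> \<le> 1 * \<bar>v n (left_node (N n) x) - v0\<bar> + 1 * \<bar>v n (right_node (N n) x) - v0\<bar>"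
      using s by (intro add_mono mult_right_mono) auto
    finally show ?thesis by simp
  qed
  have "(\<lambda>n. \<bar>v n (left_node (N n) x) - v0\<bar> + \<bar>v n (right_node (N n) x) - v0\<bar>) \<longlonglongrightarrow> \<bar>v0 - v0\<bar> + \<bar>v0 - v0\<bar>"
    by (intro tendsto_intros l r)
  then have "(\<lambda>n. \<bar>v n (left_node (N n) x) - v0\<bar> + \<bar>v n (right_node (N n) x) - v0\<bar>) \<longlonglongrightarrow> 0" by simp
  then have "(\<lambda>n. pen n x - v0) \<longlonglongrightarrow> 0"
    by (rule Lim_null_comparison[OF always_eventually[OF allI[OF le]]])
  then show ?thesis unfolding v0_def by (rule LIM_zero_cancel)
qed

lemma pen_lim: "(\<lambda>n. LINT x|M. pen n x) \<longlonglongrightarrow> (LINT x|M. (cderiv L y x \<bullet> b x)\<^sup>2)"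
proof (rule integral_dominated_convergence[where w="\<lambda>_. 1"])
  show "(\<lambda>x. (cderiv L y x \<bullet> b x)\<^sup>2) \<in> borel_measurable M"
    by (intro borel_measurable_power borel_measurable_inner H1_measurable t_H1 b_H1)
  show "pen n \<in> borel_measurable M" for n by (rule nodal_interp_measurable[OF N])
  show "integrable M (\<lambda>_. 1::real)" by simp
  show "AE x in M. (\<lambda>n. pen n x) \<longlonglongrightarrow> (cderiv L y x \<bullet> b x)\<^sup>2"
    by (intro AE_I2 pen_lim_pointwise) simp
  show "AE x in M. norm (pen n x) \<le> 1" for n
  proof (rule AE_I2)
    fix x assume "x \<in> space M"
    then have x: "x \<in> {0..L}" by simp
    show "norm (pen n x) \<le> 1"
      using nodal_interp_bounds[OF N x pen_nodal, of n] by simp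
  qed
qed

text \<open>A vanishing integral gives orthogonality everywhere, because the squared inner product
  of the limits is continuous and nonnegative.\<close>

lemma limit_orthogonal:
  assumes "(\<lambda>n. LINT x|M. pen n x) \<longlonglongrightarrow> 0" and x: "x \<in> {0..L}"
  shows "cderiv L y x \<bullet> b x = 0"
proof -
  have c: "continuous_on {0..L} (\<lambda>x. (cderiv L y x \<bullet> b x)\<^sup>2)"
    by (intro continuous_on_power continuous_on_inner H1_continuous t_H1 b_H1)
  have "(LINT x|M. (cderiv L y x \<bullet> b x)\<^sup>2) = 0"
    by (rule LIMSEQ_unique[OF pen_lim assms(1)])
  moreover have "(LINT x|M. (cderiv L y x \<bullet> b x)\<^sup>2) = integral {0..L} (\<lambda>x. (cderiv L y x \<bullet> b x)\<^sup>2)"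
    by (rule lebesgue_integral_eq_integral[OF continuous_imp_integrable_real[OF c]]) simp
  ultimately have "\<forall>x\<in>{0..L}. (cderiv L y x \<bullet> b x)\<^sup>2 = 0"
    using integral_eq_0_iff[OF c L] by simp
  then show ?thesis using x by simp
qed

lemma p_weak: "sq_integrable M w \<Longrightarrow>
    (\<lambda>n. LINT x|M. wderiv2 L (yh n) x \<bullet> w x) \<longlonglongrightarrow> (LINT x|M. wderiv2 L y x \<bullet> w x)"
  by (rule weakly_H1_wderiv[OF t_weak])

lemma q_weak: "sq_integrable M w \<Longrightarrow>
    (\<lambda>n. LINT x|M. wderiv L (bh n) x \<bullet> w x) \<longlonglongrightarrow> (LINT x|M. wderiv L b x \<bullet> w x)"
  by (rule weakly_H1_wderiv[OF b])

end

lemma wderiv_inner_const: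
  assumes f: "f \<in> H1 L" "g \<in> H1 L" and c: "\<And>x. x \<in> {0..L} \<Longrightarrow> f x \<bullet> g x = c"
  shows "AE x in lebesgue_on {0..L}. f x \<bullet> wderiv L g x + wderiv L f x \<bullet> g x = 0"
  by (rule inner_const_imp_AE[OF wderiv_integrable[OF f(1)] wderiv_integrable[OF f(2)] H1_FTC[OF f(1)] H1_FTC[OF f(2)] c])

text \<open>\<open>b'\<close> is expanded in the frame of tangent, director and their cross product.
  Differentiating the constraints removes the director component and turns the tangent component
  into a curvature term; the discrete functional imitates this decomposition.\<close>

lemma admissible_energy:
  assumes L: "0 < L" and adm: "(y, b) \<in> admissible L Lbc lbc"
  shows "(LINT x|lebesgue_on {0..L}. (norm (wderiv L b x))\<^sup>2)
    = (LINT x|lebesgue_on {0..L}. (wderiv2 L y x \<bullet> b x)\<^sup>2)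
      + (LINT x|lebesgue_on {0..L}. (wderiv L b x \<bullet> cross3 (cderiv L y x) (b x))\<^sup>2)"
proof -
  let ?M = "lebesgue_on {0..L}"
  have y: "y \<in> H2 L" and b: "b \<in> H1 L"
    and u: "\<And>x. x \<in> {0..L} \<Longrightarrow> norm (cderiv L y x) = 1 \<and> norm (b x) = 1 \<and> cderiv L y x \<bullet> b x = 0"
    using adm by (auto simp: admissible_def)
  note t = H2_D(2)[OF L y]
  have bb: "b x \<bullet> b x = 1" if "x \<in> {0..L}" for x using u[OF that] by (simp add: norm_eq_1)
  have tb: "cderiv L y x \<bullet> b x = 0" if "x \<in> {0..L}" for x using u[OF that] by simp
  have ae: "AE x in ?M. (norm (wderiv L b x))\<^sup>2
      = (wderiv2 L y x \<bullet> b x)\<^sup>2 + (wderiv L b x \<bullet> cross3 (cderiv L y x) (b x))\<^sup>2"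
  proof -
    have "AE x in ?M. b x \<bullet> wderiv L b x + wderiv L b x \<bullet> b x = 0"
      by (rule wderiv_inner_const[OF b b]) (rule bb)
    moreover have "AE x in ?M. cderiv L y x \<bullet> wderiv L b x + wderiv2 L y x \<bullet> b x = 0"
      by (rule wderiv_inner_const[OF t b]) (rule tb)
    ultimately show ?thesis using AE_space
    proof eventually_elim
      case (elim x)
      have 1: "wderiv L b x \<bullet> b x = 0" using elim(1) by (simp add: inner_commute)
      have "wderiv L b x \<bullet> cderiv L y x = - (wderiv2 L y x \<bullet> b x)"
        using elim(2) by (simp add: inner_commute add_eq_0_iff)
      then have 2: "(wderiv L b x \<bullet> cderiv L y x)\<^sup>2 = (wderiv2 L y x \<bullet> b x)\<^sup>2" by simp
      have x: "x \<in> {0..L}" using elim(3) by simp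
      show ?case
        using orthonormal_frame_norm_sq[of "cderiv L y x" "b x" "wderiv L b x"] u[OF x] 1 2 by simp
    qed
  qed
  have bm: "b \<in> borel_measurable ?M" and tm: "cderiv L y \<in> borel_measurable ?M"
    by (rule continuous_on_imp_measurable_Icc[OF H1_continuous] b t)+
  have dm: "(\<lambda>x. cross3 (cderiv L y x) (b x)) \<in> borel_measurable ?M"
    by (rule borel_measurable_bilinear[OF bilinear_cross tm bm]) simp
  have bB: "AE x in ?M. norm (b x) \<le> 1" using u by (intro AE_I2) simp
  have dB: "AE x in ?M. norm (cross3 (cderiv L y x) (b x)) \<le> 1"
  proof (rule AE_I2)
    fix x assume "x \<in> space ?M"
    then show "norm (cross3 (cderiv L y x) (b x)) \<le> 1"
      using norm_cross3_le[of "cderiv L y x" "b x"] u[of x] by simp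
  qed
  \<comment> \<open>Constant sequences of directions make the integrability facts of the convergence
    context available for the limit itself.\<close>
  have i1: "integrable ?M (\<lambda>x. (wderiv2 L y x \<bullet> b x)\<^sup>2)"
    by (rule sq_integrable_inner_bounded(3)[where \<omega>="\<lambda>_. b" and B=1, OF bm bm bB _ wderiv(3)[OF t] wderiv(3)[OF t]]) simp
  have i2: "integrable ?M (\<lambda>x. (wderiv L b x \<bullet> cross3 (cderiv L y x) (b x))\<^sup>2)"
    by (rule sq_integrable_inner_bounded(3)[where \<omega>="\<lambda>_ x. cross3 (cderiv L y x) (b x)" and B=1, OF dm dm dB _ wderiv(3)[OF b] wderiv(3)[OF b]]) simp
  have "(LINT x|?M. (norm (wderiv L b x))\<^sup>2)
      = (LINT x|?M. (wderiv2 L y x \<bullet> b x)\<^sup>2 + (wderiv L b x \<bullet> cross3 (cderiv L y x) (b x))\<^sup>2)"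
    by (rule integral_cong_AE[OF borel_measurable_integrable[OF sq_integrable_norm_sq[OF wderiv(3)[OF b]]]
        borel_measurable_integrable[OF Bochner_Integration.integrable_add[OF i1 i2]] ae])
  also have "\<dots> = (LINT x|?M. (wderiv2 L y x \<bullet> b x)\<^sup>2) + (LINT x|?M. (wderiv L b x \<bullet> cross3 (cderiv L y x) (b x))\<^sup>2)"
    by (rule Bochner_Integration.integral_add[OF i1 i2])
  finally show ?thesis .
qed

section \<open>The lower bound\<close>

definition rod_energy :: "real \<Rightarrow> real \<Rightarrow> curve \<Rightarrow> curve \<Rightarrow> real" where
  "rod_energy L \<kappa> y b = \<kappa> / 2 * (LINT x|lebesgue_on {0..L}. (norm (wderiv2 L y x))\<^sup>2)
    + 1 / 2 * (LINT x|lebesgue_on {0..L}. (wderiv L b x \<bullet> cross3 (cderiv L y x) (b x))\<^sup>2)"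

text \<open>The finite branch as a real number, so that estimates avoid \<open>ereal\<close>. The
  factors of the subtracted term are swapped to match the pattern
  \<open>v x \<bullet> \<omega> n x\<close>.\<close>

definition discrete_energy :: "real \<Rightarrow> real \<Rightarrow> real \<Rightarrow> real set \<Rightarrow> real \<Rightarrow> curve \<Rightarrow> curve \<Rightarrow> real" where
  "discrete_energy L \<kappa> \<theta> N \<epsilon> y b =
    \<kappa> / 2 * (LINT x|lebesgue_on {0..L}. (norm (wderiv2 L y x))\<^sup>2)
    + \<theta> / 2 * (LINT x|lebesgue_on {0..L}. (norm (wderiv L b x))\<^sup>2)
    - \<theta> / 2 * (LINT x|lebesgue_on {0..L}. (wderiv2 L y x \<bullet> Q_avg N b x)\<^sup>2)
    + 1 / (2 * \<epsilon>) * (LINT x|lebesgue_on {0..L}. nodal_interp N (\<lambda>t. (cderiv L y t \<bullet> b t)\<^sup>2) x)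
    + (1 - \<theta>) / 2 * (LINT x|lebesgue_on {0..L}. (wderiv L b x \<bullet> cross3 (cderiv L y x) (Q_avg N b x))\<^sup>2)"

lemma I_rod_eq:
  "I_rod L \<kappa> Lbc lbc y b = (if (y, b) \<in> admissible L Lbc lbc then ereal (rod_energy L \<kappa> y b) else \<infinity>)"
  by (simp only: I_rod_def rod_energy_def)

lemma I_rod_h_eq:
  "I_rod_h L \<kappa> \<theta> Lbc lbc N \<epsilon> y b =
    (if (y, b) \<in> admissible_h L N Lbc lbc then ereal (discrete_energy L \<kappa> \<theta> N \<epsilon> y b) else \<infinity>)"
  by (simp only: I_rod_h_def discrete_energy_def inner_commute[of "Q_avg N b _"])

text \<open>For every \<theta> the two middle terms amount to a share \<theta> of the torsion. In
  this form the limit energy matches the discrete one term by term.\<close>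

lemma rod_energy_split:
  assumes "0 < L" "(y, b) \<in> admissible L Lbc lbc"
  shows "rod_energy L \<kappa> y b = \<kappa> / 2 * (LINT x|lebesgue_on {0..L}. (norm (wderiv2 L y x))\<^sup>2)
    + \<theta> / 2 * (LINT x|lebesgue_on {0..L}. (norm (wderiv L b x))\<^sup>2)
    - \<theta> / 2 * (LINT x|lebesgue_on {0..L}. (wderiv2 L y x \<bullet> b x)\<^sup>2)
    + (1 - \<theta>) / 2 * (LINT x|lebesgue_on {0..L}. (wderiv L b x \<bullet> cross3 (cderiv L y x) (b x))\<^sup>2)"
  unfolding rod_energy_def admissible_energy[OF assms] by (simp add: algebra_simps add_divide_distrib diff_divide_distrib)

lemma Q_avg_proj_le:
  assumes N: "node_set L N" and adm: "(y, b) \<in> admissible_h L N Lbc lbc" and b: "b \<in> H1 L"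
    and v: "sq_integrable (lebesgue_on {0..L}) v"
  shows "(LINT x|lebesgue_on {0..L}. (v x \<bullet> Q_avg N b x)\<^sup>2) \<le> (LINT x|lebesgue_on {0..L}. (norm (v x))\<^sup>2)"
proof -
  let ?M = "lebesgue_on {0..L}"
  have ae: "AE x in ?M. norm (Q_avg N b x) \<le> 1"
  proof -
    have "AE x in ?M. x \<notin> N" by (rule AE_lebesgue_on_notin[OF null_sets_node_set[OF N]]) simp
    then show ?thesis using AE_space
    proof eventually_elim
      case (elim x)
      then show ?case
        by (intro Q_avg_norm_le[OF N H1_continuous[OF b]] admissible_h_norm_le[OF N adm]) auto
    qed
  qed
  have "(LINT x|?M. (v x \<bullet> Q_avg N b x)\<^sup>2) \<le> 1\<^sup>2 * (LINT x|?M. (norm (v x))\<^sup>2)"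
    by (rule proj_integral_le[where \<omega>="\<lambda>_. Q_avg N b", OF Q_avg_measurable[OF N] Q_avg_measurable[OF N, of b] ae _ v]) simp
  then show ?thesis by simp
qed

text \<open>Here \<theta> \<le> \<kappa> / 2 enters: half of the bending energy absorbs the
  subtracted term and the other half survives with coefficient \<open>\<kappa> / 4\<close>. All
  remaining terms are nonnegative, so each is bounded separately.\<close>

lemma discrete_energy_bounds:
  assumes L: "0 < L" and \<kappa>: "0 < \<kappa>" and \<theta>: "\<theta> = min (\<kappa> / 2) 1" and N: "node_set L N" and \<epsilon>: "0 < \<epsilon>"
    and adm: "(y, b) \<in> admissible_h L N Lbc lbc" and y: "y \<in> H2 L" and b: "b \<in> H1 L"
    and E: "discrete_energy L \<kappa> \<theta> N \<epsilon> y b \<le> c"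
  shows "\<kappa> / 4 * (LINT x|lebesgue_on {0..L}. (norm (wderiv2 L y x))\<^sup>2) \<le> c"
    "\<theta> / 2 * (LINT x|lebesgue_on {0..L}. (norm (wderiv L b x))\<^sup>2) \<le> c"
    "(LINT x|lebesgue_on {0..L}. nodal_interp N (\<lambda>t. (cderiv L y t \<bullet> b t)\<^sup>2) x) \<le> 2 * \<epsilon> * c"
    "0 \<le> (LINT x|lebesgue_on {0..L}. nodal_interp N (\<lambda>t. (cderiv L y t \<bullet> b t)\<^sup>2) x)"
proof -
  define P T S W U where "P = (LINT x|lebesgue_on {0..L}. (norm (wderiv2 L y x))\<^sup>2)"
    and "T = (LINT x|lebesgue_on {0..L}. (norm (wderiv L b x))\<^sup>2)"
    and "S = (LINT x|lebesgue_on {0..L}. (wderiv2 L y x \<bullet> Q_avg N b x)\<^sup>2)"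
    and "W = (LINT x|lebesgue_on {0..L}. nodal_interp N (\<lambda>t. (cderiv L y t \<bullet> b t)\<^sup>2) x)"
    and "U = (LINT x|lebesgue_on {0..L}. (wderiv L b x \<bullet> cross3 (cderiv L y x) (Q_avg N b x))\<^sup>2)"
  have E': "\<kappa> / 2 * P + \<theta> / 2 * T - \<theta> / 2 * S + 1 / (2 * \<epsilon>) * W + (1 - \<theta>) / 2 * U \<le> c"
    using E unfolding discrete_energy_def P_def T_def S_def W_def U_def .
  have nn: "0 \<le> P" "0 \<le> T" "0 \<le> U" by (simp_all add: P_def T_def U_def)
  show W: "0 \<le> (LINT x|lebesgue_on {0..L}. nodal_interp N (\<lambda>t. (cderiv L y t \<bullet> b t)\<^sup>2) x)"
  proof (intro integral_nonneg_AE AE_I2)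
    fix x assume "x \<in> space (lebesgue_on {0..L})"
    then obtain s where "0 \<le> s" "s \<le> 1" "nodal_interp N (\<lambda>t. (cderiv L y t \<bullet> b t)\<^sup>2) x =
        (1 - s) * (cderiv L y (left_node N x) \<bullet> b (left_node N x))\<^sup>2 + s * (cderiv L y (right_node N x) \<bullet> b (right_node N x))\<^sup>2"
      using nodal_interp_convex[OF N, of x "\<lambda>t. (cderiv L y t \<bullet> b t)\<^sup>2"] by auto
    then show "0 \<le> nodal_interp N (\<lambda>t. (cderiv L y t \<bullet> b t)\<^sup>2) x" by simp
  qed
  have th: "0 < \<theta>" "\<theta> \<le> \<kappa> / 2" "\<theta> \<le> 1" using \<kappa> unfolding \<theta> by auto
  have "S \<le> P"
    unfolding S_def P_def by (rule Q_avg_proj_le[OF N adm b wderiv(3)[OF H2_D(2)[OF L y]]])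
  then have "\<theta> / 2 * S \<le> \<theta> / 2 * P" using th by (intro mult_left_mono) auto
  also have "\<dots> \<le> \<kappa> / 4 * P" using th nn by (intro mult_right_mono) auto
  finally have SP: "\<theta> / 2 * S \<le> \<kappa> / 4 * P" .
  have half: "\<kappa> / 2 * P = \<kappa> / 4 * P + \<kappa> / 4 * P" by (simp add: field_simps)
  have n1: "0 \<le> \<kappa> / 4 * P" using \<kappa> nn(1) by simp
  have n2: "0 \<le> \<theta> / 2 * T" using th nn(2) by simp
  have n3: "0 \<le> (1 - \<theta>) / 2 * U" using th nn(3) by simp
  have n4: "0 \<le> 1 / (2 * \<epsilon>) * W" using \<epsilon> W by (simp add: W_def)
  show "\<kappa> / 4 * (LINT x|lebesgue_on {0..L}. (norm (wderiv2 L y x))\<^sup>2) \<le> c"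
    unfolding P_def[symmetric] using E' SP half n1 n2 n3 n4 by linarith
  show "\<theta> / 2 * (LINT x|lebesgue_on {0..L}. (norm (wderiv L b x))\<^sup>2) \<le> c"
    unfolding T_def[symmetric] using E' SP half n1 n2 n3 n4 by linarith
  have "1 / (2 * \<epsilon>) * W \<le> c" using E' SP half n1 n2 n3 n4 by linarith
  then show "(LINT x|lebesgue_on {0..L}. nodal_interp N (\<lambda>t. (cderiv L y t \<bullet> b t)\<^sup>2) x) \<le> 2 * \<epsilon> * c"
    unfolding W_def[symmetric] using \<epsilon> by (simp add: divide_le_eq mult.commute mult.left_commute)
qed

text \<open>Each quadratic term is replaced by its tangent at the weak limit, which is linear in the
  discrete derivatives and so passes to the limit. The tangents bound the form from below although
  one term is concave, because the total second-order remainder is nonnegative.\<close>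

lemma (in discrete_sequence) energy_lower_bound:
  assumes \<kappa>: "0 < \<kappa>" and \<theta>: "0 < \<theta>" "\<theta> \<le> \<kappa>" "\<theta> \<le> 1" and \<epsilon>: "\<And>n. 0 < \<epsilon> n"
    and E: "\<And>n. discrete_energy L \<kappa> \<theta> (N n) (\<epsilon> n) (yh n) (bh n) \<le> c"
  shows "\<kappa> / 2 * (LINT x|M. (norm (wderiv2 L y x))\<^sup>2) + \<theta> / 2 * (LINT x|M. (norm (wderiv L b x))\<^sup>2)
    - \<theta> / 2 * (LINT x|M. (wderiv2 L y x \<bullet> b x)\<^sup>2)
    + (1 - \<theta>) / 2 * (LINT x|M. (wderiv L b x \<bullet> d0 x)\<^sup>2) \<le> c"
proof -
  let ?p = "wderiv2 L y" and ?q = "wderiv L b"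
  define P0 T0 S0 U0 where "P0 = (LINT x|M. (norm (?p x))\<^sup>2)" and "T0 = (LINT x|M. (norm (?q x))\<^sup>2)"
    and "S0 = (LINT x|M. (?p x \<bullet> b x)\<^sup>2)" and "U0 = (LINT x|M. (?q x \<bullet> d0 x)\<^sup>2)"
  have sp: "sq_integrable M ?p" "\<And>n. sq_integrable M (wderiv2 L (yh n))"
    by (rule wderiv(3) t_H1 th_H1)+
  have sq: "sq_integrable M ?q" "\<And>n. sq_integrable M (wderiv L (bh n))"
    by (rule wderiv(3) b_H1 bh_H1)+
  define Pc Tc Sc Sq Uc Uq where "Pc n = (LINT x|M. wderiv2 L (yh n) x \<bullet> ?p x)"
    and "Tc n = (LINT x|M. wderiv L (bh n) x \<bullet> ?q x)"
    and "Sc n = (LINT x|M. (?p x \<bullet> Q n x) * (wderiv2 L (yh n) x \<bullet> Q n x))"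
    and "Sq n = (LINT x|M. (?p x \<bullet> Q n x)\<^sup>2)"
    and "Uc n = (LINT x|M. (?q x \<bullet> d n x) * (wderiv L (bh n) x \<bullet> d n x))"
    and "Uq n = (LINT x|M. (?q x \<bullet> d n x)\<^sup>2)" for n
  note Qc = Q_meas H1_measurable[OF b_H1] Q_bound Q_lim
  note dc = d_meas d0_meas d_bound d_lim
  have lims: "Pc \<longlonglongrightarrow> P0" "Tc \<longlonglongrightarrow> T0" "Sc \<longlonglongrightarrow> S0" "Sq \<longlonglongrightarrow> S0" "Uc \<longlonglongrightarrow> U0" "Uq \<longlonglongrightarrow> U0"
    unfolding Pc_def[abs_def] Tc_def[abs_def] Sc_def[abs_def] Sq_def[abs_def] Uc_def[abs_def] Uq_def[abs_def]
      P0_def T0_def S0_def U0_def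
    using p_weak[OF sp(1)] q_weak[OF sq(1)]
      proj_cross_convergence[OF Qc sp(2) y_bound sp(1) p_weak] proj_square_convergence[OF Qc sp(1)]
      proj_cross_convergence[OF dc sq(2) b_bound sq(1) q_weak] proj_square_convergence[OF dc sq(1)]
    by (simp_all only: power2_norm_eq_inner)
  \<comment> \<open>The linearisation at the limit \<open>(?p, ?q)\<close>, with directions frozen
    at step n: mixed terms are doubled and pure terms at the limit are subtracted.\<close>
  define G where "G n = \<kappa> / 2 * (2 * Pc n - P0) + \<theta> / 2 * (2 * Tc n - T0) - \<theta> / 2 * (2 * Sc n - Sq n)
      + (1 - \<theta>) / 2 * (2 * Uc n - Uq n)" for n
  have "G \<longlonglongrightarrow> \<kappa> / 2 * (2 * P0 - P0) + \<theta> / 2 * (2 * T0 - T0) - \<theta> / 2 * (2 * S0 - S0) + (1 - \<theta>) / 2 * (2 * U0 - U0)"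
    unfolding G_def[abs_def] by (intro tendsto_intros lims)
  moreover have "G n \<le> c" for n
  proof -
    define P T S W U where "P = (LINT x|M. (norm (wderiv2 L (yh n) x))\<^sup>2)"
      and "T = (LINT x|M. (norm (wderiv L (bh n) x))\<^sup>2)"
      and "S = (LINT x|M. (wderiv2 L (yh n) x \<bullet> Q n x)\<^sup>2)"
      and "W = (LINT x|M. pen n x)"
      and "U = (LINT x|M. (wderiv L (bh n) x \<bullet> d n x)\<^sup>2)"
    define X Y where "X = (LINT x|M. (norm (wderiv2 L (yh n) x - ?p x))\<^sup>2)"
      and "Y = (LINT x|M. ((wderiv2 L (yh n) x - ?p x) \<bullet> Q n x)\<^sup>2)"
    have E': "\<kappa> / 2 * P + \<theta> / 2 * T - \<theta> / 2 * S + 1 / (2 * \<epsilon> n) * W + (1 - \<theta>) / 2 * U \<le> c"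
      using E[of n] unfolding discrete_energy_def P_def T_def S_def W_def U_def .
    have diff: "(LINT x|M. (norm (v x - w x))\<^sup>2) = (LINT x|M. (norm (v x))\<^sup>2) - 2 * (LINT x|M. v x \<bullet> w x) + (LINT x|M. (norm (w x))\<^sup>2)"
      if "sq_integrable M v" "sq_integrable M w" for v w :: curve
      using integral_norm_sq_add[OF that(1) sq_integrable_scaleR[OF that(2), of "-1"]] by simp
    have X: "X = P - 2 * Pc n + P0"
      unfolding X_def P_def Pc_def P0_def by (rule diff[OF sp(2) sp(1)])
    have "0 \<le> (LINT x|M. (norm (wderiv L (bh n) x - ?q x))\<^sup>2)" by simp
    then have T: "2 * Tc n - T0 \<le> T"
      using diff[OF sq(2)[of n] sq(1)] unfolding T_def Tc_def T0_def by linarith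
    have S: "S - Y = 2 * Sc n - Sq n"
      using proj_lower_bound[OF Qc sp(2) sp(1), of n n] unfolding S_def Y_def Sc_def Sq_def by linarith
    have YX: "Y \<le> X" unfolding X_def Y_def
      by (rule Q_avg_proj_le[OF N adm bh_H1 sq_integrable_diff[OF sp(2) sp(1)]])
    have "0 \<le> (LINT x|M. ((wderiv L (bh n) x - ?q x) \<bullet> d n x)\<^sup>2)" by simp
    then have U: "2 * Uc n - Uq n \<le> U"
      using proj_lower_bound[OF dc sq(2) sq(1), of n n] unfolding U_def Uc_def Uq_def by linarith
    have W: "0 \<le> 1 / (2 * \<epsilon> n) * W" using pen_nonneg[of n] \<epsilon>[of n] unfolding W_def by simp
    have "0 \<le> X" by (simp add: X_def)
    \<comment> \<open>The remainder X of the bending term pays for the remainder Y of the subtracted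
      one; for the other terms the remainder is simply dropped.\<close>
    then have XY: "\<theta> / 2 * Y \<le> \<kappa> / 2 * X"
      using YX \<theta> by (intro order_trans[OF mult_left_mono[OF YX] mult_right_mono]) auto
    have "\<theta> / 2 * (2 * Tc n - T0) \<le> \<theta> / 2 * T" using T \<theta> by (intro mult_left_mono) auto
    moreover have "(1 - \<theta>) / 2 * (2 * Uc n - Uq n) \<le> (1 - \<theta>) / 2 * U" using U \<theta> by (intro mult_left_mono) auto
    moreover have "\<kappa> / 2 * (2 * Pc n - P0) = \<kappa> / 2 * P - \<kappa> / 2 * X" unfolding X by (simp add: algebra_simps)
    moreover have "\<theta> / 2 * (2 * Sc n - Sq n) = \<theta> / 2 * S - \<theta> / 2 * Y" unfolding S[symmetric] by (rule right_diff_distrib')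
    ultimately show ?thesis unfolding G_def using E' W XY by linarith
  qed
  ultimately have "\<kappa> / 2 * (2 * P0 - P0) + \<theta> / 2 * (2 * T0 - T0) - \<theta> / 2 * (2 * S0 - S0) + (1 - \<theta>) / 2 * (2 * U0 - U0) \<le> c"
    by (intro LIMSEQ_le_const2) auto
  then show ?thesis unfolding P0_def[symmetric] T0_def[symmetric] S0_def[symmetric] U0_def[symmetric] by simp
qed

lemma bounded_energy_limit:
  fixes Lbc :: "curve \<Rightarrow> curve \<Rightarrow> 'y::real_vector"
  assumes L: "0 < L" and \<kappa>: "0 < \<kappa>" and \<theta>: "\<theta> = min (\<kappa> / 2) 1" and bo: "boundary_operator L Lbc"
    and N: "\<And>n. node_set L (N n)" and mesh: "(\<lambda>n. mesh_size (N n)) \<longlonglongrightarrow> 0"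
    and \<epsilon>: "\<And>n. 0 < \<epsilon> n" "\<epsilon> \<longlonglongrightarrow> 0"
    and y: "weakly_H2 L yh y" and b: "weakly_H1 L bh b"
    and adm: "\<And>n. (yh n, bh n) \<in> admissible_h L (N n) Lbc lbc"
    and E: "\<And>n. discrete_energy L \<kappa> \<theta> (N n) (\<epsilon> n) (yh n) (bh n) \<le> c"
  shows "(y, b) \<in> admissible L Lbc lbc" "rod_energy L \<kappa> y b \<le> c"
proof -
  have th: "0 < \<theta>" "\<theta> \<le> \<kappa>" "\<theta> \<le> 1" using \<kappa> unfolding \<theta> by auto
  note bd = discrete_energy_bounds[OF L \<kappa> \<theta> N \<epsilon>(1) adm weakly_converges_mem(1)[OF y] weakly_converges_mem(1)[OF b] E]
  define K where "K = max (4 * c / \<kappa>) (2 * c / \<theta>)"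
  interpret discrete_sequence L N Lbc lbc yh bh y b K
  proof
    show "(LINT x|lebesgue_on {0..L}. (norm (wderiv2 L (yh n) x))\<^sup>2) \<le> K" for n
    proof -
      have "(LINT x|lebesgue_on {0..L}. (norm (wderiv2 L (yh n) x))\<^sup>2) \<le> 4 * c / \<kappa>"
        using bd(1)[of n] \<kappa> by (simp add: pos_le_divide_eq mult.commute)
      then show ?thesis by (simp add: K_def)
    qed
    show "(LINT x|lebesgue_on {0..L}. (norm (wderiv L (bh n) x))\<^sup>2) \<le> K" for n
    proof -
      have "(LINT x|lebesgue_on {0..L}. (norm (wderiv L (bh n) x))\<^sup>2) \<le> 2 * c / \<theta>"
        using bd(2)[of n] th(1) by (simp add: pos_le_divide_eq mult.commute)
      then show ?thesis by (simp add: K_def)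
    qed
  qed (fact L bo N mesh y b adm)+
  \<comment> \<open>The penalty integral tends to zero through \<epsilon> alone, at a rate that does
    not involve the mesh.\<close>
  have "(\<lambda>n. 2 * \<epsilon> n * c) \<longlonglongrightarrow> 2 * 0 * c" by (intro tendsto_intros \<epsilon>)
  then have "(\<lambda>n. 2 * \<epsilon> n * c) \<longlonglongrightarrow> 0" by simp
  then have "(\<lambda>n. LINT x|M. pen n x) \<longlonglongrightarrow> 0"
  proof (rule tendsto_sandwich[OF _ _ tendsto_const, rotated 2])
    show "\<forall>\<^sub>F n in sequentially. 0 \<le> (LINT x|M. pen n x)" by (rule always_eventually) (use bd(4) in blast)
    show "\<forall>\<^sub>F n in sequentially. (LINT x|M. pen n x) \<le> 2 * \<epsilon> n * c" by (rule always_eventually) (use bd(3) in blast)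
  qed
  note orth = limit_orthogonal[OF this]
  show a: "(y, b) \<in> admissible L Lbc lbc"
    using y_H2 b_H1 boundary_limit limit_unit orth unfolding admissible_def by blast
  show "rod_energy L \<kappa> y b \<le> c"
    unfolding rod_energy_split[OF L a, of \<kappa> \<theta>] by (rule energy_lower_bound[OF \<kappa> th \<epsilon>(1) E])
qed

lemma weakly_converges_subseq:
  assumes "weakly_converges X nrm u v" "strict_mono r"
  shows "weakly_converges X nrm (\<lambda>n. u (r n)) v"
  unfolding weakly_converges_def
proof (intro conjI allI impI)
  fix F assume "dual_functional X nrm F"
  from LIMSEQ_subseq_LIMSEQ[OF weakly_convergesD[OF assms(1) this] assms(2)]
  show "(\<lambda>n. F (u (r n))) \<longlonglongrightarrow> F v" unfolding comp_def .
qed (rule weakly_converges_mem[OF assms(1)])+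

text \<open>If the inequality fails, a real c fits strictly between the two sides and infinitely
  many energies lie below it. Along that subsequence the pairs are discretely admissible with energy
  at most c, so the limit energy is at most c as well.\<close>

lemma liminf_inequality:
  fixes Lbc :: "curve \<Rightarrow> curve \<Rightarrow> 'y::real_vector"
  assumes L: "0 < L" and \<kappa>: "0 < \<kappa>" and \<theta>: "\<theta> = min (\<kappa> / 2) 1" and bo: "boundary_operator L Lbc"
    and N: "\<And>n. node_set L (N n)" and mesh: "(\<lambda>n. mesh_size (N n)) \<longlonglongrightarrow> 0"
    and \<epsilon>: "\<And>n. 0 < \<epsilon> n" "\<epsilon> \<longlonglongrightarrow> 0"
    and y: "weakly_H2 L yh y" and b: "weakly_H1 L bh b"
  shows "I_rod L \<kappa> Lbc lbc y b \<le> liminf (\<lambda>n. I_rod_h L \<kappa> \<theta> Lbc lbc (N n) (\<epsilon> n) (yh n) (bh n))"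
proof (rule ccontr)
  define J where "J n = I_rod_h L \<kappa> \<theta> Lbc lbc (N n) (\<epsilon> n) (yh n) (bh n)" for n
  assume "\<not> I_rod L \<kappa> Lbc lbc y b \<le> liminf (\<lambda>n. I_rod_h L \<kappa> \<theta> Lbc lbc (N n) (\<epsilon> n) (yh n) (bh n))"
  then have "liminf J < I_rod L \<kappa> Lbc lbc y b" by (simp add: J_def[abs_def] not_le)
  then obtain c where c: "liminf J < ereal c" "ereal c < I_rod L \<kappa> Lbc lbc y b"
    using ereal_dense2 by blast
  have "frequently (\<lambda>n. J n < ereal c) sequentially"
  proof (rule ccontr)
    assume "\<not> frequently (\<lambda>n. J n < ereal c) sequentially"
    then have "\<forall>\<^sub>F n in sequentially. ereal c \<le> J n" by (simp add: not_frequently not_less)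
    then have "ereal c \<le> liminf J" by (rule Liminf_bounded)
    with c(1) show False by simp
  qed
  then have "infinite {n. J n < ereal c}"
    by (simp add: frequently_cofinite flip: cofinite_eq_sequentially)
  then obtain r :: "nat \<Rightarrow> nat" where r: "strict_mono r" "\<And>n. r n \<in> {n. J n < ereal c}"
    using infinite_enumerate by blast
  have J: "(yh (r n), bh (r n)) \<in> admissible_h L (N (r n)) Lbc lbc"
      "discrete_energy L \<kappa> \<theta> (N (r n)) (\<epsilon> (r n)) (yh (r n)) (bh (r n)) \<le> c" for n
    using r(2)[of n] by (auto simp: J_def I_rod_h_eq split: if_splits)
  note lim = bounded_energy_limit[where N="\<lambda>n. N (r n)" and \<epsilon>="\<lambda>n. \<epsilon> (r n)", OF L \<kappa> \<theta> bo N
      LIMSEQ_subseq_LIMSEQ[OF mesh r(1), unfolded comp_def] \<epsilon>(1) LIMSEQ_subseq_LIMSEQ[OF \<epsilon>(2) r(1), unfolded comp_def]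
      weakly_converges_subseq[OF y r(1)] weakly_converges_subseq[OF b r(1)] J]
  have "I_rod L \<kappa> Lbc lbc y b \<le> ereal c" using lim by (simp add: I_rod_eq)
  with c(2) show False by simp
qed

section \<open>Interpolation\<close>

text \<open>Integration by parts against an affine function; it holds for continuous \<open>g\<close>, and both sides
  depend continuously on \<open>g\<close> in \<open>L\<^sup>2\<close>.\<close>

lemma integral_primitive:
  fixes g :: "real \<Rightarrow> 'b::euclidean_space"
  assumes g: "sq_integrable (lebesgue_on {0..L}) g" and z: "0 \<le> z" "z \<le> z'" "z' \<le> L"
  shows "integral {z..z'} (\<lambda>x. integral {z..x} g) = integral {z..z'} (\<lambda>x. (z' - x) *\<^sub>R g x)"
proof -
  let ?M = "lebesgue_on {0..L}"
  define D where "D h = integral {z..z'} (\<lambda>x. integral {z..x} h) - integral {z..z'} (\<lambda>x. (z' - x) *\<^sub>R h x)"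
    for h :: "real \<Rightarrow> 'b"
  have L: "0 \<le> L" using z by simp
  have int: "h integrable_on {z..z'}" "continuous_on {z..z'} (\<lambda>x. integral {z..x} h)"
      "(\<lambda>x. integral {z..x} h) integrable_on {z..z'}" "(\<lambda>x. (z' - x) *\<^sub>R h x) integrable_on {z..z'}"
      "sq_integrable ?M (\<lambda>x. (z' - x) *\<^sub>R h x)"
    if h: "sq_integrable ?M h" for h :: "real \<Rightarrow> 'b"
  proof -
    show 1: "h integrable_on {z..z'}"
      by (rule integrable_imp_integrable_on_Icc(1)[OF sq_integrable_imp_integrable[OF finite_measure_Icc h] z(1,3)])
    show 2: "continuous_on {z..z'} (\<lambda>x. integral {z..x} h)" by (rule indefinite_integral_continuous_1[OF 1])
    show "(\<lambda>x. integral {z..x} h) integrable_on {z..z'}" by (rule integrable_continuous_interval[OF 2])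
    show s: "sq_integrable ?M (\<lambda>x. (z' - x) *\<^sub>R h x)"
    proof (rule sq_integrable_bound[OF h])
      show "(\<lambda>x. (z' - x) *\<^sub>R h x) \<in> borel_measurable ?M"
        by (intro borel_measurable_scaleR continuous_on_imp_measurable_Icc continuous_intros sq_integrable_measurable h)
      show "AE x in ?M. norm ((z' - x) *\<^sub>R h x) \<le> L * norm (h x)"
        using z by (intro AE_I2) (auto intro!: mult_right_mono)
    qed
    show "(\<lambda>x. (z' - x) *\<^sub>R h x) integrable_on {z..z'}"
      by (rule integrable_imp_integrable_on_Icc(1)[OF sq_integrable_imp_integrable[OF finite_measure_Icc s] z(1,3)])
  qed
  have bound: "norm (D h) \<le> 2 * (L * sqrt (L * e))"
    if h: "sq_integrable ?M h" and e: "(LINT x|?M. (norm (h x))\<^sup>2) \<le> e" for h :: "real \<Rightarrow> 'b" and e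
  proof -
    have e0: "0 \<le> e" by (rule order_trans[OF _ e]) simp
    have prim: "norm (integral {a..x} w) \<le> sqrt (L * c)"
      if "sq_integrable ?M w" "(LINT x|?M. (norm (w x))\<^sup>2) \<le> c" "0 \<le> a" "a \<le> x" "x \<le> L" for w :: "real \<Rightarrow> 'b" and a x c
    proof (rule real_le_rsqrt)
      have "(norm (integral {a..x} w))\<^sup>2 \<le> (x - a) * (LINT x|?M. (norm (w x))\<^sup>2)"
        by (rule norm_integral_sq_le[OF that(1,3,4,5)])
      also have "\<dots> \<le> L * c" using that L by (intro mult_mono) auto
      finally show "(norm (integral {a..x} w))\<^sup>2 \<le> L * c" .
    qed
    have "norm (integral {z..z'} (\<lambda>x. integral {z..x} h)) \<le> sqrt (L * e) * (z' - z)"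
    proof (rule integral_bound[OF z(2) int(2)[OF h]])
      fix x assume "x \<in> {z..z'}"
      then show "norm (integral {z..x} h) \<le> sqrt (L * e)" using z by (intro prim[OF h e]) auto
    qed
    also have "\<dots> \<le> sqrt (L * e) * L" using z e0 L by (intro mult_left_mono) auto
    finally have 1: "norm (integral {z..z'} (\<lambda>x. integral {z..x} h)) \<le> L * sqrt (L * e)" by (simp add: mult.commute)
    have "(LINT x|?M. (norm ((z' - x) *\<^sub>R h x))\<^sup>2) \<le> (LINT x|?M. L\<^sup>2 * (norm (h x))\<^sup>2)"
    proof (rule integral_mono)
      fix x assume x: "x \<in> space ?M"
      have "(z' - x)\<^sup>2 \<le> L\<^sup>2" using z x by (intro abs_le_square_iff[THEN iffD1]) auto
      then show "(norm ((z' - x) *\<^sub>R h x))\<^sup>2 \<le> L\<^sup>2 * (norm (h x))\<^sup>2"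
        by (simp add: power_mult_distrib mult_right_mono)
    qed (use sq_integrable_norm_sq[OF int(5)[OF h]] sq_integrable_norm_sq[OF h] in auto)
    also have "\<dots> \<le> L\<^sup>2 * e" using e by (simp add: mult_left_mono)
    finally have "norm (integral {z..z'} (\<lambda>x. (z' - x) *\<^sub>R h x)) \<le> sqrt (L * (L\<^sup>2 * e))"
      by (rule prim[OF int(5)[OF h] _ z])
    also have "\<dots> = L * sqrt (L * e)" using L by (simp add: real_sqrt_mult mult.left_commute)
    finally have 2: "norm (integral {z..z'} (\<lambda>x. (z' - x) *\<^sub>R h x)) \<le> L * sqrt (L * e)" .
    have "norm (D h) \<le> L * sqrt (L * e) + L * sqrt (L * e)"
      unfolding D_def by (rule norm_triangle_le_diff[OF add_mono[OF 1 2]])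
    then show ?thesis by simp
  qed
  have cont: "D k = 0" if k: "continuous_on {z..z'} k" for k :: "real \<Rightarrow> 'b"
  proof -
    have ki: "k integrable_on {z..z'}" by (rule integrable_continuous_interval[OF k])
    have Gc: "continuous_on {z..z'} (\<lambda>x. integral {z..x} k)" by (rule indefinite_integral_continuous_1[OF ki])
    \<comment> \<open>The integrand is the derivative of (z' - x) times the primitive of k, a
      product that vanishes at both ends.\<close>
    have "((\<lambda>x. (z' - x) *\<^sub>R k x + (-1) *\<^sub>R integral {z..x} k) has_integral
        ((z' - z') *\<^sub>R integral {z..z'} k - (z' - z) *\<^sub>R integral {z..z} k)) {z..z'}"
    proof (rule fundamental_theorem_of_calculus[OF z(2)])
      fix x assume x: "x \<in> {z..z'}"
      have "((\<lambda>x. z' - x) has_vector_derivative -1) (at x within {z..z'})"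
        by (auto intro!: derivative_eq_intros)
      from bounded_bilinear.has_vector_derivative[OF bounded_bilinear_scaleR this integral_has_vector_derivative[OF k x]]
      show "((\<lambda>x. (z' - x) *\<^sub>R integral {z..x} k) has_vector_derivative (z' - x) *\<^sub>R k x + (-1) *\<^sub>R integral {z..x} k) (at x within {z..z'})" .
    qed
    then have "integral {z..z'} (\<lambda>x. (z' - x) *\<^sub>R k x - integral {z..x} k) = 0"
      by (simp add: integral_unique)
    moreover have "(\<lambda>x. (z' - x) *\<^sub>R k x) integrable_on {z..z'}"
      by (intro integrable_continuous_interval continuous_intros k)
    ultimately show ?thesis
      unfolding D_def using Henstock_Kurzweil_Integration.integral_diff[OF _ integrable_continuous_interval[OF Gc]] by simp
  qed
  have "norm (D g) \<le> 2 * (L * sqrt (L * e))" if e: "e > 0" for e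
  proof -
    obtain k where k: "continuous_on UNIV k" "(LINT x|?M. (norm (g x - k x))\<^sup>2) < e"
      using sq_integrable_approx_continuous[OF g e] .
    have ks: "sq_integrable ?M k" by (rule continuous_on_imp_sq_integrable[OF continuous_on_subset[OF k(1)]]) simp
    have gk: "sq_integrable ?M (\<lambda>x. g x - k x)" by (rule sq_integrable_diff[OF g ks])
    have gi: "g integrable_on {z..x}" "k integrable_on {z..x}" if "x \<in> {z..z'}" for x
      using integrable_subinterval_real[OF int(1)[OF g]] integrable_subinterval_real[OF int(1)[OF ks]] that by auto
    have "integral {z..z'} (\<lambda>x. integral {z..x} (\<lambda>x. g x - k x)) = integral {z..z'} (\<lambda>x. integral {z..x} g - integral {z..x} k)"
      using gi by (intro Henstock_Kurzweil_Integration.integral_cong Henstock_Kurzweil_Integration.integral_diff) auto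
    also have "\<dots> = integral {z..z'} (\<lambda>x. integral {z..x} g) - integral {z..z'} (\<lambda>x. integral {z..x} k)"
      by (rule Henstock_Kurzweil_Integration.integral_diff[OF int(3)[OF g] int(3)[OF ks]])
    finally have "D (\<lambda>x. g x - k x) = D g - D k"
      unfolding D_def scaleR_diff_right Henstock_Kurzweil_Integration.integral_diff[OF int(4)[OF g] int(4)[OF ks]] by simp
    moreover have "D k = 0" by (rule cont[OF continuous_on_subset[OF k(1)]]) simp
    ultimately show ?thesis using bound[OF gk less_imp_le[OF k(2)]] by simp
  qed
  note small = this
  have "D g = 0"
  proof (rule ccontr)
    assume "D g \<noteq> 0"
    then have pos: "norm (D g) > 0" by simp
    have lim: "(\<lambda>n. 2 * (L * sqrt (L * inverse (real (Suc n))))) \<longlonglongrightarrow> 2 * (L * sqrt (L * 0))"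
      by (intro tendsto_intros LIMSEQ_inverse_real_of_nat)
    have all: "\<forall>n. norm (D g) \<le> 2 * (L * sqrt (L * inverse (real (Suc n))))"
      by (intro allI small) simp
    have "norm (D g) \<le> 2 * (L * sqrt (L * 0))" by (rule LIMSEQ_le_const[OF lim]) (use all in blast)
    with pos show False by simp
  qed
  then show ?thesis by (simp add: D_def)
qed

text \<open>The formula for h is required on the open element only, since an elementwise function
  carries unrelated values at the nodes; its primitive is polynomial on the closed element
  nevertheless.\<close>

lemma polynomial_on_primitive:
  assumes z: "z \<le> z'" and h: "\<And>t. t \<in> {z<..<z'} \<Longrightarrow> h t = (\<Sum>i\<le>k. t ^ i *\<^sub>R c i)"
    and F: "\<And>t. t \<in> {z..z'} \<Longrightarrow> F t = F z + integral {z..t} h"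
  shows "polynomial_on (Suc k) {z..z'} F"
proof -
  define G where "G t = (\<Sum>i\<le>k. (t ^ Suc i / real (Suc i)) *\<^sub>R c i)" for t :: real
  have G: "integral {z..t} h = G t - G z" if t: "t \<in> {z..z'}" for t
  proof (rule integral_unique, rule fundamental_theorem_of_calculus_interior)
    show "continuous_on {z..t} G" unfolding G_def by (intro continuous_intros) auto
    fix x assume x: "x \<in> {z<..<t}"
    have "((\<lambda>t. t ^ Suc i / real (Suc i)) has_real_derivative (real (Suc i) * x ^ (Suc i - Suc 0)) / real (Suc i)) (at x)" for i
      by (intro DERIV_cdivide DERIV_pow)
    then have "((\<lambda>t. t ^ Suc i / real (Suc i)) has_real_derivative x ^ i) (at x)" for i
      by (simp del: of_nat_Suc power_Suc)
    then have "((\<lambda>t. (t ^ Suc i / real (Suc i)) *\<^sub>R c i) has_vector_derivative x ^ i *\<^sub>R c i) (at x)" for i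
      by (intro has_vector_derivative_scaleR[THEN has_vector_derivative_eq_rhs] has_vector_derivative_const) auto
    then have "(G has_vector_derivative (\<Sum>i\<le>k. x ^ i *\<^sub>R c i)) (at x)"
      unfolding G_def[abs_def] by (intro has_vector_derivative_sum)
    then show "(G has_vector_derivative h x) (at x)" using h[of x] x t by simp
  qed (use t in simp)
  \<comment> \<open>The shifted coefficients of the antiderivative; the constant term is adjusted so
    that the value at z is right.\<close>
  define C where "C j = (case j of 0 \<Rightarrow> F z - G z | Suc i \<Rightarrow> (1 / real (Suc i)) *\<^sub>R c i)" for j
  have "F t = (\<Sum>j\<le>Suc k. t ^ j *\<^sub>R C j)" if t: "t \<in> {z..z'}" for t
  proof -
    have "(\<Sum>j\<le>Suc k. t ^ j *\<^sub>R C j) = C 0 + (\<Sum>i\<le>k. t ^ Suc i *\<^sub>R C (Suc i))"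
      by (simp only: sum.atMost_Suc_shift) simp
    also have "(\<Sum>i\<le>k. t ^ Suc i *\<^sub>R C (Suc i)) = G t" unfolding G_def C_def by simp
    finally show ?thesis using F[OF t] G[OF t] by (simp add: C_def)
  qed
  then show ?thesis unfolding polynomial_on_def by blast
qed

text \<open>Centred at the midpoint c, the functions 1 and x - c are orthogonal on the element, with
  squared norms l and \<open>l ^ 3 / 12\<close>. Thus e and a are the Fourier coefficients of g,
  rewritten in powers of x.\<close>

lemma affine_projection_exists:
  fixes g :: "real \<Rightarrow> 'b::euclidean_space"
  assumes z: "z < z'" and g: "g integrable_on {z..z'}" "(\<lambda>x. x *\<^sub>R g x) integrable_on {z..z'}"
  shows "\<exists>a e. integral {z..z'} (\<lambda>x. a + x *\<^sub>R e - g x) = 0 \<and> integral {z..z'} (\<lambda>x. x *\<^sub>R (a + x *\<^sub>R e - g x)) = 0"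
proof -
  define c l where "c = (z + z') / 2" and "l = z' - z"
  have l: "l > 0" using z by (simp add: l_def)
  define I0 I1 where "I0 = integral {z..z'} g" and "I1 = integral {z..z'} (\<lambda>x. x *\<^sub>R g x)"
  define e where "e = (12 / l ^ 3) *\<^sub>R (I1 - c *\<^sub>R I0)"
  define a where "a = (1 / l) *\<^sub>R I0 - c *\<^sub>R e"
  have p: "((\<lambda>x::real. 1) has_integral l) {z..z'}" "((\<lambda>x::real. x) has_integral c * l) {z..z'}"
    "((\<lambda>x::real. x\<^sup>2) has_integral (c\<^sup>2 * l + l ^ 3 / 12)) {z..z'}"
  proof -
    show "((\<lambda>x::real. 1) has_integral l) {z..z'}"
      using has_integral_const_real[of "1::real" z z'] z by (simp add: l_def)
    have "((\<lambda>x::real. x) has_integral (z'\<^sup>2 / 2 - z\<^sup>2 / 2)) {z..z'}"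
      using z by (intro fundamental_theorem_of_calculus) (auto intro!: derivative_eq_intros simp flip: has_real_derivative_iff_has_vector_derivative)
    moreover have "z'\<^sup>2 / 2 - z\<^sup>2 / 2 = c * l" by (simp add: c_def l_def field_simps power2_eq_square)
    ultimately show "((\<lambda>x::real. x) has_integral c * l) {z..z'}" by simp
    have "((\<lambda>x::real. x\<^sup>2) has_integral (z' ^ 3 / 3 - z ^ 3 / 3)) {z..z'}"
      using z by (intro fundamental_theorem_of_calculus) (auto intro!: derivative_eq_intros simp flip: has_real_derivative_iff_has_vector_derivative)
    moreover have "z' ^ 3 / 3 - z ^ 3 / 3 = c\<^sup>2 * l + l ^ 3 / 12"
      by (simp add: c_def l_def field_simps power2_eq_square power3_eq_cube)
    ultimately show "((\<lambda>x::real. x\<^sup>2) has_integral (c\<^sup>2 * l + l ^ 3 / 12)) {z..z'}" by simp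
  qed
  have sc: "((\<lambda>x. f x *\<^sub>R v) has_integral r *\<^sub>R v) {z..z'}" if "(f has_integral r) {z..z'}" for f :: "real \<Rightarrow> real" and r and v :: 'b
    using has_integral_scaleR_left[OF that] .
  have 1: "((\<lambda>x. 1 *\<^sub>R a + x *\<^sub>R e - g x) has_integral (l *\<^sub>R a + (c * l) *\<^sub>R e - I0)) {z..z'}"
    unfolding I0_def by (intro has_integral_diff has_integral_add sc p integrable_integral g)
  have 2: "((\<lambda>x. x *\<^sub>R a + x\<^sup>2 *\<^sub>R e - x *\<^sub>R g x) has_integral ((c * l) *\<^sub>R a + (c\<^sup>2 * l + l ^ 3 / 12) *\<^sub>R e - I1)) {z..z'}"
    unfolding I1_def by (intro has_integral_diff has_integral_add sc p integrable_integral g)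
  have z1: "l *\<^sub>R a + (c * l) *\<^sub>R e - I0 = 0"
    using l by (simp add: a_def scaleR_diff_right mult.commute)
  have "(c * l) *\<^sub>R a = c *\<^sub>R I0 - (c\<^sup>2 * l) *\<^sub>R e"
    using l by (simp add: a_def scaleR_diff_right power2_eq_square mult_ac)
  moreover have "(l ^ 3 / 12) *\<^sub>R e = I1 - c *\<^sub>R I0" using l by (simp add: e_def)
  ultimately have z2: "(c * l) *\<^sub>R a + (c\<^sup>2 * l + l ^ 3 / 12) *\<^sub>R e - I1 = 0"
    by (simp add: scaleR_add_left)
  have "integral {z..z'} (\<lambda>x. a + x *\<^sub>R e - g x) = 0"
    using integral_unique[OF 1] z1 by simp
  moreover have "integral {z..z'} (\<lambda>x. x *\<^sub>R (a + x *\<^sub>R e - g x)) = 0"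
    using integral_unique[OF 2] z2 by (simp add: scaleR_add_right scaleR_diff_right power2_eq_square)
  ultimately show ?thesis by blast
qed

text \<open>Coefficients are indexed by the two endpoints, which avoids numbering the elements. At a
  node both arguments coincide and the value is arbitrary.\<close>

definition elementwise_affine :: "real set \<Rightarrow> (real \<Rightarrow> real \<Rightarrow> 'b::real_vector) \<Rightarrow> (real \<Rightarrow> real \<Rightarrow> 'b) \<Rightarrow> real \<Rightarrow> 'b" where
  "elementwise_affine N a e x = a (left_node N x) (right_node N x) + x *\<^sub>R e (left_node N x) (right_node N x)"

context
  fixes L :: real and N :: "real set" and a e :: "real \<Rightarrow> real \<Rightarrow> real^3"
  assumes L: "0 < L" and N: "node_set L N"
begin

private abbreviation "A \<equiv> elementwise_affine N a e"

lemma elementwise_affine_eq: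
  assumes "neighbours N z z'" "x \<in> {z<..<z'}"
  shows "A x = a z z' + x *\<^sub>R e z z'"
  using node_eqI[OF N assms(1), of x] assms(2) by (simp add: elementwise_affine_def)

lemma elementwise_affine_continuous: "neighbours N z z' \<Longrightarrow> continuous_on {z<..<z'} A"
proof -
  assume nb: "neighbours N z z'"
  have "continuous_on {z<..<z'} A \<longleftrightarrow> continuous_on {z<..<z'} (\<lambda>x. a z z' + x *\<^sub>R e z z')"
    by (rule continuous_on_cong) (use elementwise_affine_eq[OF nb] in auto)
  then show ?thesis by (simp add: continuous_intros)
qed

lemma elementwise_affine_sq_integrable: "sq_integrable (lebesgue_on {0..L}) A"
proof (rule sq_integrable_bounded[OF finite_measure_Icc elementwise_continuous_measurable[OF N elementwise_affine_continuous]])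
  \<comment> \<open>The sum runs over all pairs of nodes and so includes the degenerate pairs that
    are evaluated at the nodes.\<close>
  define B where "B = (\<Sum>u\<in>N \<times> N. norm (a (fst u) (snd u)) + L * norm (e (fst u) (snd u)))"
  fix x assume "x \<in> space (lebesgue_on {0..L})"
  then have x: "x \<in> {0..L}" by simp
  let ?u = "(left_node N x, right_node N x)"
  have "norm (A x) \<le> norm (a (fst ?u) (snd ?u)) + norm (x *\<^sub>R e (fst ?u) (snd ?u))"
    unfolding elementwise_affine_def fst_conv snd_conv by (rule norm_triangle_ineq)
  also have "\<dots> \<le> norm (a (fst ?u) (snd ?u)) + L * norm (e (fst ?u) (snd ?u))"
    using x by (simp add: mult_right_mono)
  also have "\<dots> \<le> B" unfolding B_def
  proof (rule member_le_sum)
    show "?u \<in> N \<times> N" using left_right_node(1,3)[OF N x] by simp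
    show "finite (N \<times> N)" using N by (simp add: node_set_def)
  qed (use L in auto)
  finally show "norm (A x) \<le> B" .
qed

lemma elementwise_affine_integrable: "integrable (lebesgue_on {0..L}) A"
  by (rule sq_integrable_imp_integrable[OF finite_measure_Icc elementwise_affine_sq_integrable])

lemma elementwise_affine_primitive:
  assumes F: "\<And>x. x \<in> {0..L} \<Longrightarrow> F x = v + integral {0..x} A"
  shows "F \<in> H1 L" "AE x in lebesgue_on {0..L}. wderiv L F x = A x" "F 0 = v"
    "neighbours N z z' \<Longrightarrow> t \<in> {z..z'} \<Longrightarrow> F t = F z + integral {z..t} A"
proof -
  note Ai = integrable_imp_integrable_on_Icc(1)[OF elementwise_affine_integrable order_refl order_refl]
  have "continuous_on {0..L} (\<lambda>x. v + integral {0..x} A)"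
    by (intro continuous_intros indefinite_integral_continuous_1 Ai)
  then have c: "continuous_on {0..L} F" by (rule continuous_on_eq) (rule F[symmetric])
  have w: "is_weak_deriv L F A"
  proof (rule is_weak_deriv_of_has_vector_derivative[OF _ _ c elementwise_affine_integrable])
    show fin: "finite N" using N by (simp add: node_set_def)
    fix x assume x: "x \<in> {0<..<L} - N"
    then have x': "x \<in> {0..L}" "x \<notin> N" by auto
    define z z' where "z = left_node N x" and "z' = right_node N x"
    have nb: "neighbours N z z'" and zx: "x \<in> {z<..<z'}"
      using left_right_node(7,8)[OF N x'] by (auto simp: z_def z'_def)
    have "isCont A x"
      using continuous_on_interior[OF elementwise_affine_continuous[OF nb]] zx by (simp add: interior_open)
    \<comment> \<open>The nodes are the finite exceptional set. The resulting one-set derivative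
      becomes an ordinary one, because the open element around x avoids them.\<close>
    then have "continuous (at x within ({0..L} - N)) A" by (rule continuous_at_imp_continuous_at_within)
    from integral_has_vector_derivative_continuous_at[OF Ai _ fin this]
    have "((\<lambda>u. integral {0..u} A) has_vector_derivative A x) (at x within ({0..L} - N))"
      using x by auto
    then have d: "((\<lambda>u. v + integral {0..u} A) has_vector_derivative A x) (at x within ({0..L} - N))"
      by (auto intro!: derivative_eq_intros)
    have sub: "{z<..<z'} \<subseteq> {0..L} - N" using neighbours_Icc[OF N nb] neighboursD(4)[OF nb] by force
    have "((\<lambda>u. v + integral {0..u} A) has_vector_derivative A x) (at x)"
      using has_vector_derivative_within_subset[OF d sub] has_vector_derivative_within_open[OF zx open_greaterThanLessThan]
      by blast
    then show "(F has_vector_derivative A x) (at x)"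
    proof (rule has_vector_derivative_transform_within_open[OF _ open_greaterThanLessThan zx])
      show "v + integral {0..t} A = F t" if "t \<in> {z<..<z'}" for t using F[of t] that sub by auto
    qed
  qed (use L in simp)
  have A2: "L2_fun L A" using elementwise_affine_sq_integrable by (simp add: L2_fun_iff)
  show "F \<in> H1 L" by (rule H1_I[OF c A2 w])
  show "AE x in lebesgue_on {0..L}. wderiv L F x = A x" by (rule wderiv_AE_eq[OF c A2 w])
  show "F 0 = v" using F[of 0] L by simp
  assume nb: "neighbours N z z'" and t: "t \<in> {z..z'}"
  note I = neighbours_Icc[OF N nb]
  have "integral {0..t} A = integral {0..z} A + integral {z..t} A"
    using I t by (intro integral_Icc_combine[OF elementwise_affine_integrable]) auto
  then show "F t = F z + integral {z..t} A" using F[of t] F[of z] I t by simp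
qed

text \<open>\<open>A\<close> is the elementwise \<open>L\<^sup>2\<close> projection of \<open>g\<close> onto affine functions, or onto constants
  if \<open>e\<close> vanishes; in both cases the error is orthogonal to \<open>A\<close> and to elementwise constants.\<close>

lemma elementwise_projection_orthogonal:
  assumes nb: "neighbours N z z'" and g: "sq_integrable (lebesgue_on {0..L}) g"
    and m0: "integral {z..z'} (\<lambda>x. a z z' + x *\<^sub>R e z z' - g x) = 0"
    and m1: "e z z' = 0 \<or> integral {z..z'} (\<lambda>x. x *\<^sub>R (a z z' + x *\<^sub>R e z z' - g x)) = 0"
    and P: "\<And>x. x \<in> {z<..<z'} \<Longrightarrow> P x = c"
  shows "integral {z..z'} (\<lambda>x. (g x - A x) \<bullet> (A x - P x)) = 0"
proof -
  note I = neighbours_Icc[OF N nb]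
  let ?w = "\<lambda>x. a z z' + x *\<^sub>R e z z' - g x"
  have ws: "sq_integrable (lebesgue_on {0..L}) ?w"
    by (intro sq_integrable_diff continuous_on_imp_sq_integrable g continuous_intros)
  have wi: "?w integrable_on {z..z'}"
    by (rule integrable_imp_integrable_on_Icc(1)[OF sq_integrable_imp_integrable[OF finite_measure_Icc ws] I(1,2)])
  have xwi: "(\<lambda>x. x *\<^sub>R ?w x) integrable_on {z..z'}"
    by (intro integrable_imp_integrable_on_Icc(1)[OF _ I(1,2)] test_function_product_integrable continuous_intros
        sq_integrable_imp_integrable[OF finite_measure_Icc ws])
  have 1: "((\<lambda>x. ?w x \<bullet> (a z z' - c)) has_integral (0 \<bullet> (a z z' - c))) {z..z'}"
    using has_integral_linear[OF integrable_integral[OF wi] bounded_linear_inner_left, of "a z z' - c"] m0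
    by (simp add: o_def)
  have 2: "((\<lambda>x. (x *\<^sub>R ?w x) \<bullet> e z z') has_integral 0) {z..z'}"
    using has_integral_linear[OF integrable_integral[OF xwi] bounded_linear_inner_left, of "e z z'"] m1
    by (auto simp: o_def)
  have "integral {z..z'} (\<lambda>x. (g x - A x) \<bullet> (A x - P x))
      = integral {z..z'} (\<lambda>x. - (?w x \<bullet> (a z z' - c) + (x *\<^sub>R ?w x) \<bullet> e z z'))"
  proof (rule integral_spike[of "{z, z'}"])
    fix x assume "x \<in> {z..z'} - {z, z'}"
    then have x: "x \<in> {z<..<z'}" by auto
    have "g x - A x = - ?w x" "A x - P x = (a z z' - c) + x *\<^sub>R e z z'"
      unfolding elementwise_affine_eq[OF nb x] P[OF x] by simp_all
    then have "(g x - A x) \<bullet> (A x - P x) = - (?w x \<bullet> ((a z z' - c) + x *\<^sub>R e z z'))"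
      by (simp only: inner_minus_left)
    then show "- (?w x \<bullet> (a z z' - c) + (x *\<^sub>R ?w x) \<bullet> e z z') = (g x - A x) \<bullet> (A x - P x)"
      unfolding inner_add_right by simp
  qed simp
  also have "\<dots> = 0"
    using integral_unique[OF has_integral_neg[OF has_integral_add[OF 1 2]]] by simp
  finally show ?thesis .
qed

end

text \<open>Pythagoras: g - P is the orthogonal sum of g - A and A - P for every elementwise
  constant P. Sampling an arbitrary k at left nodes provides the competitors for the density
  argument.\<close>

lemma elementwise_projection_best:
  fixes N :: "real set" and a e :: "real \<Rightarrow> real \<Rightarrow> real^3"
  defines "A \<equiv> elementwise_affine N a e"
  assumes L: "0 < L" and N: "node_set L N" and g: "sq_integrable (lebesgue_on {0..L}) g"
    and m0: "\<And>z z'. neighbours N z z' \<Longrightarrow> integral {z..z'} (\<lambda>x. a z z' + x *\<^sub>R e z z' - g x) = 0"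
    and m1: "\<And>z z'. neighbours N z z' \<Longrightarrow>
      e z z' = 0 \<or> integral {z..z'} (\<lambda>x. x *\<^sub>R (a z z' + x *\<^sub>R e z z' - g x)) = 0"
  shows "(LINT x|lebesgue_on {0..L}. (norm (A x - g x))\<^sup>2)
    \<le> (LINT x|lebesgue_on {0..L}. (norm (g x - k (left_node N x)))\<^sup>2)"
proof -
  let ?M = "lebesgue_on {0..L}"
  let ?P = "\<lambda>x. k (left_node N x)"
  \<comment> \<open>The competitor is itself elementwise affine with zero slope, which settles its
    measurability and integrability.\<close>
  have P_eq: "elementwise_affine N (\<lambda>z z'. k z) (\<lambda>z z'. 0) = ?P"
    by (auto simp: elementwise_affine_def)
  have Ps: "sq_integrable ?M ?P"
    using elementwise_affine_sq_integrable[OF L N, of "\<lambda>z z'. k z" "\<lambda>z z'. 0"] unfolding P_eq .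
  have As: "sq_integrable ?M A" unfolding A_def by (rule elementwise_affine_sq_integrable[OF L N])
  have gA: "sq_integrable ?M (\<lambda>x. g x - A x)" and AP: "sq_integrable ?M (\<lambda>x. A x - ?P x)"
    by (rule sq_integrable_diff[OF g As] sq_integrable_diff[OF As Ps])+
  have zero: "(LINT x|?M. (g x - A x) \<bullet> (A x - ?P x)) = 0"
  proof (rule elementwise_lebesgue_integral_zero[OF N sq_integrable_inner[OF gA AP]])
    fix z z' assume nb: "neighbours N z z'"
    show "integral {z..z'} (\<lambda>x. (g x - A x) \<bullet> (A x - ?P x)) = 0"
      unfolding A_def
      by (rule elementwise_projection_orthogonal[where a=a and e=e and c="k z", OF L N nb g m0[OF nb] m1[OF nb]])
        (use node_eqI[OF N nb] in auto)
  qed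
  have "(LINT x|?M. (norm (g x - ?P x))\<^sup>2) = (LINT x|?M. (norm ((g x - A x) + (A x - ?P x)))\<^sup>2)" by simp
  also have "\<dots> = (LINT x|?M. (norm (g x - A x))\<^sup>2) + (LINT x|?M. (norm (A x - ?P x))\<^sup>2)"
    unfolding integral_norm_sq_add[OF gA AP] zero by simp
  finally have "(LINT x|?M. (norm (g x - A x))\<^sup>2) \<le> (LINT x|?M. (norm (g x - ?P x))\<^sup>2)" by simp
  then show ?thesis by (simp add: norm_minus_commute)
qed

text \<open>Matching zeroth moments means that A and the derivative of f have equal integrals over
  every element, so their primitives agree at the nodes.\<close>

lemma elementwise_projection_nodal:
  fixes N :: "real set" and a e :: "real \<Rightarrow> real \<Rightarrow> real^3"
  defines "A \<equiv> elementwise_affine N a e"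
  assumes L: "0 < L" and N: "node_set L N" and f: "f \<in> H1 L" and F: "\<And>x. x \<in> {0..L} \<Longrightarrow> F x = f 0 + integral {0..x} A"
    and m0: "\<And>z z'. neighbours N z z' \<Longrightarrow> integral {z..z'} (\<lambda>x. a z z' + x *\<^sub>R e z z' - wderiv L f x) = 0"
    and z: "z \<in> N"
  shows "F z = f z"
proof -
  note fi = wderiv_integrable[OF f]
  have z0: "0 \<le> z" "z \<le> L" using N z by (auto simp: node_set_def)
  have "integral {0..z} (\<lambda>x. A x - wderiv L f x) = 0"
  proof (rule elementwise_integral_zero[OF N _ _ z])
    show "integrable (lebesgue_on {0..L}) (\<lambda>x. A x - wderiv L f x)"
      unfolding A_def using elementwise_affine_integrable[OF L N] fi by simp
    fix u u' assume nb: "neighbours N u u'"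
    have "integral {u..u'} (\<lambda>x. A x - wderiv L f x) = integral {u..u'} (\<lambda>x. a u u' + x *\<^sub>R e u u' - wderiv L f x)"
      by (rule integral_spike[of "{u, u'}"]) (use elementwise_affine_eq[OF L N nb] in \<open>auto simp: A_def\<close>)
    then show "integral {u..u'} (\<lambda>x. A x - wderiv L f x) = 0" using m0[OF nb] by simp
  qed
  then have "integral {0..z} A = integral {0..z} (wderiv L f)"
    using Henstock_Kurzweil_Integration.integral_diff[OF
        integrable_imp_integrable_on_Icc(1)[OF elementwise_affine_integrable[OF L N] order_refl z0(2)]
        integrable_imp_integrable_on_Icc(1)[OF fi order_refl z0(2)]] by (simp add: A_def)
  moreover have "f z = f 0 + integral {0..z} (wderiv L f)"
    using H1_FTC[OF f order_refl z0] by (simp add: diff_eq_eq add.commute)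
  ultimately show ?thesis using F[of z] z0 by simp
qed

text \<open>Interpolation is obtained by projecting the derivative and integrating back, which
  yields nodal agreement and the error estimate together. The disjunction in the moment condition
  serves both the constant projection for the director and the affine one for the tangent.\<close>

lemma H1_interpolant:
  fixes a e :: "real \<Rightarrow> real \<Rightarrow> real^3"
  assumes L: "0 < L" and N: "node_set L N" and f: "f \<in> H1 L"
    and m: "\<forall>z z'. neighbours N z z' \<longrightarrow> integral {z..z'} (\<lambda>x. a z z' + x *\<^sub>R e z z' - wderiv L f x) = 0 \<and>
      (e z z' = 0 \<or> integral {z..z'} (\<lambda>x. x *\<^sub>R (a z z' + x *\<^sub>R e z z' - wderiv L f x)) = 0)"
  defines "F \<equiv> \<lambda>x. f 0 + integral {0..x} (elementwise_affine N a e)"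
  shows "F \<in> H1 L" "z \<in> N \<Longrightarrow> F z = f z"
    "neighbours N z z' \<Longrightarrow> t \<in> {z..z'} \<Longrightarrow> F t = F z + integral {z..t} (elementwise_affine N a e)"
    "(LINT x|lebesgue_on {0..L}. (norm (wderiv L F x - wderiv L f x))\<^sup>2)
      \<le> (LINT x|lebesgue_on {0..L}. (norm (wderiv L f x - k (left_node N x)))\<^sup>2)"
proof -
  have m0: "integral {z..z'} (\<lambda>x. a z z' + x *\<^sub>R e z z' - wderiv L f x) = 0"
    and m1: "e z z' = 0 \<or> integral {z..z'} (\<lambda>x. x *\<^sub>R (a z z' + x *\<^sub>R e z z' - wderiv L f x)) = 0"
    if "neighbours N z z'" for z z' using m[rule_format, OF that] by blast+
  have F: "F x = f 0 + integral {0..x} (elementwise_affine N a e)" for x by (simp add: F_def)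
  note pr = elementwise_affine_primitive[OF L N F]
  show H: "F \<in> H1 L" by (rule pr(1))
  show "z \<in> N \<Longrightarrow> F z = f z" by (rule elementwise_projection_nodal[OF L N f F m0])
  show "neighbours N z z' \<Longrightarrow> t \<in> {z..z'} \<Longrightarrow> F t = F z + integral {z..t} (elementwise_affine N a e)" by (rule pr(4))
  have ae: "AE x in lebesgue_on {0..L}. wderiv L F x - wderiv L f x = elementwise_affine N a e x - wderiv L f x"
    using pr(2) by eventually_elim simp
  have "(LINT x|lebesgue_on {0..L}. (norm (wderiv L F x - wderiv L f x))\<^sup>2)
      = (LINT x|lebesgue_on {0..L}. (norm (elementwise_affine N a e x - wderiv L f x))\<^sup>2)"
    by (rule integral_norm_sq_cong_AE[OF _ _ ae])
      (intro borel_measurable_diff sq_integrable_measurable wderiv(3) H f elementwise_affine_sq_integrable L N)+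
  also have "\<dots> \<le> (LINT x|lebesgue_on {0..L}. (norm (wderiv L f x - k (left_node N x)))\<^sup>2)"
    by (rule elementwise_projection_best[OF L N wderiv(3)[OF f] m0 m1])
  finally show "(LINT x|lebesgue_on {0..L}. (norm (wderiv L F x - wderiv L f x))\<^sup>2)
      \<le> (LINT x|lebesgue_on {0..L}. (norm (wderiv L f x - k (left_node N x)))\<^sup>2)" .
qed

lemma director_interpolant:
  assumes L: "0 < L" and N: "node_set L N" and b: "b \<in> H1 L"
  shows "\<exists>bh. bh \<in> H1 L \<and> (\<forall>z\<in>N. bh z = b z) \<and> (\<forall>z z'. neighbours N z z' \<longrightarrow> polynomial_on 1 {z..z'} bh) \<and>
    (\<forall>k. (LINT x|lebesgue_on {0..L}. (norm (wderiv L bh x - wderiv L b x))\<^sup>2)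
      \<le> (LINT x|lebesgue_on {0..L}. (norm (wderiv L b x - k (left_node N x)))\<^sup>2))"
proof -
  \<comment> \<open>The mean of the derivative of b, that is, its projection onto constants;
    integrated back, it is the slope of the nodal interpolant.\<close>
  define a where "a z z' = (1 / (z' - z)) *\<^sub>R integral {z..z'} (wderiv L b)" for z z'
  have m0: "integral {z..z'} (\<lambda>x. a z z' + x *\<^sub>R 0 - wderiv L b x) = 0" if nb: "neighbours N z z'" for z z'
  proof -
    note I = neighbours_Icc[OF N nb]
    have "integral {z..z'} (\<lambda>x. a z z' - wderiv L b x) = (z' - z) *\<^sub>R a z z' - integral {z..z'} (wderiv L b)"
      using I by (subst Henstock_Kurzweil_Integration.integral_diff)
        (auto intro: integrable_imp_integrable_on_Icc(1)[OF wderiv_integrable[OF b]])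
    also have "\<dots> = 0" using I(3) by (simp add: a_def)
    finally show ?thesis by simp
  qed
  let ?e = "\<lambda>(z::real) (z'::real). 0 :: real^3"
  have "\<forall>z z'. neighbours N z z' \<longrightarrow> integral {z..z'} (\<lambda>x. a z z' + x *\<^sub>R ?e z z' - wderiv L b x) = 0 \<and>
      (?e z z' = 0 \<or> integral {z..z'} (\<lambda>x. x *\<^sub>R (a z z' + x *\<^sub>R ?e z z' - wderiv L b x)) = 0)"
    using m0 by blast
  note F = H1_interpolant[OF L N b this]
  show ?thesis
  proof (intro exI[of _ "\<lambda>x. b 0 + integral {0..x} (elementwise_affine N a ?e)"] conjI allI impI ballI)
    fix z z' assume nb: "neighbours N z z'"
    note I = neighbours_Icc[OF N nb]
    have "polynomial_on (Suc 0) {z..z'} (\<lambda>x. b 0 + integral {0..x} (elementwise_affine N a ?e))"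
    proof (rule polynomial_on_primitive[where h="elementwise_affine N a ?e" and c="\<lambda>_. a z z'"])
      show "z \<le> z'" using I by simp
      show "elementwise_affine N a ?e t = (\<Sum>i\<le>0. t ^ i *\<^sub>R a z z')" if "t \<in> {z<..<z'}" for t
        using elementwise_affine_eq[OF L N nb that, of a ?e] by simp
    qed (rule F(3)[OF nb])
    then show "polynomial_on 1 {z..z'} (\<lambda>x. b 0 + integral {0..x} (elementwise_affine N a ?e))" by simp
  qed (rule F(1,2,4), assumption?)+
qed

lemma H2_FTC:
  assumes "0 < L" "y \<in> H2 L" "0 \<le> a" "a \<le> b" "b \<le> L"
  shows "y b - y a = integral {a..b} (cderiv L y)"
  using weak_deriv_FTC[OF H1_continuous[OF H2_D(1)[OF assms(1,2)]] _ H2_D(4)[OF assms(1,2)] assms(3-5)]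
    H1_sq_integrable[OF H2_D(2)[OF assms(1,2)]] by (simp add: L2_fun_iff)

text \<open>The tangent p interpolates the derivative of y at the nodes with an affine derivative on
  each element. Vanishing first moments make the integrals of p and of the derivative of y agree on
  every element, so the interpolant also arrives at \<open>y L\<close>.\<close>

lemma curve_interpolant:
  assumes L: "0 < L" and N: "node_set L N" and y: "y \<in> H2 L"
  shows "\<exists>yh. yh \<in> H2 L \<and> yh 0 = y 0 \<and> yh L = y L \<and> (\<forall>z\<in>N. cderiv L yh z = cderiv L y z) \<and>
    (\<forall>z z'. neighbours N z z' \<longrightarrow> polynomial_on 3 {z..z'} yh) \<and>
    (\<forall>k. (LINT x|lebesgue_on {0..L}. (norm (wderiv2 L yh x - wderiv2 L y x))\<^sup>2)
      \<le> (LINT x|lebesgue_on {0..L}. (norm (wderiv2 L y x - k (left_node N x)))\<^sup>2))"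
proof -
  let ?t = "cderiv L y" and ?g = "wderiv2 L y"
  note t = H2_D(2)[OF L y]
  note gs = wderiv(3)[OF t]
  have xgi: "integrable (lebesgue_on {0..L}) (\<lambda>x. x *\<^sub>R ?g x)"
    by (intro test_function_product_integrable continuous_intros wderiv_integrable t)
  have "\<forall>w. \<exists>u. neighbours N (fst w) (snd w) \<longrightarrow>
      integral {fst w..snd w} (\<lambda>x. fst u + x *\<^sub>R snd u - ?g x) = 0 \<and>
      integral {fst w..snd w} (\<lambda>x. x *\<^sub>R (fst u + x *\<^sub>R snd u - ?g x)) = 0"
  proof
    fix w
    show "\<exists>u. neighbours N (fst w) (snd w) \<longrightarrow>
      integral {fst w..snd w} (\<lambda>x. fst u + x *\<^sub>R snd u - ?g x) = 0 \<and>
      integral {fst w..snd w} (\<lambda>x. x *\<^sub>R (fst u + x *\<^sub>R snd u - ?g x)) = 0"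
    proof (cases "neighbours N (fst w) (snd w)")
      case True
      note I = neighbours_Icc[OF N True]
      obtain a e where "integral {fst w..snd w} (\<lambda>x. a + x *\<^sub>R e - ?g x) = 0 \<and>
          integral {fst w..snd w} (\<lambda>x. x *\<^sub>R (a + x *\<^sub>R e - ?g x)) = 0"
        using affine_projection_exists[OF I(3) integrable_imp_integrable_on_Icc(1)[OF wderiv_integrable[OF t] I(1,2)]
            integrable_imp_integrable_on_Icc(1)[OF xgi I(1,2)]] by (elim exE)
      then show ?thesis by (intro exI[of _ "(a, e)"]) simp
    qed simp
  qed
  \<comment> \<open>Choosing over pairs of endpoints fixes the coefficients of all elements
    simultaneously; pairs that are not neighbours carry no condition.\<close>
  from choice[OF this] obtain f where f: "\<forall>w. neighbours N (fst w) (snd w) \<longrightarrow>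
      integral {fst w..snd w} (\<lambda>x. fst (f w) + x *\<^sub>R snd (f w) - ?g x) = 0 \<and>
      integral {fst w..snd w} (\<lambda>x. x *\<^sub>R (fst (f w) + x *\<^sub>R snd (f w) - ?g x)) = 0" ..
  define a e where "a z z' = fst (f (z, z'))" and "e z z' = snd (f (z, z'))" for z z'
  have m0: "integral {z..z'} (\<lambda>x. a z z' + x *\<^sub>R e z z' - ?g x) = 0"
    and m1': "integral {z..z'} (\<lambda>x. x *\<^sub>R (a z z' + x *\<^sub>R e z z' - ?g x)) = 0" if "neighbours N z z'" for z z'
    using f[rule_format, of "(z, z')"] that by (simp_all only: fst_conv snd_conv a_def e_def)
  have m: "\<forall>z z'. neighbours N z z' \<longrightarrow> integral {z..z'} (\<lambda>x. a z z' + x *\<^sub>R e z z' - ?g x) = 0 \<and>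
      (e z z' = 0 \<or> integral {z..z'} (\<lambda>x. x *\<^sub>R (a z z' + x *\<^sub>R e z z' - ?g x)) = 0)"
    by (intro allI impI conjI disjI2 m0 m1')
  let ?A = "elementwise_affine N a e"
  define p where "p x = ?t 0 + integral {0..x} ?A" for x
  note F = H1_interpolant[OF L N t m, folded p_def]
  have pH1: "p \<in> H1 L" using F(1) unfolding p_def[abs_def] .
  note pc = H1_continuous[OF pH1]
  define yh where "yh x = y 0 + integral {0..x} p" for x
  have d: "(yh has_vector_derivative p x) (at x within {0..L})" if "x \<in> {0..L}" for x
    unfolding yh_def[abs_def] using integral_has_vector_derivative[OF pc that]
    by (auto intro!: derivative_eq_intros)
  have H2: "yh \<in> H2 L" by (rule H2_I(1)[OF L pH1]) (rule d)
  have cd: "cderiv L yh x = p x" if "x \<in> {0..L}" for x by (rule H2_I(2)[OF L pH1 _ that]) (rule d)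
  have wd: "wderiv2 L yh = wderiv L p" by (rule H2_I(3)[OF L pH1]) (rule d)
  have NL: "0 \<in> N" "L \<in> N" "N \<subseteq> {0..L}" using N by (auto simp: node_set_def)
  have el: "integral {z..z'} (\<lambda>x. p x - ?t x) = 0" if nb: "neighbours N z z'" for z z'
  proof -
    note I = neighbours_Icc[OF N nb]
    have As: "sq_integrable (lebesgue_on {0..L}) (\<lambda>x. ?A x - ?g x)"
      by (rule sq_integrable_diff[OF elementwise_affine_sq_integrable[OF L N] gs])
    note Ai = integrable_imp_integrable_on_Icc(1)[OF elementwise_affine_integrable[OF L N]]
      and gi = integrable_imp_integrable_on_Icc(1)[OF wderiv_integrable[OF t]]
    have r: "p x - ?t x = integral {z..x} (\<lambda>x. ?A x - ?g x)" if x: "x \<in> {z..z'}" for x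
    proof -
      have px: "p x = p z + integral {z..x} ?A" using F(3)[OF nb x] .
      have "?t x - ?t z = integral {z..x} ?g" by (rule H1_FTC[OF t]) (use I x in auto)
      then have tx: "?t x = ?t z + integral {z..x} ?g" by (simp add: diff_eq_eq add.commute)
      have "integral {z..x} (\<lambda>x. ?A x - ?g x) = integral {z..x} ?A - integral {z..x} ?g"
        by (rule Henstock_Kurzweil_Integration.integral_diff[OF Ai gi]) (use I x in auto)
      then show ?thesis using px tx F(2)[OF neighboursD(1)[OF nb]] by simp
    qed
    have "integral {z..z'} (\<lambda>x. p x - ?t x) = integral {z..z'} (\<lambda>x. integral {z..x} (\<lambda>x. ?A x - ?g x))"
      by (rule Henstock_Kurzweil_Integration.integral_cong) (rule r)
    also have "\<dots> = integral {z..z'} (\<lambda>x. (z' - x) *\<^sub>R (?A x - ?g x))"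
      by (rule integral_primitive[OF As]) (use I in auto)
    \<comment> \<open>The kernel z' - x splits into its constant and linear parts, so that precisely
      the two vanishing moments appear.\<close>
    also have "\<dots> = integral {z..z'} (\<lambda>x. z' *\<^sub>R (a z z' + x *\<^sub>R e z z' - ?g x) - x *\<^sub>R (a z z' + x *\<^sub>R e z z' - ?g x))"
    proof (rule integral_spike[of "{z, z'}"])
      fix x assume "x \<in> {z..z'} - {z, z'}"
      then have x: "x \<in> {z<..<z'}" by auto
      show "z' *\<^sub>R (a z z' + x *\<^sub>R e z z' - ?g x) - x *\<^sub>R (a z z' + x *\<^sub>R e z z' - ?g x) = (z' - x) *\<^sub>R (?A x - ?g x)"
        unfolding elementwise_affine_eq[OF L N nb x] by (simp only: scaleR_diff_left)
    qed simp
    also have "\<dots> = z' *\<^sub>R integral {z..z'} (\<lambda>x. a z z' + x *\<^sub>R e z z' - ?g x)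
        - integral {z..z'} (\<lambda>x. x *\<^sub>R (a z z' + x *\<^sub>R e z z' - ?g x))"
    proof -
      let ?w = "\<lambda>x. a z z' + x *\<^sub>R e z z' - ?g x"
      have ws: "sq_integrable (lebesgue_on {0..L}) ?w"
        by (intro sq_integrable_diff continuous_on_imp_sq_integrable gs continuous_intros)
      note wi = sq_integrable_imp_integrable[OF finite_measure_Icc ws]
      have 1: "?w integrable_on {z..z'}" by (rule integrable_imp_integrable_on_Icc(1)[OF wi I(1,2)])
      have 2: "(\<lambda>x. x *\<^sub>R ?w x) integrable_on {z..z'}"
        by (intro integrable_imp_integrable_on_Icc(1)[OF _ I(1,2)] test_function_product_integrable continuous_intros wi)
      show ?thesis
        unfolding Henstock_Kurzweil_Integration.integral_diff[OF integrable_cmul[OF 1] 2] by simp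
    qed
    also have "\<dots> = 0" using m0[OF nb] m1'[OF nb] by simp
    finally show ?thesis .
  qed
  have "integral {0..L} (\<lambda>x. p x - ?t x) = 0"
    by (rule elementwise_integral_zero[OF N _ el NL(2)])
      (intro continuous_imp_integrable_real continuous_on_diff pc H1_continuous t)
  then have "integral {0..L} p = integral {0..L} ?t"
    using Henstock_Kurzweil_Integration.integral_diff[OF integrable_continuous_interval[OF pc]
      integrable_continuous_interval[OF H1_continuous[OF t]]] by simp
  moreover have "y L = y 0 + integral {0..L} ?t"
    using H2_FTC[OF L y, of 0 L] L by (simp add: diff_eq_eq add.commute)
  ultimately have yL: "yh L = y L" by (simp add: yh_def)
  show ?thesis
  proof (intro exI[of _ yh] conjI allI impI ballI H2 yL)
    show "yh 0 = y 0" by (simp add: yh_def)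
    show "cderiv L yh z = cderiv L y z" if "z \<in> N" for z
      using cd[of z] F(2)[OF that] NL(3) that by auto
    show "(LINT x|lebesgue_on {0..L}. (norm (wderiv2 L yh x - wderiv2 L y x))\<^sup>2)
      \<le> (LINT x|lebesgue_on {0..L}. (norm (wderiv2 L y x - k (left_node N x)))\<^sup>2)" for k
      unfolding wd using F(4)[of k] unfolding p_def[abs_def] .
  next
    fix z z' assume nb: "neighbours N z z'"
    note I = neighbours_Icc[OF N nb]
    have "polynomial_on (Suc 1) {z..z'} p"
    proof (rule polynomial_on_primitive[where h="?A" and c="\<lambda>i. if i = 0 then a z z' else e z z'"])
      show "z \<le> z'" using I by simp
      show "?A x = (\<Sum>i\<le>1. x ^ i *\<^sub>R (if i = 0 then a z z' else e z z'))" if "x \<in> {z<..<z'}" for x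
        using elementwise_affine_eq[OF L N nb that, of a e] by simp
    qed (rule F(3)[OF nb])
    then obtain c where c: "\<forall>x\<in>{z..z'}. p x = (\<Sum>i\<le>Suc 1. x ^ i *\<^sub>R c i)" unfolding polynomial_on_def by blast
    have "polynomial_on (Suc (Suc 1)) {z..z'} yh"
    proof (rule polynomial_on_primitive[where h=p and c=c])
      show "z \<le> z'" using I by simp
      show "p x = (\<Sum>i\<le>Suc 1. x ^ i *\<^sub>R c i)" if "x \<in> {z<..<z'}" for x using c that by auto
      show "yh x = yh z + integral {z..x} p" if x: "x \<in> {z..z'}" for x
        using integral_Icc_combine[OF continuous_imp_integrable_real[OF pc], of 0 z x] I x by (simp add: yh_def)
    qed
    then show "polynomial_on 3 {z..z'} yh" by (simp add: numeral_3_eq_3)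
  qed
qed

text \<open>The projection error is at most the distance to every sampled function k. Choosing k
  continuous and close to g, uniform continuity controls k minus its samples once the mesh is
  fine.\<close>

lemma elementwise_constants_dense:
  fixes g :: curve
  assumes L: "0 < L" and N: "\<And>n. node_set L (N n)" and mesh: "(\<lambda>n. mesh_size (N n)) \<longlonglongrightarrow> 0"
    and g: "sq_integrable (lebesgue_on {0..L}) g" and X: "\<And>n. 0 \<le> X n"
      "\<And>n k. X n \<le> (LINT x|lebesgue_on {0..L}. (norm (g x - k (left_node (N n) x)))\<^sup>2)"
  shows "X \<longlonglongrightarrow> 0"
proof (rule LIMSEQ_I)
  let ?M = "lebesgue_on {0..L}"
  fix \<eta> :: real assume \<eta>: "0 < \<eta>"
  then have "0 < \<eta> / 8" by simp
  from sq_integrable_approx_continuous[OF g this]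
  obtain k where k: "continuous_on UNIV k" "(LINT x|?M. (norm (g x - k x))\<^sup>2) < \<eta> / 8" by blast
  \<comment> \<open>Chosen so that \<open>L * r\<^sup>2 = \<eta> / 8\<close>; the two errors, each
    doubled, add up to less than \<eta>.\<close>
  define r where "r = sqrt (\<eta> / (8 * L))"
  have r: "0 < r" using \<eta> L by (simp add: r_def)
  have "uniformly_continuous_on {0..L} k"
    by (rule compact_uniformly_continuous[OF continuous_on_subset[OF k(1)]]) auto
  then obtain \<delta> where \<delta>: "0 < \<delta>" "\<And>x x'. x \<in> {0..L} \<Longrightarrow> x' \<in> {0..L} \<Longrightarrow> dist x' x < \<delta> \<Longrightarrow> dist (k x') (k x) < r"
    unfolding uniformly_continuous_on_def using r by metis
  obtain n0 where n0: "\<And>n. n \<ge> n0 \<Longrightarrow> norm (mesh_size (N n) - 0) < \<delta>"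
    using LIMSEQ_D[OF mesh \<delta>(1)] by blast
  have "norm (X n - 0) < \<eta>" if n: "n \<ge> n0" for n
  proof -
    let ?P = "\<lambda>x. k (left_node (N n) x)"
    have P_eq: "elementwise_affine (N n) (\<lambda>z z'. k z) (\<lambda>z z'. 0) = ?P"
      by (auto simp: elementwise_affine_def)
    have Ps: "sq_integrable ?M ?P"
      using elementwise_affine_sq_integrable[OF L N, of n "\<lambda>z z'. k z" "\<lambda>z z'. 0"] unfolding P_eq .
    have ks: "sq_integrable ?M k" by (rule continuous_on_imp_sq_integrable[OF continuous_on_subset[OF k(1)]]) simp
    have "(LINT x|?M. (norm (k x - ?P x))\<^sup>2) \<le> (LINT x|?M. r\<^sup>2)"
    proof (rule integral_mono)
      fix x assume "x \<in> space ?M"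
      then have x: "x \<in> {0..L}" by simp
      have "left_node (N n) x \<in> {0..L}" using left_right_node(1)[OF N x, of n] N[of n] by (auto simp: node_set_def)
      moreover have "dist x (left_node (N n) x) < \<delta>"
        using left_right_node_dist(1)[OF N L x, of n] n0[OF n] by (simp add: dist_real_def)
      ultimately have "dist (k x) (?P x) < r" using x by (intro \<delta>(2))
      then have "norm (k x - ?P x) \<le> r" by (simp add: dist_norm)
      then show "(norm (k x - ?P x))\<^sup>2 \<le> r\<^sup>2" by (intro power_mono) auto
    qed (use sq_integrable_norm_sq[OF sq_integrable_diff[OF ks Ps]] in auto)
    also have "\<dots> = \<eta> / 8" using measure_lebesgue_on_Icc[of L] L \<eta> by (simp add: r_def)
    finally have 1: "(LINT x|?M. (norm (k x - ?P x))\<^sup>2) \<le> \<eta> / 8" .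
    have "X n \<le> (LINT x|?M. (norm (g x - ?P x))\<^sup>2)" by (rule X(2))
    also have "\<dots> = (LINT x|?M. (norm ((g x - k x) + (k x - ?P x)))\<^sup>2)" by simp
    also have "\<dots> \<le> 2 * (LINT x|?M. (norm (g x - k x))\<^sup>2) + 2 * (LINT x|?M. (norm (k x - ?P x))\<^sup>2)"
      by (rule integral_norm_sq_add_le[OF sq_integrable_diff[OF g ks] sq_integrable_diff[OF ks Ps]])
    also have "\<dots> < \<eta>" using 1 k(2) \<eta> by linarith
    finally show ?thesis using X(1)[of n] by simp
  qed
  then show "\<exists>no. \<forall>n\<ge>no. norm (X n - 0) < \<eta>" by blast
qed

section \<open>Recovery sequences\<close>

lemma weakly_converges_const: "v \<in> X \<Longrightarrow> weakly_converges X nrm (\<lambda>_. v) v"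
  by (simp add: weakly_converges_def)

text \<open>Strong convergence of the highest derivatives carries every quadratic term to the limit,
  including the subtracted one. Nodal orthogonality makes the penalty vanish identically, whatever
  the values of \<epsilon>.\<close>

lemma (in discrete_sequence) energy_convergence:
  assumes p: "(\<lambda>n. LINT x|M. (norm (wderiv2 L (yh n) x - wderiv2 L y x))\<^sup>2) \<longlonglongrightarrow> 0"
    and q: "(\<lambda>n. LINT x|M. (norm (wderiv L (bh n) x - wderiv L b x))\<^sup>2) \<longlonglongrightarrow> 0"
    and orth: "\<And>n z. z \<in> N n \<Longrightarrow> cderiv L (yh n) z \<bullet> bh n z = 0"
    and a: "(y, b) \<in> admissible L Lbc lbc"
  shows "(\<lambda>n. discrete_energy L \<kappa> \<theta> (N n) (\<epsilon> n) (yh n) (bh n)) \<longlonglongrightarrow> rod_energy L \<kappa> y b"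
proof -
  have sp: "sq_integrable M (wderiv2 L y)" "\<And>n. sq_integrable M (wderiv2 L (yh n))"
    by (rule wderiv(3) t_H1 th_H1)+
  have sq: "sq_integrable M (wderiv L b)" "\<And>n. sq_integrable M (wderiv L (bh n))"
    by (rule wderiv(3) b_H1 bh_H1)+
  have pen0: "(LINT x|M. pen n x) = 0" for n
  proof (intro integral_eq_zero_AE AE_I2)
    fix x assume "x \<in> space M"
    then have x: "x \<in> {0..L}" by simp
    show "pen n x = 0"
      using nodal_interp_bounds[OF N x, of n 0 "\<lambda>t. (cderiv L (yh n) t \<bullet> bh n t)\<^sup>2" 0] orth by simp
  qed
  note Qc = Q_meas H1_measurable[OF b_H1] Q_bound Q_lim
  note dc = d_meas d0_meas d_bound d_lim
  note lims = tendsto_norm_sq_of_strong[OF sp(2,1) p] tendsto_norm_sq_of_strong[OF sq(2,1) q]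
    proj_strong_square_convergence[OF Qc sp(2,1) p p_weak y_bound]
    proj_strong_square_convergence[OF dc sq(2,1) q q_weak b_bound]
  show ?thesis
    unfolding discrete_energy_def rod_energy_split[OF L a, of \<kappa> \<theta>] pen0 mult_zero_right add_0_right
    by (intro tendsto_add tendsto_diff tendsto_mult tendsto_const lims)
qed

text \<open>Stability of a projection from its error estimate: with the competitor
  \<open>k = 0\<close> the error is at most the norm of w, and the factor 4 comes from doubling both
  squares.\<close>

lemma sq_integral_le_of_diff:
  assumes v: "sq_integrable M v" "sq_integrable M w"
    and le: "(LINT x|M. (norm (v x - w x))\<^sup>2) \<le> (LINT x|M. (norm (w x - 0))\<^sup>2)"
  shows "(LINT x|M. (norm (v x))\<^sup>2) \<le> 4 * (LINT x|M. (norm (w x))\<^sup>2)"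
  using integral_norm_sq_add_le[OF sq_integrable_diff[OF v] v(2)] le by simp

text \<open>Interpolation preserves all six boundary vectors and all nodal tangents and directors.
  Admissibility is therefore inherited exactly, and only strong convergence of the derivatives
  remains to be shown.\<close>

lemma recovery_sequence:
  fixes Lbc :: "curve \<Rightarrow> curve \<Rightarrow> 'y::real_vector"
  assumes L: "0 < L" and bo: "boundary_operator L Lbc"
    and N: "\<And>n. node_set L (N n)" and mesh: "(\<lambda>n. mesh_size (N n)) \<longlonglongrightarrow> 0"
    and a: "(y, b) \<in> admissible L Lbc lbc"
  shows "\<exists>yh bh. weakly_H2 L yh y \<and> weakly_H1 L bh b \<and> (\<forall>n. (yh n, bh n) \<in> admissible_h L (N n) Lbc lbc) \<and>
    (\<lambda>n. discrete_energy L \<kappa> \<theta> (N n) (\<epsilon> n) (yh n) (bh n)) \<longlonglongrightarrow> rod_energy L \<kappa> y b"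
proof -
  have y: "y \<in> H2 L" and b: "b \<in> H1 L" and bc: "Lbc y b = lbc"
    and u: "\<And>x. x \<in> {0..L} \<Longrightarrow> norm (cderiv L y x) = 1 \<and> norm (b x) = 1 \<and> cderiv L y x \<bullet> b x = 0"
    using a by (auto simp: admissible_def)
  have "\<forall>n. \<exists>yh. yh \<in> H2 L \<and> yh 0 = y 0 \<and> yh L = y L \<and> (\<forall>z\<in>N n. cderiv L yh z = cderiv L y z) \<and>
    (\<forall>z z'. neighbours (N n) z z' \<longrightarrow> polynomial_on 3 {z..z'} yh) \<and>
    (\<forall>k. (LINT x|lebesgue_on {0..L}. (norm (wderiv2 L yh x - wderiv2 L y x))\<^sup>2)
      \<le> (LINT x|lebesgue_on {0..L}. (norm (wderiv2 L y x - k (left_node (N n) x)))\<^sup>2))"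
    by (intro allI curve_interpolant L N y)
  from choice[OF this] obtain yh where yh: "\<forall>n. yh n \<in> H2 L \<and> yh n 0 = y 0 \<and> yh n L = y L \<and> (\<forall>z\<in>N n. cderiv L (yh n) z = cderiv L y z) \<and>
    (\<forall>z z'. neighbours (N n) z z' \<longrightarrow> polynomial_on 3 {z..z'} (yh n)) \<and>
    (\<forall>k. (LINT x|lebesgue_on {0..L}. (norm (wderiv2 L (yh n) x - wderiv2 L y x))\<^sup>2)
      \<le> (LINT x|lebesgue_on {0..L}. (norm (wderiv2 L y x - k (left_node (N n) x)))\<^sup>2))" ..
  have "\<forall>n. \<exists>bh. bh \<in> H1 L \<and> (\<forall>z\<in>N n. bh z = b z) \<and> (\<forall>z z'. neighbours (N n) z z' \<longrightarrow> polynomial_on 1 {z..z'} bh) \<and>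
    (\<forall>k. (LINT x|lebesgue_on {0..L}. (norm (wderiv L bh x - wderiv L b x))\<^sup>2)
      \<le> (LINT x|lebesgue_on {0..L}. (norm (wderiv L b x - k (left_node (N n) x)))\<^sup>2))"
    by (intro allI director_interpolant L N b)
  from choice[OF this] obtain bh where bh: "\<forall>n. bh n \<in> H1 L \<and> (\<forall>z\<in>N n. bh n z = b z) \<and> (\<forall>z z'. neighbours (N n) z z' \<longrightarrow> polynomial_on 1 {z..z'} (bh n)) \<and>
    (\<forall>k. (LINT x|lebesgue_on {0..L}. (norm (wderiv L (bh n) x - wderiv L b x))\<^sup>2)
      \<le> (LINT x|lebesgue_on {0..L}. (norm (wderiv L b x - k (left_node (N n) x)))\<^sup>2))" ..
  have yh': "yh n \<in> H2 L" "yh n 0 = y 0" "yh n L = y L" "\<And>z. z \<in> N n \<Longrightarrow> cderiv L (yh n) z = cderiv L y z"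
    "\<And>z z'. neighbours (N n) z z' \<Longrightarrow> polynomial_on 3 {z..z'} (yh n)"
    "(LINT x|lebesgue_on {0..L}. (norm (wderiv2 L (yh n) x - wderiv2 L y x))\<^sup>2)
      \<le> (LINT x|lebesgue_on {0..L}. (norm (wderiv2 L y x - k (left_node (N n) x)))\<^sup>2)" for n k
    using spec[OF yh, of n] by (elim conjE; blast)+
  have bh': "bh n \<in> H1 L" "\<And>z. z \<in> N n \<Longrightarrow> bh n z = b z"
    "\<And>z z'. neighbours (N n) z z' \<Longrightarrow> polynomial_on 1 {z..z'} (bh n)"
    "(LINT x|lebesgue_on {0..L}. (norm (wderiv L (bh n) x - wderiv L b x))\<^sup>2)
      \<le> (LINT x|lebesgue_on {0..L}. (norm (wderiv L b x - k (left_node (N n) x)))\<^sup>2)" for n k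
    using spec[OF bh, of n] by (elim conjE; blast)+
  note ps = wderiv(3)[OF H2_D(2)[OF L y]] and qs = wderiv(3)[OF b]
  have p: "(\<lambda>n. LINT x|lebesgue_on {0..L}. (norm (wderiv2 L (yh n) x - wderiv2 L y x))\<^sup>2) \<longlonglongrightarrow> 0"
    by (rule elementwise_constants_dense[OF L N mesh ps _ yh'(6)]) simp
  have q: "(\<lambda>n. LINT x|lebesgue_on {0..L}. (norm (wderiv L (bh n) x - wderiv L b x))\<^sup>2) \<longlonglongrightarrow> 0"
    by (rule elementwise_constants_dense[OF L N mesh qs _ bh'(4)]) simp
  have N0: "0 \<in> N n" "L \<in> N n" "N n \<subseteq> {0..L}" for n using N[of n] by (auto simp: node_set_def)
  have wy: "weakly_H2 L yh y"
    by (rule weakly_H2_of_strong[OF L yh'(1) y yh'(2) yh'(4)[OF N0(1)] p])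
  have wb: "weakly_H1 L bh b"
    by (rule weakly_H1_of_strong[OF less_imp_le[OF L] bh'(1) b bh'(2)[OF N0(1)] q])
  have adm: "(yh n, bh n) \<in> admissible_h L (N n) Lbc lbc" for n
  proof -
    obtain \<Lambda> :: "(real^3) \<times> (real^3) \<times> (real^3) \<times> (real^3) \<times> (real^3) \<times> (real^3) \<Rightarrow> 'y"
      where *: "linear \<Lambda> \<and> (\<forall>y\<in>H2 L. \<forall>b\<in>H1 L.
        Lbc y b = \<Lambda> (y 0, y L, cderiv L y 0, cderiv L y L, b 0, b L))"
      using bo unfolding boundary_operator_def ..
    have \<Lambda>: "Lbc y b = \<Lambda> (y 0, y L, cderiv L y 0, cderiv L y L, b 0, b L)" if "y \<in> H2 L" "b \<in> H1 L" for y b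
      using bspec[OF bspec[OF conjunct2[OF *] that(1)] that(2)] .
    have "Lbc (yh n) (bh n) = Lbc y b"
      unfolding \<Lambda>[OF yh'(1) bh'(1)] \<Lambda>[OF y b] by (simp only: yh'(2,3) yh'(4)[OF N0(1)] yh'(4)[OF N0(2)] bh'(2)[OF N0(1)] bh'(2)[OF N0(2)])
    moreover have "(yh n, bh n) \<in> V_rod L (N n)"
    proof -
      have "yh n differentiable at x within {0..L}" if "x \<in> {0..L}" for x
        by (rule differentiableI_vector[OF H2_D(3)[OF L yh'(1) that]])
      then show ?thesis
        unfolding V_rod_def using H1_continuous[OF H2_D(2)[OF L yh'(1)[of n]]] H1_continuous[OF bh'(1)[of n]]
          yh'(5)[of n] bh'(3)[of n] by auto
    qed
    moreover have "norm (cderiv L (yh n) z) = 1 \<and> norm (bh n z) = 1" if "z \<in> N n" for z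
      unfolding yh'(4)[OF that] bh'(2)[OF that] using u[of z] N0(3)[of n] that by blast
    ultimately show ?thesis unfolding admissible_h_def using bc by simp
  qed
  define K where "K = max (4 * (LINT x|lebesgue_on {0..L}. (norm (wderiv2 L y x))\<^sup>2)) (4 * (LINT x|lebesgue_on {0..L}. (norm (wderiv L b x))\<^sup>2))"
  interpret discrete_sequence L N Lbc lbc yh bh y b K
  proof
    show "(LINT x|lebesgue_on {0..L}. (norm (wderiv2 L (yh n) x))\<^sup>2) \<le> K" for n
      unfolding K_def
      by (rule max.coboundedI1, rule sq_integral_le_of_diff[OF wderiv(3)[OF H2_D(2)[OF L yh'(1)]] ps yh'(6)[where k="\<lambda>_. 0"]])
    show "(LINT x|lebesgue_on {0..L}. (norm (wderiv L (bh n) x))\<^sup>2) \<le> K" for n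
      unfolding K_def
      by (rule max.coboundedI2, rule sq_integral_le_of_diff[OF wderiv(3)[OF bh'(1)] qs bh'(4)[where k="\<lambda>_. 0"]])
  qed (fact L bo N mesh wy wb adm)+
  have orth: "cderiv L (yh n) z \<bullet> bh n z = 0" if "z \<in> N n" for n z
    unfolding yh'(4)[OF that] bh'(2)[OF that] using u[of z] N0(3)[of n] that by blast
  have "(\<lambda>n. discrete_energy L \<kappa> \<theta> (N n) (\<epsilon> n) (yh n) (bh n)) \<longlonglongrightarrow> rod_energy L \<kappa> y b"
    by (rule energy_convergence[OF p q orth a])
  with wy wb adm show ?thesis by (intro exI[of _ yh] exI[of _ bh] conjI allI)
qed

lemma limsup_inequality:
  fixes Lbc :: "curve \<Rightarrow> curve \<Rightarrow> 'y::real_vector"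
  assumes L: "0 < L" and bo: "boundary_operator L Lbc"
    and N: "\<And>n. node_set L (N n)" and mesh: "(\<lambda>n. mesh_size (N n)) \<longlonglongrightarrow> 0"
    and y: "y \<in> H2 L" and b: "b \<in> H1 L"
  shows "\<exists>yh bh. weakly_H2 L yh y \<and> weakly_H1 L bh b \<and>
    limsup (\<lambda>n. I_rod_h L \<kappa> \<theta> Lbc lbc (N n) (\<epsilon> n) (yh n) (bh n)) \<le> I_rod L \<kappa> Lbc lbc y b"
proof (cases "(y, b) \<in> admissible L Lbc lbc")
  case False
  \<comment> \<open>The energy bound is trivial in this case, but a weakly convergent sequence still
    has to be exhibited; the constant one serves.\<close>
  then have "I_rod L \<kappa> Lbc lbc y b = \<infinity>" by (simp add: I_rod_eq)
  then show ?thesis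
    by (intro exI[of _ "\<lambda>_. y"] exI[of _ "\<lambda>_. b"] conjI weakly_converges_const y b) simp
next
  case True
  obtain yh bh where w: "weakly_H2 L yh y" "weakly_H1 L bh b"
    and adm: "\<forall>n. (yh n, bh n) \<in> admissible_h L (N n) Lbc lbc"
    and lim: "(\<lambda>n. discrete_energy L \<kappa> \<theta> (N n) (\<epsilon> n) (yh n) (bh n)) \<longlonglongrightarrow> rod_energy L \<kappa> y b"
    using recovery_sequence[OF L bo N mesh True, of \<kappa> \<theta> \<epsilon>] by (elim exE conjE)
  have "(\<lambda>n. I_rod_h L \<kappa> \<theta> Lbc lbc (N n) (\<epsilon> n) (yh n) (bh n))
      = (\<lambda>n. ereal (discrete_energy L \<kappa> \<theta> (N n) (\<epsilon> n) (yh n) (bh n)))"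
    using adm by (simp add: I_rod_h_eq)
  moreover have "limsup (\<lambda>n. ereal (discrete_energy L \<kappa> \<theta> (N n) (\<epsilon> n) (yh n) (bh n))) = ereal (rod_energy L \<kappa> y b)"
    using lim by (intro lim_imp_Limsup) auto
  ultimately have "limsup (\<lambda>n. I_rod_h L \<kappa> \<theta> Lbc lbc (N n) (\<epsilon> n) (yh n) (bh n)) \<le> I_rod L \<kappa> Lbc lbc y b"
    using True by (simp add: I_rod_eq)
  with w show ?thesis by (intro exI[of _ yh] exI[of _ bh] conjI)
qed

theorem proposition4p1:
  fixes L \<kappa> \<theta> :: real
    and Lbc :: "curve \<Rightarrow> curve \<Rightarrow> 'y::real_vector" and lbc :: 'y
    and H :: "real set" and N :: "real \<Rightarrow> real set"
  assumes "L > 0" and "\<kappa> > 0" and "\<theta> = min (\<kappa> / 2) 1"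
    and "\<exists>B. finite B \<and> span B = (UNIV :: 'y set)"
    and "boundary_operator L Lbc"
    and "admissible L Lbc lbc \<noteq> {}"
    and "\<exists>(y, b)\<in>admissible L Lbc lbc. dist (y 0) (y L) < L"
    and "\<And>h. h \<in> H \<Longrightarrow> node_set L (N h) \<and> mesh_size (N h) = h"
  shows "\<forall>h \<epsilon> :: nat \<Rightarrow> real.
    (\<forall>n. h n \<in> H) \<and> h \<longlonglongrightarrow> 0 \<and> (\<forall>n. \<epsilon> n > 0) \<and> \<epsilon> \<longlonglongrightarrow> 0 \<longrightarrow>
      (\<forall>yh bh y b. weakly_H2 L yh y \<and> weakly_H1 L bh b \<longrightarrow>
         I_rod L \<kappa> Lbc lbc y b
           \<le> liminf (\<lambda>n. I_rod_h L \<kappa> \<theta> Lbc lbc (N (h n)) (\<epsilon> n) (yh n) (bh n))) \<and>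
      (\<forall>y\<in>H2 L. \<forall>b\<in>H1 L. \<exists>yh bh. weakly_H2 L yh y \<and> weakly_H1 L bh b \<and>
         limsup (\<lambda>n. I_rod_h L \<kappa> \<theta> Lbc lbc (N (h n)) (\<epsilon> n) (yh n) (bh n))
           \<le> I_rod L \<kappa> Lbc lbc y b)"
proof (intro allI impI, elim conjE)
  fix h \<epsilon> :: "nat \<Rightarrow> real"
  assume h: "\<forall>n. h n \<in> H" "h \<longlonglongrightarrow> 0" and \<epsilon>: "\<forall>n. \<epsilon> n > 0" "\<epsilon> \<longlonglongrightarrow> 0"
  have N: "node_set L (N (h n))" for n using assms(8) h(1) by blast
  have "mesh_size (N (h n)) = h n" for n using assms(8) h(1) by blast
  then have mesh: "(\<lambda>n. mesh_size (N (h n))) \<longlonglongrightarrow> 0" using h(2) by simp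
  have \<epsilon>': "\<epsilon> n > 0" for n using \<epsilon>(1) by blast
  show "(\<forall>yh bh y b. weakly_H2 L yh y \<and> weakly_H1 L bh b \<longrightarrow>
         I_rod L \<kappa> Lbc lbc y b
           \<le> liminf (\<lambda>n. I_rod_h L \<kappa> \<theta> Lbc lbc (N (h n)) (\<epsilon> n) (yh n) (bh n))) \<and>
      (\<forall>y\<in>H2 L. \<forall>b\<in>H1 L. \<exists>yh bh. weakly_H2 L yh y \<and> weakly_H1 L bh b \<and>
         limsup (\<lambda>n. I_rod_h L \<kappa> \<theta> Lbc lbc (N (h n)) (\<epsilon> n) (yh n) (bh n))
           \<le> I_rod L \<kappa> Lbc lbc y b)"
  proof (intro conjI allI impI ballI, elim conjE)
    fix yh bh :: "nat \<Rightarrow> curve" and y b :: curve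
    assume y: "weakly_H2 L yh y" and b: "weakly_H1 L bh b"
    show "I_rod L \<kappa> Lbc lbc y b
        \<le> liminf (\<lambda>n. I_rod_h L \<kappa> \<theta> Lbc lbc (N (h n)) (\<epsilon> n) (yh n) (bh n))"
      by (rule liminf_inequality[where N="\<lambda>n. N (h n)", OF assms(1,2,3,5) N mesh \<epsilon>' \<epsilon>(2) y b])
  next
    fix y b assume y: "y \<in> H2 L" and b: "b \<in> H1 L"
    show "\<exists>yh bh. weakly_H2 L yh y \<and> weakly_H1 L bh b \<and>
         limsup (\<lambda>n. I_rod_h L \<kappa> \<theta> Lbc lbc (N (h n)) (\<epsilon> n) (yh n) (bh n))
           \<le> I_rod L \<kappa> Lbc lbc y b"
      by (rule limsup_inequality[where N="\<lambda>n. N (h n)", OF assms(1,5) N mesh y b])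
  qed
qed

end
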